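(* Let $\dot A$ be the non-negative symmetric Schrödinger operator in $L_2[a,+\infty)$ with deficiency indices $(1,1)$ and $m_\infty(-0)<\infty$ described in the context, and let $\operatorname{Im}h>0$. Let $\Theta$ be an L-system whose state-space operator $\mathbb A=\mathbb A_\mu$ is an accumulative $( * )$-extension of an $\alpha$-sectorial Schrödinger operator $T_h$ with the exact angle of sectoriality $\alpha\in(0,\pi/2)$. Then the associated operator $\tilde{\mathbb A}=\tilde{\mathbb A}_\mu$ is $\alpha$-sectorial (with the same angle of sectoriality $\alpha$ as $T_h$) if and only if $\mu=-m_\infty(-0)$.
   Context: **Schrödinger operators.** Let $\mathcal H=L_2[a,+\infty)$ and $l(y)=-y''+q(x)y$ with $q$ real and locally summable. Let $\dot A y=l(y)$ with boundary conditions $y(a)=y'(a)=0$ be the (closed, densely defined) minimal symmetric operator; it is assumed to have deficiency indices $(1,1)$ and to be non-negative. Then $\mathcal H_+=\operatorname{Dom}(\dot A^* )$ is the set of $y\in L_2[a,+\infty)$ such that $y,y'$ are locally absolutely continuous and $l(y)\in L_2[a,+\infty)$, with inner product $(y,z)_+=\int_a^\infty (y\bar z+l(y)\overline{l(z)})\,dx$. $\mathcal H_+\subset\mathcal H\subset\mathcal H_-$ is the corresponding rigged Hilbert space ($\mathcal H_-$ is the dual of $\mathcal H_+$ with respect to the pairing extending the inner product $(\cdot,\cdot)$ of $\mathcal H$). $[\mathcal H_+,\mathcal H_-]$ is the set of bounded linear operators from $\mathcal H_+$ to $\mathcal H_-$; the adjoint of $\mathbb A\in[\mathcal H_+,\mathcal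 H_-]$ is again in $[\mathcal H_+,\mathcal H_-]$. The functionals $\delta(x-a),\delta'(x-a)\in\mathcal H_-$ act by $(y,\delta(x-a))=y(a)$, $(y,\delta'(x-a))=-y'(a)$. For $h\in\mathbb C$ with $\operatorname{Im}h>0$, $T_h y=l(y)$ with domain $\{y\in\mathcal H_+: y'(a)=hy(a)\}$. **The function $m_\infty$.** Let $\varphi_1,\varphi_2$ solve $l(\varphi_k)=\lambda\varphi_k$ with $\varphi_1(a,\lambda)=0,\ \varphi_1'(a,\lambda)=1$, $\varphi_2(a,\lambda)=-1,\ \varphi_2'(a,\lambda)=0$. $m_\infty(\lambda)$ is the function for which $\varphi_2(x,\lambda)+m_\infty(\lambda)\varphi_1(x,\lambda)\in L_2[a,+\infty)$, and $m_\infty(-0)=\lim_{x\to-0}m_\infty(x)$. It is assumed that $m_\infty(-0)<\infty$. **$( * )$-extensions.** The $( * )$-extensions of $T_h$ are in one-to-one correspondence with the parameters $\mu\in[-\infty,+\infty]$ (with $\pm\infty$ identified); they are the operators $\mathbb A=\mathbb A_\mu\in[\mathcal H_+,\mathcal H_-]$, $$\mathbb A_\mu y=-y''+q(x)y-\frac{1}{\mu-h}\,[y'(a)-hy(a)]\,[\mu\,\delta(x-a)+\delta'(x-a)],$$ with $\mathbb A_{\infty}y=-y''+q(x)y+[hy(a)-y'(a)]\,\delta(x-a)$. $\operatorname{Re}\mathbb A=(\mathbb A+\mathbb A^* )/2$, $\operatorname{Im}\mathbb A=(\mathbb A-\mathbb A^* )/(2i)$. The $( * )$-extension $\mathbb A$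 is called accumulative if $(\operatorname{Re}\mathbb Af,f)\le(\dot A^*f,f)+(f,\dot A^*f)$ for all $f\in\mathcal H_+$. **L-system.** For such $\mathbb A=\mathbb A_\mu$ one has $\operatorname{Im}\mathbb A=KK^*$ with $K:\mathbb C\to\mathcal H_-$, $Kc=cg$, $g=\frac{(\operatorname{Im}h)^{1/2}}{|\mu-h|}[\mu\delta(x-a)+\delta'(x-a)]$. The L-system $\Theta$ is the array consisting of $\mathbb A$ (state-space operator), $K$ (channel operator) and the triplet $\mathcal H_+\subset\mathcal H\subset\mathcal H_-$ with input-output space $\mathbb C$; $T_h$ is its main operator. **Associated operator.** $\tilde{\mathbb A}=2\operatorname{Re}\dot A^*-\mathbb A\in[\mathcal H_+,\mathcal H_-]$, where $\dot A^*$ is regarded as an element of $[\mathcal H_+,\mathcal H_-]$. For $\mathbb A=\mathbb A_\mu$ this is $$\tilde{\mathbb A}_\mu y=-y''+q(x)y-y'(a)\delta(x-a)-y(a)\delta'(x-a)+\frac{1}{\mu-h}[y'(a)-hy(a)]\,[\mu\delta(x-a)+\delta'(x-a)].$$ **Sectoriality.** For $\alpha\in(0,\pi/2)$, an operator $T$ in $\mathcal H$ is $\alpha$-sectorial if $(\cot\alpha)|\operatorname{Im}(Tf,f)|\le\operatorname{Re}(Tf,f)$ for all $f\in\operatorname{Dom}(T)$, and the angle $\alpha$ is exact if $\tan\alpha=\sup_{f\in\operatorname{Dom}(T)}|\operatorname{Im}(Tf,f)|/\operatorname{Re}(Tf,f)$. An operator $\mathbb B\in[\mathcal H_+,\mathcal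 H_-]$ is $\alpha$-sectorial if $(\cot\alpha)|\operatorname{Im}(\mathbb Bf,f)|\le\operatorname{Re}(\mathbb Bf,f)$ for all $f\in\mathcal H_+$. *)

theory Defs
  imports "HOL-Analysis.Analysis"
begin

text \<open>
  Elements of L_2[a,oo) are represented by functions on the real line of which only the values on
  \<^term>\<open>{a..}\<close> matter (almost everywhere).  Every element of H_+ has a unique
  representative that is continuous on \<^term>\<open>{a..}\<close>, and this is the one used below, so
  that boundary values at \<^term>\<open>a\<close> make sense.
\<close>

type_synonym cfun = "real \<Rightarrow> complex"

definition L2 :: "real \<Rightarrow> cfun set" where
  "L2 a = {f. set_borel_measurable lebesgue {a..} f \<and>
              (\<lambda>x. (cmod (f x))\<^sup>2) absolutely_integrable_on {a..}}"

definition ip :: "real \<Rightarrow> cfun \<Rightarrow> cfun \<Rightarrow> complex" where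
  "ip a f g = (LINT x:{a..}|lebesgue. f x * cnj (g x))"

definition abs_cont_on :: "real \<Rightarrow> real \<Rightarrow> cfun \<Rightarrow> bool" where
  "abs_cont_on a b f \<longleftrightarrow>
     (\<forall>\<epsilon>>0. \<exists>\<delta>>0. \<forall>(n::nat) (s::nat \<Rightarrow> real) (t::nat \<Rightarrow> real).
        (\<forall>i<n. a \<le> s i \<and> s i \<le> t i \<and> t i \<le> b) \<longrightarrow>
        (\<forall>i<n. \<forall>j<n. i \<noteq> j \<longrightarrow> {s i<..<t i} \<inter> {s j<..<t j} = {}) \<longrightarrow>
        (\<Sum>i<n. t i - s i) < \<delta> \<longrightarrow>
        (\<Sum>i<n. dist (f (s i)) (f (t i))) < \<epsilon>)"

definition loc_abs_cont :: "real \<Rightarrow> cfun \<Rightarrow> bool" where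
  "loc_abs_cont a f \<longleftrightarrow> (\<forall>b\<ge>a. abs_cont_on a b f)"

text \<open>Derivative on the half-line: one-sided at \<^term>\<open>a\<close>, two-sided to the right of it.\<close>

definition hl_deriv :: "real \<Rightarrow> cfun \<Rightarrow> cfun" where
  "hl_deriv a y x = vector_derivative y (at x within {a..})"

text \<open>
  For \<^term>\<open>y\<close> with locally absolutely continuous \<^term>\<open>hl_deriv a y\<close> the second derivative
  exists almost everywhere; on the remaining null set \<open>lop a q y\<close> is an arbitrary value.
\<close>

definition lop :: "real \<Rightarrow> (real \<Rightarrow> real) \<Rightarrow> cfun \<Rightarrow> cfun" where
  "lop a q y x = - hl_deriv a (hl_deriv a y) x + complex_of_real (q x) * y x"

definition twice_ac :: "real \<Rightarrow> cfun \<Rightarrow> bool" where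
  "twice_ac a y \<longleftrightarrow> y differentiable_on {a..} \<and> loc_abs_cont a y \<and> loc_abs_cont a (hl_deriv a y)"

definition locally_summable :: "real \<Rightarrow> (real \<Rightarrow> real) \<Rightarrow> bool" where
  "locally_summable a q \<longleftrightarrow> (\<forall>b\<ge>a. q absolutely_integrable_on {a..b})"


subsection \<open>The rigged space and the minimal operator\<close>

definition Hplus :: "real \<Rightarrow> (real \<Rightarrow> real) \<Rightarrow> cfun set" where
  "Hplus a q = {y \<in> L2 a. twice_ac a y \<and> lop a q y \<in> L2 a}"

definition plus_ip :: "real \<Rightarrow> (real \<Rightarrow> real) \<Rightarrow> cfun \<Rightarrow> cfun \<Rightarrow> complex" where
  "plus_ip a q y z = ip a y z + ip a (lop a q y) (lop a q z)"

text \<open>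
  An element \<open>F\<close> of H_- is represented by the conjugate-linear functional
  \<open>z \<mapsto> (F, z)\<close> on H_+, so that \<open>(z, F)\<close> is the complex conjugate of \<open>F z\<close>, and
  \<open>f\<close> in H becomes the functional \<open>ip a f\<close>.  An operator \<open>B\<close> in [H_+, H_-] is accordingly a
  function with \<open>B y z = (B y, z)\<close>.  Only the values at arguments in H_+ are meaningful.
\<close>

type_synonym functional = "cfun \<Rightarrow> complex"
type_synonym pm_op = "cfun \<Rightarrow> functional"

definition Hminus :: "real \<Rightarrow> (real \<Rightarrow> real) \<Rightarrow> functional set" where
  "Hminus a q = {F.
     (\<forall>y\<in>Hplus a q. \<forall>z\<in>Hplus a q. F (\<lambda>x. y x + z x) = F y + F z) \<and>
     (\<forall>c. \<forall>z\<in>Hplus a q. F (\<lambda>x. c * z x) = cnj c * F z) \<and>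
     (\<exists>C. \<forall>z\<in>Hplus a q. cmod (F z) \<le> C * sqrt (Re (plus_ip a q z z)))}"

text \<open>The conventions are \<open>(y, \<delta>) = y(a)\<close> and \<open>(y, \<delta>') = - y'(a)\<close>.\<close>

definition delta :: "real \<Rightarrow> functional" where
  "delta a z = cnj (z a)"

definition delta' :: "real \<Rightarrow> functional" where
  "delta' a z = - cnj (hl_deriv a z a)"

definition adj_op :: "pm_op \<Rightarrow> pm_op" where
  "adj_op B y z = cnj (B z y)"

definition Re_op :: "pm_op \<Rightarrow> pm_op" where
  "Re_op B y z = (B y z + adj_op B y z) / 2"

definition Adot_dom :: "real \<Rightarrow> (real \<Rightarrow> real) \<Rightarrow> cfun set" where
  "Adot_dom a q = {y \<in> Hplus a q. y a = 0 \<and> hl_deriv a y a = 0}"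

definition symmetric_on :: "real \<Rightarrow> cfun set \<Rightarrow> (cfun \<Rightarrow> cfun) \<Rightarrow> bool" where
  "symmetric_on a S T \<longleftrightarrow> (\<forall>f\<in>S. \<forall>g\<in>S. ip a (T f) g = ip a f (T g))"

definition nonneg_on :: "real \<Rightarrow> cfun set \<Rightarrow> (cfun \<Rightarrow> cfun) \<Rightarrow> bool" where
  "nonneg_on a S T \<longleftrightarrow> (\<forall>f\<in>S. ip a (T f) f \<in> \<real> \<and> 0 \<le> Re (ip a (T f) f))"

text \<open>The kernel of \<open>T\<^sup>* - w\<close>, where \<open>T\<^sup>*\<close> is the adjoint in L_2[a,oo) of \<open>T\<close> with domain \<open>S\<close>.\<close>

definition deficiency_space :: "real \<Rightarrow> cfun set \<Rightarrow> (cfun \<Rightarrow> cfun) \<Rightarrow> complex \<Rightarrow> cfun set" where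
  "deficiency_space a S T w =
     {f \<in> L2 a. \<forall>y\<in>S. ip a (T y) f = ip a y (\<lambda>x. w * f x)}"

definition one_dimensional_ae :: "real \<Rightarrow> cfun set \<Rightarrow> bool" where
  "one_dimensional_ae a N \<longleftrightarrow>
     (\<exists>e\<in>N. \<not> (AE x in lebesgue. x \<in> {a..} \<longrightarrow> e x = 0) \<and>
        (\<forall>f\<in>N. \<exists>c. AE x in lebesgue. x \<in> {a..} \<longrightarrow> f x = c * e x))"

definition deficiency_indices_1_1 :: "real \<Rightarrow> cfun set \<Rightarrow> (cfun \<Rightarrow> cfun) \<Rightarrow> bool" where
  "deficiency_indices_1_1 a S T \<longleftrightarrow>
     one_dimensional_ae a (deficiency_space a S T \<i>) \<and>
     one_dimensional_ae a (deficiency_space a S T (- \<i>))"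

text \<open>\<open>\<dot>A\<^sup>*\<close>, which acts as the differential expression on H_+, as an element of [H_+, H_-].\<close>

definition Astar :: "real \<Rightarrow> (real \<Rightarrow> real) \<Rightarrow> pm_op" where
  "Astar a q y = ip a (lop a q y)"

definition T_dom :: "real \<Rightarrow> (real \<Rightarrow> real) \<Rightarrow> complex \<Rightarrow> cfun set" where
  "T_dom a q h = {y \<in> Hplus a q. hl_deriv a y a = h * y a}"


subsection \<open>The function m_infinity\<close>

definition is_solution :: "real \<Rightarrow> (real \<Rightarrow> real) \<Rightarrow> complex \<Rightarrow> cfun \<Rightarrow> bool" where
  "is_solution a q w y \<longleftrightarrow> twice_ac a y \<and>
     (AE x in lebesgue. x \<in> {a..} \<longrightarrow> lop a q y x = w * y x)"

text \<open>The initial value problems determine the solutions uniquely on \<^term>\<open>{a..}\<close>.\<close>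

definition phi1 :: "real \<Rightarrow> (real \<Rightarrow> real) \<Rightarrow> complex \<Rightarrow> cfun" where
  "phi1 a q w = (SOME y. is_solution a q w y \<and> y a = 0 \<and> hl_deriv a y a = 1)"

definition phi2 :: "real \<Rightarrow> (real \<Rightarrow> real) \<Rightarrow> complex \<Rightarrow> cfun" where
  "phi2 a q w = (SOME y. is_solution a q w y \<and> y a = - 1 \<and> hl_deriv a y a = 0)"

definition m_infty :: "real \<Rightarrow> (real \<Rightarrow> real) \<Rightarrow> complex \<Rightarrow> complex" where
  "m_infty a q w = (THE m. (\<lambda>x. phi2 a q w x + m * phi1 a q w x) \<in> L2 a)"


subsection \<open>Star-extensions, L-systems and the associated operator\<close>

text \<open>The two infinite values of \<open>\<mu>\<close> give the same operator, i.e. they are identified.\<close>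

definition A_mu :: "real \<Rightarrow> (real \<Rightarrow> real) \<Rightarrow> complex \<Rightarrow> ereal \<Rightarrow> pm_op" where
  "A_mu a q h \<mu> y z =
     (case \<mu> of
        ereal r \<Rightarrow> ip a (lop a q y) z
          - 1 / (complex_of_real r - h) * (hl_deriv a y a - h * y a)
            * (complex_of_real r * delta a z + delta' a z)
      | _ \<Rightarrow> ip a (lop a q y) z + (h * y a - hl_deriv a y a) * delta a z)"

definition accumulative :: "real \<Rightarrow> (real \<Rightarrow> real) \<Rightarrow> pm_op \<Rightarrow> bool" where
  "accumulative a q B \<longleftrightarrow>
     (\<forall>f\<in>Hplus a q. Re (Re_op B f f) \<le> Re (ip a (lop a q f) f + ip a f (lop a q f)))"

text \<open>
  The channel vector \<open>g\<close>; at infinite \<open>\<mu>\<close> it is the limit of the finite case, which is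
  the vector for which the imaginary part of \<open>A_mu\<close> is \<open>(\<cdot>, g) g\<close>.
\<close>

definition channel_vector :: "complex \<Rightarrow> real \<Rightarrow> ereal \<Rightarrow> functional" where
  "channel_vector h a \<mu> z =
     (case \<mu> of
        ereal r \<Rightarrow> complex_of_real (sqrt (Im h) / cmod (complex_of_real r - h))
          * (complex_of_real r * delta a z + delta' a z)
      | _ \<Rightarrow> complex_of_real (sqrt (Im h)) * delta a z)"

record l_system =
  state_operator :: pm_op
  channel_operator :: "complex \<Rightarrow> functional"
  rigging :: "cfun set \<times> cfun set \<times> functional set"

definition schroedinger_l_system ::
    "real \<Rightarrow> (real \<Rightarrow> real) \<Rightarrow> complex \<Rightarrow> ereal \<Rightarrow> l_system" where
  "schroedinger_l_system a q h \<mu> =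
     \<lparr> state_operator = A_mu a q h \<mu>,
       channel_operator = (\<lambda>c z. c * channel_vector h a \<mu> z),
       rigging = (Hplus a q, L2 a, Hminus a q) \<rparr>"

definition associated_op :: "real \<Rightarrow> (real \<Rightarrow> real) \<Rightarrow> pm_op \<Rightarrow> pm_op" where
  "associated_op a q B y z = 2 * Re_op (Astar a q) y z - B y z"


subsection \<open>Sectoriality\<close>

text \<open>Here \<open>t f\<close> is the quadratic form \<open>(T f, f)\<close> of the operator in question, and \<open>S\<close> its domain.\<close>

definition sectorial_form :: "cfun set \<Rightarrow> (cfun \<Rightarrow> complex) \<Rightarrow> real \<Rightarrow> bool" where
  "sectorial_form S t \<alpha> \<longleftrightarrow> (\<forall>f\<in>S. cot \<alpha> * \<bar>Im (t f)\<bar> \<le> Re (t f))"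

text \<open>
  Sectoriality makes the set of quotients bounded, and forces \<open>Im (t f) = 0\<close> whenever
  \<open>Re (t f) = 0\<close>; such \<open>f\<close> contribute the value 0 and do not affect the supremum.
\<close>

definition exact_sectorial_form :: "cfun set \<Rightarrow> (cfun \<Rightarrow> complex) \<Rightarrow> real \<Rightarrow> bool" where
  "exact_sectorial_form S t \<alpha> \<longleftrightarrow> sectorial_form S t \<alpha> \<and>
     tan \<alpha> = (SUP f\<in>S. \<bar>Im (t f)\<bar> / Re (t f))"

definition sectorial_op :: "real \<Rightarrow> cfun set \<Rightarrow> (cfun \<Rightarrow> cfun) \<Rightarrow> real \<Rightarrow> bool" where
  "sectorial_op a S T = sectorial_form S (\<lambda>f. ip a (T f) f)"

definition exact_sectorial_op :: "real \<Rightarrow> cfun set \<Rightarrow> (cfun \<Rightarrow> cfun) \<Rightarrow> real \<Rightarrow> bool" where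
  "exact_sectorial_op a S T = exact_sectorial_form S (\<lambda>f. ip a (T f) f)"

definition sectorial_pm :: "real \<Rightarrow> (real \<Rightarrow> real) \<Rightarrow> pm_op \<Rightarrow> real \<Rightarrow> bool" where
  "sectorial_pm a q B = sectorial_form (Hplus a q) (\<lambda>f. B f f)"

end

theory Submission
  imports Defs
begin

text \<open>
  Let \<open>E(y)\<close> be the energy of \<open>y\<close>, the integral of \<open>|y'|\<^sup>2 + q |y|\<^sup>2\<close>.  With \<open>w = \<mu> y(a) - y'(a)\<close>, the form of the
  associated operator is
  \<open>E(y) + \<mu> |y(a)|\<^sup>2 - (\<mu> - Re h) |w|\<^sup>2 / |\<mu> - h|\<^sup>2 - i Im h |w|\<^sup>2 / |\<mu> - h|\<^sup>2\<close>,
  and that of \<open>T_h\<close> is \<open>E(y) + h |y(a)|\<^sup>2\<close>.  The infimum of \<open>E(y)\<close> for prescribed \<open>y(a)\<close> and \<open>y'(a)\<close> is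
  \<open>m |y(a)|\<^sup>2\<close> with \<open>m = m_infty(-0)\<close>: for \<open>\<lambda> < 0\<close> the Weyl solution minimises \<open>E(y) - \<lambda> \<parallel>y\<parallel>\<^sup>2\<close> for
  given \<open>y(a)\<close>, with minimum \<open>m_infty(\<lambda>) |y(a)|\<^sup>2\<close>, and \<open>y'(a)\<close> can be changed at no cost in energy.
  Hence exactness of the angle says \<open>cot \<alpha> Im h = Re h + m\<close>, accumulativity gives \<open>- m \<le> \<mu>\<close>, and testing
  sectoriality with \<open>y(a) = 0\<close> gives \<open>\<mu> \<le> - m\<close>; for \<open>\<mu> = - m\<close> the required inequality is immediate.

  For the elements of \<open>Hplus\<close> integration by parts rests on the fundamental theorem of calculus for
  absolutely continuous functions, including their differentiability almost everywhere, which is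
  obtained from the Vitali covering theorem.  Self-adjointness at infinity (the limit-point case) is
  a consequence of the symmetry of the minimal operator, by subtracting functions of compact support
  with the same boundary data at \<open>a\<close>.
\<close>

section \<open>Absolutely continuous functions\<close>

text \<open>The potential is only locally summable, so \<open>lop a q y\<close> is known almost
  everywhere only. Where pointwise bounds are needed it is replaced by a continuous representative
  \<open>k\<close>, which exists for the functions built from solutions of
  \<open>l(y) = \<lambda> y\<close> and cut-offs. Non-negativity is given only for functions with
  \<open>y(a) = y'(a) = 0\<close>, but is needed for Dirichlet problems on \<open>[a,b]\<close>,
  where only the values vanish at the ends. A function vanishing at \<open>b\<close> can be cut off
  within \<open>\<epsilon>\<close> beyond \<open>b\<close> at energy of order
  \<open>\<epsilon>\<close>; where it does not vanish, the cost would be of order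
  \<open>1/\<epsilon>\<close>. The same device at \<open>b = a\<close> produces functions with
  \<open>y(a) = 0\<close>, \<open>y'(a) = 1\<close> and energy tending to 0, which is why
  \<open>y'(a)\<close> is free. The parameter \<lambda> stays negative because the Dirichlet form
  then excludes eigenfunctions: \<open>phi1\<close> has no zero beyond \<open>a\<close> and is not
  square integrable, so \<open>m_infty\<close> is well defined. At \<open>\<lambda> = 0\<close> the
  corresponding solution need not be square integrable, hence the passage to the limit.\<close>

abbreviation disjoint_intervals :: "(real \<times> real) set \<Rightarrow> bool" where
  "disjoint_intervals F \<equiv> pairwise (\<lambda>i j. disjnt {fst i..snd i} {fst j..snd j}) F"

section \<open>Vitali covers by intervals and divisions of intervals\<close>

text \<open>The Vitali covering theorem gives a countable disjoint subfamily covering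
  \<open>E\<close> up to a null set. All its intervals lie in \<open>{A..B}\<close>, so their union
  has finite measure, and by continuity from below finitely many of them leave a tail of measure
  below \<open>\<eta>\<close>. \<open>Z\<close> is this tail together with the null set. No
  measurability of \<open>E\<close> is assumed, so that exceptional sets can be covered
  directly.\<close>

lemma Vitali_cover_finite:
  fixes E :: "real set" and K :: "(real \<times> real) set"
  assumes K: "\<And>s t. (s,t) \<in> K \<Longrightarrow> s < t \<and> A \<le> s \<and> t \<le> B"
    and cov: "\<And>x d. x \<in> E \<Longrightarrow> d > 0 \<Longrightarrow> \<exists>s t. (s,t) \<in> K \<and> s \<le> x \<and> x \<le> t \<and> t - s < d"
    and "\<eta> > 0"
  obtains F Z where "finite F" "F \<subseteq> K"
    "disjoint_intervals F"
    "Z \<in> lmeasurable" "measure lebesgue Z < \<eta>" "E \<subseteq> (\<Union>i\<in>F. {fst i..snd i}) \<union> Z"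
proof -
  define c where "c i = (fst i + snd i) / 2" for i :: "real \<times> real"
  define r where "r i = (snd i - fst i) / 2" for i :: "real \<times> real"
  have cb: "cball (c i) (r i) = {fst i..snd i}" for i
    by (auto simp: c_def r_def cball_eq_atLeastAtMost field_simps)
  have rpos: "0 < r i" if "i \<in> K" for i
    using K[of "fst i" "snd i"] that by (auto simp: r_def)
  have S: "\<exists>i. i \<in> K \<and> x \<in> cball (c i) (r i) \<and> r i < d" if "x \<in> E" "0 < d" for x d
  proof -
    obtain s t where "(s,t) \<in> K" "s \<le> x" "x \<le> t" "t - s < d" using cov[OF \<open>x\<in>E\<close> \<open>0<d\<close>] by blast
    then show ?thesis using K[of s t] unfolding cb
      by (intro exI[of _ "(s,t)"]) (auto simp: r_def)
  qed
  obtain C where C: "countable C" "C \<subseteq> K"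
     "pairwise (\<lambda>i j. disjnt (cball (c i) (r i)) (cball (c j) (r j))) C"
     "negligible (E - (\<Union>i \<in> C. cball (c i) (r i)))"
    by (rule Vitali_covering_theorem_cballs[of K r E c, OF rpos S])
  note C = C[unfolded cb]
  let ?I = "\<lambda>i::real \<times> real. {fst i..snd i}"
  have sub: "?I i \<subseteq> {A..B}" if "i \<in> K" for i
    using K[of "fst i" "snd i"] that by auto
  have Um: "(\<Union>i\<in>D. ?I i) \<in> lmeasurable" if "D \<subseteq> C" for D
  proof (rule bounded_set_imp_lmeasurable)
    show "bounded (\<Union>i\<in>D. ?I i)"
      by (rule bounded_subset[of "{A..B}"], simp, rule UN_least, rule sub) (use C(2) that in blast)
    have "countable D" using C(1) that countable_subset by blast
    then show "(\<Union>i\<in>D. ?I i) \<in> sets lebesgue" by (intro sets.countable_UN') auto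
  qed
  have "\<exists>F. finite F \<and> F \<subseteq> C \<and> measure lebesgue ((\<Union>i\<in>C. ?I i) - (\<Union>i\<in>F. ?I i)) < \<eta>"
  proof (cases "C = {}")
    case True then show ?thesis using \<open>\<eta> > 0\<close> by auto
  next
    case False
    define U where "U n = (\<Union>i\<in>from_nat_into C ` {..<n}. ?I i)" for n :: nat
    have ran: "range (from_nat_into C) = C" using C(1) False by (simp add: range_from_nat_into)
    have fC: "from_nat_into C ` {..<n} \<subseteq> C" for n using ran by blast
    have Un: "(\<Union>n. U n) = (\<Union>i\<in>C. ?I i)"
    proof -
      have "(\<Union>n. U n) = (\<Union>i\<in>(\<Union>n. from_nat_into C ` {..<n}). ?I i)" by (auto simp: U_def)
      also have "(\<Union>n. from_nat_into C ` {..<n}) = range (from_nat_into C)"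
        by (auto intro: lessI)
      finally show ?thesis using ran by simp
    qed
    have "(\<lambda>n. measure lebesgue (U n)) \<longlonglongrightarrow> measure lebesgue (\<Union>n. U n)"
    proof (rule Lim_measure_incseq)
      show "range U \<subseteq> sets lebesgue" using Um[OF fC] by (auto simp: U_def)
      show "incseq U" unfolding incseq_def U_def by (intro allI impI UN_mono image_mono) auto
      show "emeasure lebesgue (\<Union>n. U n) \<noteq> \<infinity>"
        unfolding Un using Um[of C] by (auto simp: fmeasurable_def)
    qed
    then have "\<forall>\<^sub>F n in sequentially. measure lebesgue (\<Union>n. U n) - \<eta> < measure lebesgue (U n)"
      using \<open>\<eta>>0\<close> by (intro order_tendstoD) auto
    then obtain n where n: "measure lebesgue (\<Union>n. U n) - \<eta> < measure lebesgue (U n)"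
      by (auto simp: eventually_sequentially)
    have "measure lebesgue ((\<Union>i\<in>C. ?I i) - U n) = measure lebesgue (\<Union>i\<in>C. ?I i) - measure lebesgue (U n)"
      using Um[of C] Um[OF fC[of n]] by (intro measurable_measure_Diff) (auto simp: U_def fmeasurableD Un[symmetric])
    then have "measure lebesgue ((\<Union>i\<in>C. ?I i) - U n) < \<eta>" using n unfolding Un by linarith
    then show ?thesis using fC unfolding U_def by (intro exI[of _ "from_nat_into C ` {..<n}"]) auto
  qed
  then obtain F where F: "finite F" "F \<subseteq> C" "measure lebesgue ((\<Union>i\<in>C. ?I i) - (\<Union>i\<in>F. ?I i)) < \<eta>" by blast
  define N where "N = E - (\<Union>i\<in>C. ?I i)"
  define Y where "Y = (\<Union>i\<in>C. ?I i) - (\<Union>i\<in>F. ?I i)"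
  have Y: "Y \<in> lmeasurable" unfolding Y_def using Um[of C] Um[OF F(2)] by auto
  have N: "N \<in> lmeasurable" "measure lebesgue N = 0"
    using C(4) negligible_imp_measurable negligible_imp_measure0 by (auto simp: N_def)
  have "measure lebesgue (N \<union> Y) \<le> measure lebesgue N + measure lebesgue Y"
    using N(1) Y by (intro measure_Un_le) auto
  then have m: "measure lebesgue (N \<union> Y) < \<eta>" using N(2) F(3) by (simp add: Y_def)
  show thesis
  proof (rule that)
    show "disjoint_intervals F"
      using C(3) F(2) pairwise_subset by fastforce
    show "E \<subseteq> (\<Union>i\<in>F. {fst i..snd i}) \<union> (N \<union> Y)" by (auto simp: N_def Y_def)
  qed (use F C(2) N Y m in auto)
qed

text \<open>The sum telescopes. Tagging each interval with its left endpoint makes the division a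
  tagged one, to which additivity of increments applies.\<close>

lemma division_increments:
  fixes f :: "real \<Rightarrow> 'a::real_normed_vector"
  assumes "a \<le> b" "q division_of {a..b}"
  shows "(\<Sum>k\<in>q. f (Sup k) - f (Inf k)) = f b - f a"
proof -
  note q = division_ofD[OF assms(2)]
  let ?p = "(\<lambda>k. (Inf k, k)) ` q"
  have k: "\<exists>u v. u \<le> v \<and> k = {u..v}" if "k \<in> q" for k
    using q(3,4)[OF that] by (metis atLeastatMost_empty_iff cbox_interval not_le)
  have "?p tagged_division_of {a..b}"
    unfolding tagged_division_of
  proof (intro conjI allI impI)
    fix x K assume "(x,K) \<in> ?p"
    then have "K \<in> q" "x = Inf K" by auto
    then show "x \<in> K" "K \<subseteq> {a..b}" "\<exists>a b. K = cbox a b"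
      using k[OF \<open>K\<in>q\<close>] q(2)[OF \<open>K \<in> q\<close>] by (auto simp: cInf_atLeastAtMost)
  next
    fix x1 K1 x2 K2 assume "(x1, K1) \<in> ?p \<and> (x2, K2) \<in> ?p \<and> (x1, K1) \<noteq> (x2, K2)"
    then show "interior K1 \<inter> interior K2 = {}" using q(5)[of K1 K2] by auto
  next
    have "{K. \<exists>x. (x, K) \<in> ?p} = q" by auto
    then show "\<Union>{K. \<exists>x. (x, K) \<in> ?p} = {a..b}" using q(6) by simp
  qed (use q(1) in auto)
  then have "(\<Sum>(x,k)\<in>?p. f (Sup k) - f (Inf k)) = f b - f a"
    using additive_tagged_division_1[OF assms(1)] by blast
  moreover have "inj_on (\<lambda>k. (Inf k, k)) q" by (auto simp: inj_on_def)
  ultimately show ?thesis by (simp add: sum.reindex)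
qed

lemma division_interval:
  assumes "D division_of S" "k \<in> D"
  obtains u v :: real where "u \<le> v" "k = {u..v}" "Inf k = u" "Sup k = v" "measure lborel k = v - u"
proof -
  obtain u v where "k = {u..v}" "k \<noteq> {}" using division_ofD(3,4)[OF assms] by (metis cbox_interval)
  then show thesis using that[of u v] by auto
qed

text \<open>Vitali covers deliver pairs of endpoints, divisions are sets of sets. Nondegeneracy
  makes the passage injective, so sums can be transferred.\<close>

lemma division_of_pairs:
  fixes F :: "(real \<times> real) set"
  assumes "finite F" "\<And>i. i \<in> F \<Longrightarrow> fst i < snd i"
    "disjoint_intervals F"
  defines "P \<equiv> (\<lambda>i. {fst i..snd i}) ` F"
  shows "P division_of (\<Union>i\<in>F. {fst i..snd i})" "inj_on (\<lambda>i. {fst i..snd i}) F"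
proof -
  show "inj_on (\<lambda>i. {fst i..snd i}) F"
  proof (rule inj_onI)
    fix i j assume "i \<in> F" "j \<in> F" "{fst i..snd i} = {fst j..snd j}"
    then show "i = j" using assms(2)[of i] assms(2)[of j] by (auto simp: Icc_eq_Icc prod_eq_iff)
  qed
  show "P division_of (\<Union>i\<in>F. {fst i..snd i})"
  proof (rule division_ofI)
    fix k assume "k \<in> P"
    then obtain i where i: "i \<in> F" "k = {fst i..snd i}" by (auto simp: P_def)
    show "k \<subseteq> (\<Union>i\<in>F. {fst i..snd i})" using i by auto
    show "k \<noteq> {}" using i assms(2)[of i] by auto
    show "\<exists>a b. k = cbox a b" using i by auto
  next
    fix K1 K2 assume "K1 \<in> P" "K2 \<in> P" "K1 \<noteq> K2"
    then obtain i j where ij: "i \<in> F" "j \<in> F" "K1 = {fst i..snd i}" "K2 = {fst j..snd j}" "i \<noteq> j"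
      by (auto simp: P_def)
    then have "disjnt K1 K2" using assms(3) by (auto simp: pairwise_def)
    then show "interior K1 \<inter> interior K2 = {}" using interior_subset by (fastforce simp: disjnt_def)
  qed (use assms(1) in \<open>auto simp: P_def\<close>)
qed

section \<open>Absolute continuity over finite families of intervals\<close>

text \<open>Only the open intervals are kept apart: neighbours may share an endpoint, as they do in
  a division.\<close>

definition nonoverlapping :: "real \<Rightarrow> real \<Rightarrow> nat \<Rightarrow> (nat \<Rightarrow> real) \<Rightarrow> (nat \<Rightarrow> real) \<Rightarrow> bool" where
  "nonoverlapping a b n s t \<longleftrightarrow> (\<forall>i<n. a \<le> s i \<and> s i \<le> t i \<and> t i \<le> b) \<and>
     (\<forall>i<n. \<forall>j<n. i \<noteq> j \<longrightarrow> {s i<..<t i} \<inter> {s j<..<t j} = {})"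

lemma abs_cont_on_iff:
  "abs_cont_on a b f \<longleftrightarrow> (\<forall>\<epsilon>>0. \<exists>\<delta>>0. \<forall>n s t. nonoverlapping a b n s t \<longrightarrow> (\<Sum>i<n. t i - s i) < \<delta> \<longrightarrow>
     (\<Sum>i<n. dist (f (s i)) (f (t i))) < \<epsilon>)"
  unfolding abs_cont_on_def nonoverlapping_def by (simp only: imp_conjL)

lemma abs_cont_onE:
  assumes "abs_cont_on a b f" "\<epsilon> > 0"
  obtains \<delta> where "\<delta> > 0"
    "\<forall>n s t. nonoverlapping a b n s t \<longrightarrow> (\<Sum>i<n. t i - s i) < \<delta> \<longrightarrow> (\<Sum>i<n. dist (f (s i)) (f (t i))) < \<epsilon>"
  using assms unfolding abs_cont_on_iff by blast

text \<open>An enumeration of the division turns it into an indexed family. Divisions are the form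
  in which gaps between intervals can be filled.\<close>

lemma abs_cont_on_division:
  assumes ac: "abs_cont_on a b f" and "\<epsilon> > 0"
  obtains \<delta> where "\<delta> > 0" "\<And>D. D division_of (\<Union>D) \<Longrightarrow> \<Union>D \<subseteq> {a..b} \<Longrightarrow> sum (measure lborel) D < \<delta> \<Longrightarrow>
     (\<Sum>k\<in>D. norm (f (Sup k) - f (Inf k))) < \<epsilon>"
proof -
  obtain \<delta> where \<delta>: "\<delta> > 0" and H: "\<forall>n s t. nonoverlapping a b n s t \<longrightarrow> (\<Sum>i<n. t i - s i) < \<delta> \<longrightarrow>
      (\<Sum>i<n. dist (f (s i)) (f (t i))) < \<epsilon>"
    by (rule abs_cont_onE[OF assms])
  show thesis
  proof (rule that[OF \<delta>])
    fix D assume D: "D division_of (\<Union>D)" "\<Union>D \<subseteq> {a..b}" and s: "sum (measure lborel) D < \<delta>"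
    obtain h where h: "bij_betw h {..<card D} D"
      using division_ofD(1)[OF D(1)] ex_bij_betw_nat_finite[of D] by (auto simp: atLeast0LessThan)
    have hD: "h i \<in> D" if "i < card D" for i using h that by (auto simp: bij_betw_def)
    have e: "(\<Sum>i<card D. g (h i)) = sum g D" for g :: "real set \<Rightarrow> real"
      using sum.reindex_bij_betw[OF h, of g] by simp
    have "(\<Sum>i<card D. dist (f (Inf (h i))) (f (Sup (h i)))) < \<epsilon>"
    proof (rule H[rule_format])
      show "nonoverlapping a b (card D) (\<lambda>i. Inf (h i)) (\<lambda>i. Sup (h i))"
        unfolding nonoverlapping_def
      proof (rule conjI; intro allI impI)
      fix i assume "i < card D"
      then obtain u v where "u \<le> v" "h i = {u..v}" "Inf (h i) = u" "Sup (h i) = v"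
        using division_interval[OF D(1) hD] by metis
      then show "a \<le> Inf (h i) \<and> Inf (h i) \<le> Sup (h i) \<and> Sup (h i) \<le> b"
        using D(2) hD[OF \<open>i < card D\<close>] by (metis Union_upper atLeastatMost_subset_iff subset_trans)
    next
      fix i j assume ij: "i < card D" "j < card D" "i \<noteq> j"
      obtain u v where 1: "u \<le> v" "h i = {u..v}" "Inf (h i) = u" "Sup (h i) = v"
        using division_interval[OF D(1) hD[OF ij(1)]] by metis
      obtain u' v' where 2: "u' \<le> v'" "h j = {u'..v'}" "Inf (h j) = u'" "Sup (h j) = v'"
        using division_interval[OF D(1) hD[OF ij(2)]] by metis
      have "h i \<noteq> h j" using ij h by (auto simp: bij_betw_def inj_on_def)
      then have "interior (h i) \<inter> interior (h j) = {}"
        using division_ofD(5)[OF D(1) hD hD] ij by blast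
      then show "{Inf (h i)<..<Sup (h i)} \<inter> {Inf (h j)<..<Sup (h j)} = {}"
        unfolding 1(3,4) 2(3,4) unfolding 1(2) 2(2) by (simp add: interior_atLeastAtMost_real)
      qed
    next
      have "(\<Sum>i<card D. Sup (h i) - Inf (h i)) = (\<Sum>i<card D. measure lborel (h i))"
      proof (rule sum.cong)
        fix i assume "i \<in> {..<card D}"
        then show "Sup (h i) - Inf (h i) = measure lborel (h i)"
          using division_interval[OF D(1) hD[of i]] by (metis lessThan_iff)
      qed simp
      then show "(\<Sum>i<card D. Sup (h i) - Inf (h i)) < \<delta>" using s e[of "measure lborel"] by simp
    qed
    then show "(\<Sum>k\<in>D. norm (f (Sup k) - f (Inf k))) < \<epsilon>"
      using e[of "\<lambda>k. dist (f (Inf k)) (f (Sup k))"] by (simp add: dist_norm norm_minus_commute)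
  qed
qed

text \<open>The intervals of \<open>G\<close> lie inside those of \<open>F\<close>; both families are compared through the
  increments over the gaps that \<open>G\<close> leaves in \<open>F\<close>.\<close>

definition gap_bound :: "real \<Rightarrow> real \<Rightarrow> cfun \<Rightarrow> real \<Rightarrow> real \<Rightarrow> bool" where
  "gap_bound a b f \<delta> \<epsilon> \<longleftrightarrow> (\<forall>F G. finite F \<longrightarrow> finite G \<longrightarrow>
     (\<forall>i\<in>F. a \<le> fst i \<and> fst i < snd i \<and> snd i \<le> b) \<longrightarrow>
     (\<forall>j\<in>G. fst j < snd j \<and> (\<exists>i\<in>F. fst i \<le> fst j \<and> snd j \<le> snd i)) \<longrightarrow>
     disjoint_intervals F \<longrightarrow>
     disjoint_intervals G \<longrightarrow>
     (\<Sum>i\<in>F. snd i - fst i) - (\<Sum>j\<in>G. snd j - fst j) < \<delta> \<longrightarrow>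
     norm ((\<Sum>i\<in>F. f (snd i) - f (fst i)) - (\<Sum>j\<in>G. f (snd j) - f (fst j))) < \<epsilon>)"

text \<open>Within each interval of \<open>F\<close> the intervals of \<open>G\<close> extend to a
  division of it, and the added cells are the gaps. The gaps have total length equal to the
  difference of the two total lengths, and their increments add up to the difference of the two sums
  of increments.\<close>

lemma abs_cont_on_gaps:
  assumes ac: "abs_cont_on a b f" and "\<epsilon> > 0"
  obtains \<delta> where "\<delta> > 0" "gap_bound a b f \<delta> \<epsilon>"
proof -
  obtain \<delta> where \<delta>: "\<delta> > 0" and H: "\<And>D. D division_of (\<Union>D) \<Longrightarrow> \<Union>D \<subseteq> {a..b} \<Longrightarrow> sum (measure lborel) D < \<delta> \<Longrightarrow>
     (\<Sum>k\<in>D. norm (f (Sup k) - f (Inf k))) < \<epsilon>"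
    using abs_cont_on_division[OF assms] by metis
  show thesis
  proof (rule that[OF \<delta>], unfold gap_bound_def, intro allI impI)
    fix F G :: "(real \<times> real) set"
    let ?I = "\<lambda>i::real\<times>real. {fst i..snd i}"
    assume fin: "finite F" "finite G" and F': "\<forall>i\<in>F. a \<le> fst i \<and> fst i < snd i \<and> snd i \<le> b"
      and G': "\<forall>j\<in>G. fst j < snd j \<and> (\<exists>i\<in>F. fst i \<le> fst j \<and> snd j \<le> snd i)"
      and dF: "disjoint_intervals F"
      and dG: "disjoint_intervals G"
      and less: "(\<Sum>i\<in>F. snd i - fst i) - (\<Sum>j\<in>G. snd j - fst j) < \<delta>"
    note F = F'[rule_format] and G = G'[rule_format]
    define G' where "G' i = {j\<in>G. fst i \<le> fst j \<and> snd j \<le> snd i}" for i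
    have finG': "finite (G' i)" for i using fin by (auto simp: G'_def)
    have "\<exists>q. ?I ` G' i \<subseteq> q \<and> q division_of ?I i" if "i \<in> F" for i
    proof -
      have "?I ` G' i division_of (\<Union>j\<in>G' i. ?I j)"
        by (rule division_of_pairs(1)) (use finG' G dG in \<open>auto simp: G'_def pairwise_def\<close>)
      then have 1: "?I ` G' i division_of \<Union>(?I ` G' i)" by simp
      have 2: "\<Union>(?I ` G' i) \<subseteq> cbox (fst i) (snd i)" by (auto simp: G'_def)
      show ?thesis using partial_division_extend_interval[OF 1 2] by (metis cbox_interval)
    qed
    then obtain q where q: "\<And>i. i \<in> F \<Longrightarrow> ?I ` G' i \<subseteq> q i" "\<And>i. i \<in> F \<Longrightarrow> q i division_of ?I i"
      by metis
    define R where "R i = q i - ?I ` G' i" for i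
    have GU: "G = (\<Union>i\<in>F. G' i)" using G by (auto simp: G'_def)
    have disj: "G' i \<inter> G' j = {}" if ij: "i \<in> F" "j \<in> F" "i \<noteq> j" for i j
    proof (rule ccontr)
      assume "G' i \<inter> G' j \<noteq> {}"
      then obtain k where "k \<in> G" "fst i \<le> fst k" "snd k \<le> snd i" "fst j \<le> fst k" "snd k \<le> snd j"
        by (auto simp: G'_def)
      moreover have "fst k < snd k" using G[OF \<open>k \<in> G\<close>] by auto
      ultimately have "fst k \<in> ?I i \<inter> ?I j" by auto
      moreover have "disjnt (?I i) (?I j)" using dF ij by (auto simp: pairwise_def)
      ultimately show False by (auto simp: disjnt_def)
    qed
    have injG: "inj_on ?I G" by (rule division_of_pairs(2)[OF fin(2)]) (use G dG in auto)
    have sumR: "(\<Sum>k\<in>R i. g (Sup k) - g (Inf k)) = (g (snd i) - g (fst i)) - (\<Sum>j\<in>G' i. g (snd j) - g (fst j))"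
      if "i \<in> F" for i and g :: "real \<Rightarrow> 'b::real_normed_vector"
    proof -
      have "(\<Sum>k\<in>R i. g (Sup k) - g (Inf k)) = (\<Sum>k\<in>q i. g (Sup k) - g (Inf k)) - (\<Sum>k\<in>?I ` G' i. g (Sup k) - g (Inf k))"
        unfolding R_def using q(1)[OF that] division_ofD(1)[OF q(2)[OF that]] by (intro sum_diff) auto
      also have "(\<Sum>k\<in>q i. g (Sup k) - g (Inf k)) = g (snd i) - g (fst i)"
        using F[OF that] q(2)[OF that] by (intro division_increments) auto
      also have "(\<Sum>k\<in>?I ` G' i. g (Sup k) - g (Inf k)) = (\<Sum>j\<in>G' i. g (Sup (?I j)) - g (Inf (?I j)))"
        by (rule sum.reindex[unfolded o_def]) (rule inj_on_subset[OF injG], auto simp: G'_def)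
      also have "\<dots> = (\<Sum>j\<in>G' i. g (snd j) - g (fst j))"
        using G by (intro sum.cong) (auto simp: G'_def less_imp_le)
      finally show ?thesis .
    qed
    define D where "D = (\<Union>i\<in>F. R i)"
    have Rsub: "k \<subseteq> ?I i" "\<exists>u v. k = cbox u v" "k \<noteq> {}" if "i \<in> F" "k \<in> R i" for i k
      using division_ofD(2,3,4)[OF q(2)[OF that(1)]] that(2) by (auto simp: R_def)
    have finR: "finite (R i)" if "i \<in> F" for i using division_ofD(1)[OF q(2)[OF that]] by (auto simp: R_def)
    have disjR: "R i \<inter> R j = {}" if "i \<in> F" "j \<in> F" "i \<noteq> j" for i j
    proof (rule ccontr)
      assume "R i \<inter> R j \<noteq> {}"
      then obtain k where k: "k \<in> R i" "k \<in> R j" by auto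
      have "disjnt (?I i) (?I j)" using dF that by (auto simp: pairwise_def)
      then show False using Rsub(1,3)[OF that(1) k(1)] Rsub(1)[OF that(2) k(2)] unfolding disjnt_def by blast
    qed
    \<comment> \<open>Stated for every \<open>g\<close>: the identity function yields the total
      length of the gaps, \<open>f\<close> the sum of the increments.\<close>
    have sumD: "(\<Sum>k\<in>D. g (Sup k) - g (Inf k)) = (\<Sum>i\<in>F. g (snd i) - g (fst i)) - (\<Sum>j\<in>G. g (snd j) - g (fst j))"
      for g :: "real \<Rightarrow> 'b::real_normed_vector"
    proof -
      have "(\<Sum>k\<in>D. g (Sup k) - g (Inf k)) = (\<Sum>i\<in>F. \<Sum>k\<in>R i. g (Sup k) - g (Inf k))"
        unfolding D_def using fin finR disjR by (intro sum.UNION_disjoint) auto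
      also have "\<dots> = (\<Sum>i\<in>F. (g (snd i) - g (fst i)) - (\<Sum>j\<in>G' i. g (snd j) - g (fst j)))"
        by (intro sum.cong sumR) auto
      also have "\<dots> = (\<Sum>i\<in>F. g (snd i) - g (fst i)) - (\<Sum>i\<in>F. \<Sum>j\<in>G' i. g (snd j) - g (fst j))"
        by (simp add: sum_subtractf)
      also have "(\<Sum>i\<in>F. \<Sum>j\<in>G' i. g (snd j) - g (fst j)) = (\<Sum>j\<in>G. g (snd j) - g (fst j))"
        unfolding GU using fin finG' disj by (intro sum.UNION_disjoint[symmetric]) auto
      finally show ?thesis .
    qed
    have Ddiv: "D division_of \<Union>D"
    proof (rule division_ofI)
      show "finite D" using fin finR by (auto simp: D_def)
    next
      fix k assume "k \<in> D"
      then obtain i where "i \<in> F" "k \<in> R i" by (auto simp: D_def)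
      from Rsub[OF this] show "k \<noteq> {}" "\<exists>a b. k = cbox a b" by auto
    next
      fix K1 K2 assume K: "K1 \<in> D" "K2 \<in> D" "K1 \<noteq> K2"
      then obtain i j where i: "i \<in> F" "K1 \<in> R i" and j: "j \<in> F" "K2 \<in> R j" by (auto simp: D_def)
      show "interior K1 \<inter> interior K2 = {}"
      proof (cases "i = j")
        case True
        then show ?thesis using division_ofD(5)[OF q(2)[OF i(1)], of K1 K2] i j K by (auto simp: R_def)
      next
        case False
        then have "disjnt (?I i) (?I j)" using dF i j by (auto simp: pairwise_def)
        then have "K1 \<inter> K2 = {}" using Rsub(1)[OF i] Rsub(1)[OF j] unfolding disjnt_def by blast
        then show ?thesis using interior_subset[of K1] interior_subset[of K2] by blast
      qed
    qed auto
    have Dab: "\<Union>D \<subseteq> {a..b}"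
    proof
      fix x assume "x \<in> \<Union>D"
      then obtain i k where "i \<in> F" "k \<in> R i" "x \<in> k" by (auto simp: D_def)
      then show "x \<in> {a..b}" using Rsub(1)[of i k] F[of i] by fastforce
    qed
    have "sum (measure lborel) D = (\<Sum>k\<in>D. Sup k - Inf k)"
      by (intro sum.cong refl) (metis division_interval[OF Ddiv])
    also have "\<dots> < \<delta>" using sumD[of "\<lambda>x. x"] less by simp
    finally have "(\<Sum>k\<in>D. norm (f (Sup k) - f (Inf k))) < \<epsilon>" by (rule H[OF Ddiv Dab])
    then have "norm (\<Sum>k\<in>D. f (Sup k) - f (Inf k)) < \<epsilon>" by (rule le_less_trans[OF norm_sum])
    then show "norm ((\<Sum>i\<in>F. f (snd i) - f (fst i)) - (\<Sum>j\<in>G. f (snd j) - f (fst j))) < \<epsilon>"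
      using sumD[of f] by simp
  qed
qed

lemma measure_UN_intervals:
  fixes F :: "(real \<times> real) set"
  assumes "finite F" "\<And>i. i \<in> F \<Longrightarrow> fst i < snd i"
    "disjoint_intervals F"
  shows "(\<Union>i\<in>F. {fst i..snd i}) \<in> lmeasurable"
    "measure lebesgue (\<Union>i\<in>F. {fst i..snd i}) = (\<Sum>i\<in>F. snd i - fst i)"
proof -
  show "(\<Union>i\<in>F. {fst i..snd i}) \<in> lmeasurable"
    using assms(1) by (intro fmeasurable.finite_UN) auto
  have "measure lebesgue (\<Union>i\<in>F. {fst i..snd i}) = (\<Sum>i\<in>F. measure lebesgue {fst i..snd i})"
    using assms(1,3) unfolding pairwise_def disjnt_def
    by (intro measure_finite_Union) (auto simp: disjoint_family_on_def emeasure_lborel_Icc_eq)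
  also have "\<dots> = (\<Sum>i\<in>F. snd i - fst i)"
    using assms(2) by (intro sum.cong) (auto simp: less_imp_le)
  finally show "measure lebesgue (\<Union>i\<in>F. {fst i..snd i}) = (\<Sum>i\<in>F. snd i - fst i)" .
qed

section \<open>Almost everywhere derivative of an indefinite integral\<close>

text \<open>At a point of \<open>E \<epsilon>\<close> there are arbitrarily short intervals, inside
  the gauge and tagged at an endpoint, whose Henstock error exceeds \<open>\<epsilon>\<close> times
  their length. A finite disjoint Vitali subfamily of these is a tagged partial division, so the
  Henstock lemma bounds its total error by \<open>\<epsilon> * (\<eta>/2)\<close> and hence its
  total length by \<open>\<eta>/2\<close>. Only Henstock-Kurzweil integrability of \<open>g\<close>
  enters.\<close>

theorem indefinite_integral_has_vector_derivative_AE: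
  fixes g :: "real \<Rightarrow> 'a::euclidean_space"
  assumes g: "g integrable_on {a..b}"
  shows "negligible {x\<in>{a<..<b}. \<not> ((\<lambda>x. integral {a..x} g) has_vector_derivative g x) (at x)}"
proof -
  define G where "G x = integral {a..x} g" for x
  have Gdiff: "G t - G s = integral {s..t} g" if "a \<le> s" "s \<le> t" "t \<le> b" for s t
  proof -
    have "g integrable_on {a..t}" using g that by (meson integrable_on_subinterval atLeastatMost_subset_iff order_refl)
    then have "integral {a..s} g + integral {s..t} g = integral {a..t} g"
      using that by (intro Henstock_Kurzweil_Integration.integral_combine) auto
    then show ?thesis by (simp add: G_def algebra_simps)
  qed
  define E where "E \<epsilon> = {x\<in>{a<..<b}. \<forall>d>0. \<exists>y. \<bar>y - x\<bar> < d \<and> norm (G y - G x - (y - x) *\<^sub>R g x) > \<epsilon> * \<bar>y - x\<bar>}" for \<epsilon> :: real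
  have "negligible (E \<epsilon>)" if "\<epsilon> > 0" for \<epsilon>
    unfolding negligible_outer_le
  proof (intro allI impI)
    fix \<eta> :: real assume "\<eta> > 0"
    have "\<epsilon> * (\<eta>/2) > 0" using that \<open>\<eta> > 0\<close> by simp
    have "g integrable_on cbox a b" using g by simp
    then have "\<exists>\<gamma>. gauge \<gamma> \<and> (\<forall>p. p tagged_partial_division_of (cbox a b) \<longrightarrow> \<gamma> fine p \<longrightarrow>
             sum (\<lambda>(x,k). norm (measure lborel k *\<^sub>R g x - integral k g)) p < \<epsilon> * (\<eta>/2))"
      by (rule Henstock_lemma[OF _ \<open>\<epsilon> * (\<eta>/2) > 0\<close>]) (intro exI conjI allI impI)
    then obtain \<gamma> where \<gamma>: "gauge \<gamma>"
      "\<And>p. \<lbrakk>p tagged_partial_division_of (cbox a b); \<gamma> fine p\<rbrakk> \<Longrightarrow>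
             sum (\<lambda>(x,k). norm (measure lborel k *\<^sub>R g x - integral k g)) p < \<epsilon> * (\<eta>/2)"
      by blast
    define P where "P s t x \<longleftrightarrow> x \<in> {s,t} \<and> {s..t} \<subseteq> \<gamma> x \<and> norm ((t - s) *\<^sub>R g x - integral {s..t} g) > \<epsilon> * (t - s)" for s t x
    define K where "K = {(s,t). s < t \<and> a \<le> s \<and> t \<le> b \<and> (\<exists>x. P s t x)}"
    have cov: "\<exists>s t. (s,t) \<in> K \<and> s \<le> x \<and> x \<le> t \<and> t - s < d" if x: "x \<in> E \<epsilon>" and "d > 0" for x d
    proof -
      obtain d1 where d1: "d1 > 0" "ball x d1 \<subseteq> \<gamma> x"
        using \<gamma>(1) unfolding gauge_def by (meson open_contains_ball)
      let ?d = "min d (min d1 (min (x - a) (b - x)))"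
      have "?d > 0" using d1 \<open>d > 0\<close> x by (auto simp: E_def)
      then obtain y where y0: "\<bar>y - x\<bar> < ?d" and y2: "norm (G y - G x - (y - x) *\<^sub>R g x) > \<epsilon> * \<bar>y - x\<bar>"
        using x unfolding E_def by blast
      have y1: "\<bar>y - x\<bar> < d" "\<bar>y - x\<bar> < d1" "\<bar>y - x\<bar> < x - a" "\<bar>y - x\<bar> < b - x" using y0 by auto
      have "y \<noteq> x" using y2 by auto
      define s t where "s = min x y" and "t = max x y"
      have st: "s < t" "a \<le> s" "t \<le> b" "t - s = \<bar>y - x\<bar>" "x \<in> {s,t}"
        using y1 \<open>y \<noteq> x\<close> by (auto simp: s_def t_def min_def max_def)
      have "{s..t} \<subseteq> ball x d1" using y1 by (auto simp: s_def t_def dist_real_def)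
      then have 1: "{s..t} \<subseteq> \<gamma> x" using d1 by blast
      have "norm ((t - s) *\<^sub>R g x - integral {s..t} g) = norm (G y - G x - (y - x) *\<^sub>R g x)"
      proof (cases "x < y")
        case True
        then have "s = x" "t = y" by (auto simp: s_def t_def)
        then show ?thesis using Gdiff[of s t] st by (simp add: norm_minus_commute)
      next
        case False
        then have e: "s = y" "t = x" using \<open>y \<noteq> x\<close> by (auto simp: s_def t_def)
        have "integral {y..x} g = G x - G y" using Gdiff[of y x] st e by simp
        moreover have "(x - y) *\<^sub>R g x - (G x - G y) = G y - G x - (y - x) *\<^sub>R g x" by (simp add: algebra_simps)
        ultimately show ?thesis unfolding e by (simp only:)
      qed
      then have "P s t x" using y2 1 st by (simp add: P_def)
      then have "(s,t) \<in> K" using st by (auto simp: K_def)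
      moreover have "s \<le> x" "x \<le> t" "t - s < d" using st y1 by auto
      ultimately show ?thesis by blast
    qed
    have KK: "s < t \<and> a \<le> s \<and> t \<le> b" if "(s,t) \<in> K" for s t using that by (auto simp: K_def)
    have "\<eta>/2 > 0" using \<open>\<eta> > 0\<close> by simp
    obtain F Z where F: "finite F" "F \<subseteq> K"
      "disjoint_intervals F"
      and Z: "Z \<in> lmeasurable" "measure lebesgue Z < \<eta>/2" "E \<epsilon> \<subseteq> (\<Union>i\<in>F. {fst i..snd i}) \<union> Z"
      by (rule Vitali_cover_finite[OF KK cov \<open>\<eta>/2 > 0\<close>])
    have FK: "fst i < snd i" "a \<le> fst i" "snd i \<le> b" "\<exists>x. P (fst i) (snd i) x" if "i \<in> F" for i
      using subsetD[OF F(2) that] by (auto simp: K_def case_prod_beta)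
    then obtain \<tau> where \<tau>: "\<And>i. i \<in> F \<Longrightarrow> P (fst i) (snd i) (\<tau> i)" by metis
    let ?p = "(\<lambda>i. (\<tau> i, {fst i..snd i})) ` F"
    have inj: "inj_on (\<lambda>i. (\<tau> i, {fst i..snd i})) F"
    proof (rule inj_onI)
      fix i j assume ij: "i \<in> F" "j \<in> F" and "(\<tau> i, {fst i..snd i}) = (\<tau> j, {fst j..snd j})"
      then have "{fst i..snd i} = {fst j..snd j}" by simp
      then show "i = j" using inj_onD[OF division_of_pairs(2)[OF F(1) FK(1) F(3)] _ ij] by blast
    qed
    have "?p tagged_partial_division_of cbox a b"
      unfolding tagged_partial_division_of_def
    proof (intro conjI allI impI)
      fix x k assume "(x,k) \<in> ?p"
      then obtain i where i: "i \<in> F" "x = \<tau> i" "k = {fst i..snd i}" by auto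
      show "x \<in> k" using \<tau>[OF i(1)] FK(1)[OF i(1)] i by (auto simp: P_def)
      show "k \<subseteq> cbox a b" using FK(2,3)[OF i(1)] i by auto
      show "\<exists>a b. k = cbox a b" using i by auto
    next
      fix x1 K1 x2 K2 assume "(x1, K1) \<in> ?p \<and> (x2, K2) \<in> ?p \<and> (x1, K1) \<noteq> (x2, K2)"
      then obtain i j where "i \<in> F" "j \<in> F" "i \<noteq> j" "K1 = {fst i..snd i}" "K2 = {fst j..snd j}" by auto
      then have "K1 \<inter> K2 = {}" using F(3) by (auto simp: pairwise_def disjnt_def)
      then show "interior K1 \<inter> interior K2 = {}" using interior_subset[of K1] interior_subset[of K2] by blast
    qed (use F(1) in auto)
    moreover have "\<gamma> fine ?p" using \<tau> by (auto simp: fine_def P_def)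
    ultimately have "sum (\<lambda>(x,k). norm (measure lborel k *\<^sub>R g x - integral k g)) ?p < \<epsilon> * (\<eta>/2)"
      by (rule \<gamma>(2))
    then have "(\<Sum>i\<in>F. norm ((snd i - fst i) *\<^sub>R g (\<tau> i) - integral {fst i..snd i} g)) < \<epsilon> * (\<eta>/2)"
      using FK(1) by (subst (asm) sum.reindex[OF inj]) (simp add: less_imp_le)
    moreover have "(\<Sum>i\<in>F. \<epsilon> * (snd i - fst i)) \<le> (\<Sum>i\<in>F. norm ((snd i - fst i) *\<^sub>R g (\<tau> i) - integral {fst i..snd i} g))"
      using \<tau> by (intro sum_mono) (auto simp: P_def intro: less_imp_le)
    ultimately have "\<epsilon> * (\<Sum>i\<in>F. snd i - fst i) < \<epsilon> * (\<eta>/2)"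
      unfolding sum_distrib_left by linarith
    then have "(\<Sum>i\<in>F. snd i - fst i) < \<eta>/2" using \<open>\<epsilon> > 0\<close> by (simp only: mult_less_cancel_left_pos)
    note m = measure_UN_intervals[OF F(1) FK(1) F(3)]
    have "measure lebesgue ((\<Union>i\<in>F. {fst i..snd i}) \<union> Z) \<le> measure lebesgue (\<Union>i\<in>F. {fst i..snd i}) + measure lebesgue Z"
      using m(1) Z(1) by (intro measure_Un_le) auto
    also have "\<dots> \<le> \<eta>" using m(2) \<open>(\<Sum>i\<in>F. snd i - fst i) < \<eta>/2\<close> Z(2) by simp
    finally show "\<exists>T. E \<epsilon> \<subseteq> T \<and> T \<in> lmeasurable \<and> measure lebesgue T \<le> \<eta>"
      using Z m(1) by (intro exI[of _ "(\<Union>i\<in>F. {fst i..snd i}) \<union> Z"]) auto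
  qed
  then have "negligible (\<Union>n. E (inverse (real (Suc n))))" by (intro negligible_countable_Union) auto
  moreover have "{x\<in>{a<..<b}. \<not> (G has_vector_derivative g x) (at x)} \<subseteq> (\<Union>n. E (inverse (real (Suc n))))"
  proof
    fix x assume "x \<in> {x\<in>{a<..<b}. \<not> (G has_vector_derivative g x) (at x)}"
    then have x: "x \<in> {a<..<b}" and "\<not> (G has_derivative (\<lambda>h. h *\<^sub>R g x)) (at x)"
      by (auto simp: has_vector_derivative_def)
    then obtain e where e: "e > 0" "\<And>d. d > 0 \<Longrightarrow> \<exists>y. norm (y - x) < d \<and> \<not> norm (G y - G x - (y - x) *\<^sub>R g x) \<le> e * norm (y - x)"
      unfolding has_derivative_at_alt using bounded_linear_scaleR_left by blast
    obtain n where n: "inverse (real (Suc n)) < e" using reals_Archimedean[OF e(1)] by blast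
    have "x \<in> E (inverse (real (Suc n)))"
    proof -
      have "\<exists>y. \<bar>y - x\<bar> < d \<and> norm (G y - G x - (y - x) *\<^sub>R g x) > inverse (real (Suc n)) * \<bar>y - x\<bar>" if d0: "d > 0" for d
      proof -
        obtain y where "norm (y - x) < d" "norm (G y - G x - (y - x) *\<^sub>R g x) > e * norm (y - x)"
          using e(2)[OF d0] by force
        moreover have "inverse (real (Suc n)) * \<bar>y - x\<bar> \<le> e * \<bar>y - x\<bar>" using n by (intro mult_right_mono) auto
        ultimately show ?thesis by (intro exI[of _ y]) auto
      qed
      then show ?thesis using x by (auto simp: E_def)
    qed
    then show "x \<in> (\<Union>n. E (inverse (real (Suc n))))" by blast
  qed
  ultimately show ?thesis using negligible_subset unfolding G_def by blast
qed

section \<open>Derivates of an absolutely continuous function\<close>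

text \<open>The intervals contain \<open>x\<close>, possibly as an endpoint, and shrink to it.
  Taking for \<open>P u v\<close> the condition \<open>u \<le> p * v\<close> bounds the lower
  derivate of \<open>Re f\<close> at \<open>x\<close> by \<open>p\<close> from above;
  \<open>u \<ge> q * v\<close> bounds the upper derivate by \<open>q\<close> from below. The real
  part is taken because slopes have to be ordered.\<close>

definition near_increments :: "real \<Rightarrow> real \<Rightarrow> cfun \<Rightarrow> real \<Rightarrow> (real \<Rightarrow> real \<Rightarrow> bool) \<Rightarrow> bool" where
  "near_increments a b f x P \<longleftrightarrow> (\<forall>d>0. \<exists>s t. a \<le> s \<and> s \<le> x \<and> x \<le> t \<and> t \<le> b \<and> s < t \<and> t - s < d \<and>
     P (Re (f t - f s)) (t - s))"

text \<open>A Vitali cover of the exceptional set by intervals of slope at most \<open>p\<close>, and inside it one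
  of slope at least \<open>q\<close>, fill nearly the same measure; so the increments over the small
  remainder would not be small.\<close>

lemma abs_cont_on_derivates_agree:
  assumes ac: "abs_cont_on a b f" and "p < q"
  shows "negligible {x\<in>{a<..<b}. near_increments a b f x (\<lambda>u v. u \<le> p * v) \<and>
    near_increments a b f x (\<lambda>u v. u \<ge> q * v)}"
    (is "negligible ?E")
proof (rule ccontr)
  assume not: "\<not> negligible ?E"
  let ?I = "\<lambda>i::real\<times>real. {fst i..snd i}"
  \<comment> \<open>\<open>?E\<close> is not known to be measurable. \<open>H0\<close> is a
    measurable hull with the same outer measure, so \<open>m\<close> is a lower bound for the
    measure of every measurable superset of \<open>?E\<close>.\<close>
  obtain H0 where H0: "H0 \<in> sets lebesgue" "?E \<subseteq> H0" "outer_measure_of lebesgue ?E = emeasure lebesgue H0"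
    using outer_measure_of_attain[of ?E lebesgue] by auto
  define H where "H = H0 \<inter> {a<..<b}"
  have Hm: "H \<in> lmeasurable" using H0(1) unfolding H_def by (metis fmeasurable_Int_fmeasurable inf_commute lmeasurable_interval(2))
  have EH: "?E \<subseteq> H" using H0(2) by (auto simp: H_def)
  define m where "m = measure lebesgue H"
  have m_le: "m \<le> measure lebesgue S" if "S \<in> lmeasurable" "?E \<subseteq> S" for S
  proof -
    have "emeasure lebesgue H \<le> emeasure lebesgue H0" using H0(1) by (intro emeasure_mono) (auto simp: H_def)
    also have "\<dots> \<le> emeasure lebesgue S" unfolding H0(3)[symmetric] outer_measure_of_def
      using that by (intro INF_lower) auto
    finally show ?thesis using Hm that(1) by (simp add: m_def emeasure_eq_measure2)
  qed
  have "m > 0"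
  proof (rule ccontr)
    assume "\<not> m > 0"
    then have "m = 0" by (simp add: m_def less_le)
    then have "negligible H" using Hm by (simp add: m_def negligible_iff_measure)
    then show False using not EH negligible_subset by blast
  qed
  \<comment> \<open>The gap estimate and the slope \<open>p\<close> will each cost at most
    \<open>\<epsilon>\<close>, leaving \<open>(q - p) * L2 < 2 * \<epsilon>\<close>, that is
    \<open>L2 < m / 2\<close>.\<close>
  define \<epsilon> where "\<epsilon> = (q - p) * m / 4"
  have "\<epsilon> > 0" using \<open>p < q\<close> \<open>m > 0\<close> by (simp add: \<epsilon>_def)
  obtain \<delta>0 where \<delta>0: "\<delta>0 > 0" and gaps: "gap_bound a b f \<delta>0 \<epsilon>"
    by (rule abs_cont_on_gaps[OF ac \<open>\<epsilon> > 0\<close>])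
  \<comment> \<open>The three bounds serve, in this order, the gap estimate, the inequality
    \<open>L2 > m / 2\<close>, and the error
    \<open>\<bar>p\<bar> * \<delta> \<le> \<epsilon>\<close>.\<close>
  define \<delta> where "\<delta> = min \<delta>0 (min (m/2) (\<epsilon> / (\<bar>p\<bar> + 1)))"
  have \<delta>: "\<delta> > 0" "\<delta> \<le> \<delta>0" "\<delta> \<le> m/2" "\<delta> \<le> \<epsilon> / (\<bar>p\<bar> + 1)"
    using \<delta>0 \<open>m > 0\<close> \<open>\<epsilon> > 0\<close> unfolding \<delta>_def
    by (simp, intro min.cobounded1, intro min.coboundedI2 min.cobounded1, intro min.coboundedI2 min.cobounded2)
  \<comment> \<open>An open set barely larger than \<open>H\<close> keeps the total length of the
    first family below \<open>m + \<delta>/3\<close>.\<close>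
  obtain U0 where U0: "open U0" "H \<subseteq> U0" "U0 \<in> lmeasurable" "measure lebesgue U0 < m + \<delta>/3"
  proof -
    have "\<delta>/3 > 0" using \<delta>(1) by simp
    then obtain T where T: "open T" "H \<subseteq> T" "T - H \<in> lmeasurable" "emeasure lebesgue (T - H) < ennreal (\<delta>/3)"
      using sets_lebesgue_outer_open[OF fmeasurableD[OF Hm]] by blast
    have TU: "T = H \<union> (T - H)" using T(2) by blast
    then have Tm: "T \<in> lmeasurable" using Hm T(3) by (metis fmeasurable.Un)
    have "measure lebesgue (T - H) < \<delta>/3"
      using T(3,4) \<delta>(1) by (simp add: emeasure_eq_measure2 ennreal_less_iff)
    moreover have "measure lebesgue T \<le> m + measure lebesgue (T - H)"
      using TU Hm T(3) unfolding m_def by (metis measure_Un_le fmeasurableD)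
    ultimately show thesis using that[OF T(1,2) Tm] by linarith
  qed
  define U where "U = U0 \<inter> {a<..<b}"
  have U: "open U" "?E \<subseteq> U" "U \<subseteq> {a<..<b}" using U0 EH by (auto simp: U_def)
  define K1 where "K1 = {(s,t). s < t \<and> {s..t} \<subseteq> U \<and> Re (f t - f s) \<le> p * (t - s)}"
  have K1: "s < t \<and> a \<le> s \<and> t \<le> b" if "(s,t) \<in> K1" for s t
  proof -
    have "s \<in> {s..t}" "t \<in> {s..t}" "s < t" using that by (auto simp: K1_def)
    then show ?thesis using that U(3) unfolding K1_def by fastforce
  qed
  have cov1: "\<exists>s t. (s,t) \<in> K1 \<and> s \<le> x \<and> x \<le> t \<and> t - s < d" if x: "x \<in> ?E" and "d > 0" for x d
  proof -
    obtain d1 where d1: "d1 > 0" "ball x d1 \<subseteq> U" using U(1,2) x open_contains_ball by blast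
    have m0: "min d d1 > 0" using d1 \<open>d > 0\<close> by simp
    have "near_increments a b f x (\<lambda>u v. u \<le> p * v)" using x by simp
    from this[unfolded near_increments_def, rule_format, OF m0] obtain s t where st: "s \<le> x" "x \<le> t" "s < t" "t - s < min d d1" "Re (f t - f s) \<le> p * (t - s)"
      by blast
    then have "{s..t} \<subseteq> ball x d1" by (auto simp: dist_real_def)
    then show ?thesis using st d1 by (intro exI[of _ s] exI[of _ t]) (auto simp: K1_def)
  qed
  have "\<delta>/6 > 0" using \<delta>(1) by simp
  obtain F1 Z1 where F1: "finite F1" "F1 \<subseteq> K1" "disjoint_intervals F1"
    and Z1: "Z1 \<in> lmeasurable" "measure lebesgue Z1 < \<delta>/6" "?E \<subseteq> (\<Union>i\<in>F1. ?I i) \<union> Z1"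
    by (rule Vitali_cover_finite[OF K1 cov1 \<open>\<delta>/6 > 0\<close>])
  have F1K: "a \<le> fst i \<and> fst i < snd i \<and> snd i \<le> b" "?I i \<subseteq> U" "Re (f (snd i) - f (fst i)) \<le> p * (snd i - fst i)"
    if "i \<in> F1" for i
    using subsetD[OF F1(2) that] K1[of "fst i" "snd i"] by (simp_all add: K1_def case_prod_beta)
  \<comment> \<open>The second family lies in the open interiors of the first, so that the gap
    estimate compares the two. The finitely many endpoints lost in this way form the null set
    \<open>P\<close> below.\<close>
  define K2 where "K2 = {(s,t). s < t \<and> (\<exists>i\<in>F1. {s..t} \<subseteq> {fst i<..<snd i}) \<and> Re (f t - f s) \<ge> q * (t - s)}"
  have K2': "\<exists>i\<in>F1. fst i \<le> s \<and> t \<le> snd i" if st: "(s,t) \<in> K2" for s t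
  proof -
    obtain i where i: "i \<in> F1" "{s..t} \<subseteq> {fst i<..<snd i}" "s < t" using st unfolding K2_def by blast
    have "s \<in> {fst i<..<snd i}" "t \<in> {fst i<..<snd i}"
      using subsetD[OF i(2), of s] subsetD[OF i(2), of t] i(3) by auto
    then show ?thesis using i(1) by (intro bexI[of _ i]) auto
  qed
  have K2: "s < t \<and> a \<le> s \<and> t \<le> b" if "(s,t) \<in> K2" for s t
    using K2'[OF that] F1K(1) that by (fastforce simp: K2_def)
  define E2 where "E2 = ?E \<inter> (\<Union>i\<in>F1. {fst i<..<snd i})"
  have cov2: "\<exists>s t. (s,t) \<in> K2 \<and> s \<le> x \<and> x \<le> t \<and> t - s < d" if x: "x \<in> E2" and "d > 0" for x d
  proof -
    obtain i where i: "i \<in> F1" "x \<in> {fst i<..<snd i}" and xE: "x \<in> ?E" using x unfolding E2_def by blast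
    obtain d1 where d1: "d1 > 0" "ball x d1 \<subseteq> {fst i<..<snd i}"
      by (rule openE[OF open_greaterThanLessThan i(2)])
    have m0: "min d d1 > 0" using d1 \<open>d > 0\<close> by simp
    have "near_increments a b f x (\<lambda>u v. u \<ge> q * v)" using xE by simp
    from this[unfolded near_increments_def, rule_format, OF m0] obtain s t where st: "s \<le> x" "x \<le> t" "s < t" "t - s < min d d1" "Re (f t - f s) \<ge> q * (t - s)"
      by blast
    then have "{s..t} \<subseteq> ball x d1" by (auto simp: dist_real_def)
    then have "{s..t} \<subseteq> {fst i<..<snd i}" using d1 by blast
    then have "(s,t) \<in> K2" using st i by (auto simp: K2_def)
    then show ?thesis using st by auto
  qed
  obtain F2 Z2 where F2: "finite F2" "F2 \<subseteq> K2" "disjoint_intervals F2"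
    and Z2: "Z2 \<in> lmeasurable" "measure lebesgue Z2 < \<delta>/6" "E2 \<subseteq> (\<Union>i\<in>F2. ?I i) \<union> Z2"
    by (rule Vitali_cover_finite[OF K2 cov2 \<open>\<delta>/6 > 0\<close>])
  have F2K: "fst j < snd j \<and> (\<exists>i\<in>F1. fst i \<le> fst j \<and> snd j \<le> snd i)" "Re (f (snd j) - f (fst j)) \<ge> q * (snd j - fst j)"
    if "j \<in> F2" for j
    using subsetD[OF F2(2) that] K2'[of "fst j" "snd j"] by (simp_all add: K2_def case_prod_beta)
  define L1 where "L1 = (\<Sum>i\<in>F1. snd i - fst i)"
  define L2 where "L2 = (\<Sum>j\<in>F2. snd j - fst j)"
  have m1: "(\<Union>i\<in>F1. ?I i) \<in> lmeasurable" "measure lebesgue (\<Union>i\<in>F1. ?I i) = L1"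
    unfolding L1_def by (rule measure_UN_intervals; use F1 F1K in auto)+
  have m2: "(\<Union>i\<in>F2. ?I i) \<in> lmeasurable" "measure lebesgue (\<Union>i\<in>F2. ?I i) = L2"
    unfolding L2_def by (rule measure_UN_intervals; use F2 F2K in auto)+
  have "L1 \<le> measure lebesgue U0"
    unfolding m1(2)[symmetric] using m1(1) U0(3) F1K(2) by (intro measure_mono_fmeasurable) (auto simp: U_def fmeasurableD)
  then have L1: "L1 < m + \<delta>/3" using U0(4) by simp
  define P where "P = fst ` F1 \<union> snd ` F1"
  have P: "P \<in> lmeasurable" "measure lebesgue P = 0"
    using F1(1) negligible_finite[of P] by (auto simp: P_def negligible_iff_measure)
  have "?E \<subseteq> (\<Union>i\<in>F2. ?I i) \<union> (Z2 \<union> (Z1 \<union> P))"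
  proof
    fix x assume x: "x \<in> ?E"
    show "x \<in> (\<Union>i\<in>F2. ?I i) \<union> (Z2 \<union> (Z1 \<union> P))"
    proof (cases "x \<in> Z1 \<union> P")
      case False
      then obtain i where i: "i \<in> F1" "x \<in> ?I i" using Z1(3) x by blast
      then have "x \<noteq> fst i" "x \<noteq> snd i" using False by (auto simp: P_def)
      then have "x \<in> {fst i<..<snd i}" using i by auto
      then have "x \<in> E2" using x i unfolding E2_def by blast
      then show ?thesis using Z2(3) by blast
    qed auto
  qed
  then have "m \<le> measure lebesgue ((\<Union>i\<in>F2. ?I i) \<union> (Z2 \<union> (Z1 \<union> P)))"
    using m2(1) Z1(1) Z2(1) P(1) by (intro m_le) auto
  also have "\<dots> \<le> L2 + measure lebesgue (Z2 \<union> (Z1 \<union> P))"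
    using m2 Z1(1) Z2(1) P(1) by (subst m2(2)[symmetric], intro measure_Un_le) auto
  also have "measure lebesgue (Z2 \<union> (Z1 \<union> P)) \<le> measure lebesgue Z2 + measure lebesgue (Z1 \<union> P)"
    using Z1(1) Z2(1) P(1) by (intro measure_Un_le) auto
  also have "measure lebesgue (Z1 \<union> P) \<le> measure lebesgue Z1 + measure lebesgue P"
    using Z1(1) P(1) by (intro measure_Un_le) auto
  finally have L2: "m \<le> L2 + \<delta>/3" using Z1(2) Z2(2) P(2) by simp
  have L12: "L2 \<le> L1"
    unfolding m1(2)[symmetric] m2(2)[symmetric]
  proof (rule measure_mono_fmeasurable)
    show "(\<Union>i\<in>F2. ?I i) \<subseteq> (\<Union>i\<in>F1. ?I i)"
    proof
      fix x assume "x \<in> (\<Union>i\<in>F2. ?I i)"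
      then obtain j where "j \<in> F2" "x \<in> ?I j" by auto
      then show "x \<in> (\<Union>i\<in>F1. ?I i)" using F2K(1)[of j] by fastforce
    qed
  qed (use m1 m2 in auto)
  have "norm ((\<Sum>i\<in>F1. f (snd i) - f (fst i)) - (\<Sum>j\<in>F2. f (snd j) - f (fst j))) < \<epsilon>"
    using L1 L2 \<delta> by (intro gaps[unfolded gap_bound_def, rule_format] F1 F2 F1K F2K) (auto simp: L1_def[symmetric] L2_def[symmetric])
  then have "\<bar>Re ((\<Sum>i\<in>F1. f (snd i) - f (fst i)) - (\<Sum>j\<in>F2. f (snd j) - f (fst j)))\<bar> < \<epsilon>"
    using abs_Re_le_cmod le_less_trans by blast
  then have "(\<Sum>j\<in>F2. Re (f (snd j) - f (fst j))) - (\<Sum>i\<in>F1. Re (f (snd i) - f (fst i))) < \<epsilon>"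
    by (simp add: Re_sum)
  moreover have "(\<Sum>j\<in>F2. Re (f (snd j) - f (fst j))) \<ge> q * L2"
    unfolding L2_def sum_distrib_left by (intro sum_mono F2K)
  moreover have "(\<Sum>i\<in>F1. Re (f (snd i) - f (fst i))) \<le> p * L1"
    unfolding L1_def sum_distrib_left by (intro sum_mono F1K)
  ultimately have 1: "q * L2 - p * L1 < \<epsilon>" by linarith
  have "p * (L1 - L2) \<le> \<bar>p\<bar> * \<delta>" using L1 L2 L12 \<delta>(1) by (intro mult_mono) auto
  also have "\<dots> \<le> (\<bar>p\<bar> + 1) * \<delta>" using \<delta>(1) by simp
  also have "\<dots> \<le> \<epsilon>" using \<delta>(4) by (simp add: field_simps)
  finally have "(q - p) * L2 < 2 * \<epsilon>" using 1 by (simp add: algebra_simps)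
  then have "(q - p) * L2 < (q - p) * (m / 2)" by (simp add: \<epsilon>_def mult.commute)
  then have "L2 < m / 2" using \<open>p < q\<close> by simp
  then show False using L2 \<delta>(3) \<open>m > 0\<close> by simp
qed

section \<open>Closure properties of absolute continuity\<close>

text \<open>A single comparison of increments from which Lipschitz functions, sums, products,
  conjugates and changes of representative all follow.\<close>

lemma abs_cont_on_dominated:
  assumes f: "abs_cont_on a b f" and g: "abs_cont_on a b g" and "M \<ge> 0"
    and F: "\<And>x y. x \<in> {a..b} \<Longrightarrow> y \<in> {a..b} \<Longrightarrow> dist (F x) (F y) \<le> M * (dist (f x) (f y) + dist (g x) (g y))"
  shows "abs_cont_on a b F"
  unfolding abs_cont_on_iff
proof (intro allI impI)
  fix \<epsilon> :: real assume "\<epsilon> > 0"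
  \<comment> \<open>With \<open>M + 1\<close> in place of \<open>M\<close> the case
    \<open>M = 0\<close> needs no separate treatment.\<close>
  define e where "e = \<epsilon> / (2 * (M + 1))"
  have "e > 0" using \<open>\<epsilon> > 0\<close> \<open>M \<ge> 0\<close> by (simp add: e_def)
  obtain d1 where d1: "d1 > 0" "\<forall>n s t. nonoverlapping a b n s t \<longrightarrow> (\<Sum>i<n. t i - s i) < d1 \<longrightarrow>
      (\<Sum>i<n. dist (f (s i)) (f (t i))) < e"
    by (rule abs_cont_onE[OF f \<open>e > 0\<close>])
  obtain d2 where d2: "d2 > 0" "\<forall>n s t. nonoverlapping a b n s t \<longrightarrow> (\<Sum>i<n. t i - s i) < d2 \<longrightarrow>
      (\<Sum>i<n. dist (g (s i)) (g (t i))) < e"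
    by (rule abs_cont_onE[OF g \<open>e > 0\<close>])
  show "\<exists>\<delta>>0. \<forall>n s t. nonoverlapping a b n s t \<longrightarrow> (\<Sum>i<n. t i - s i) < \<delta> \<longrightarrow> (\<Sum>i<n. dist (F (s i)) (F (t i))) < \<epsilon>"
  proof (intro exI[of _ "min d1 d2"] conjI allI impI)
    show "min d1 d2 > 0" using d1 d2 by simp
    fix n :: nat and s t :: "nat \<Rightarrow> real"
    assume no: "nonoverlapping a b n s t"
      and 3: "(\<Sum>i<n. t i - s i) < min d1 d2"
    have "(\<Sum>i<n. t i - s i) < d1" "(\<Sum>i<n. t i - s i) < d2" using 3 by auto
    then have fg: "(\<Sum>i<n. dist (f (s i)) (f (t i))) < e" "(\<Sum>i<n. dist (g (s i)) (g (t i))) < e"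
      using d1(2) d2(2) no by auto
    have st: "s i \<in> {a..b} \<and> t i \<in> {a..b}" if "i < n" for i using no that unfolding nonoverlapping_def by force
    have "(\<Sum>i<n. dist (F (s i)) (F (t i))) \<le> (\<Sum>i<n. M * (dist (f (s i)) (f (t i)) + dist (g (s i)) (g (t i))))"
      using st by (intro sum_mono F) auto
    also have "\<dots> = M * ((\<Sum>i<n. dist (f (s i)) (f (t i))) + (\<Sum>i<n. dist (g (s i)) (g (t i))))"
      by (simp only: sum_distrib_left sum.distrib distrib_left)
    also have "\<dots> \<le> M * (e + e)" using fg \<open>M \<ge> 0\<close> by (intro mult_left_mono add_mono) auto
    also have "\<dots> < (M + 1) * (e + e)" using \<open>e > 0\<close> by simp
    also have "\<dots> = e * (2 * (M + 1))" by (simp add: algebra_simps)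
    also have "\<dots> = \<epsilon>" using \<open>M \<ge> 0\<close> by (simp add: e_def)
    finally show "(\<Sum>i<n. dist (F (s i)) (F (t i))) < \<epsilon>" .
  qed
qed

lemma abs_cont_on_of_real: "abs_cont_on a b complex_of_real"
  unfolding abs_cont_on_iff
proof (intro allI impI)
  fix \<epsilon> :: real assume "\<epsilon> > 0"
  show "\<exists>\<delta>>0. \<forall>n s t. nonoverlapping a b n s t \<longrightarrow> (\<Sum>i<n. t i - s i) < \<delta> \<longrightarrow> (\<Sum>i<n. dist (complex_of_real (s i)) (complex_of_real (t i))) < \<epsilon>"
  proof (intro exI[of _ \<epsilon>] conjI allI impI)
    fix n :: nat and s t :: "nat \<Rightarrow> real"
    assume "nonoverlapping a b n s t" and 3: "(\<Sum>i<n. t i - s i) < \<epsilon>"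
    have "(\<Sum>i<n. dist (complex_of_real (s i)) (complex_of_real (t i))) = (\<Sum>i<n. t i - s i)"
      using \<open>nonoverlapping a b n s t\<close> by (intro sum.cong) (auto simp: nonoverlapping_def dist_of_real dist_real_def)
    then show "(\<Sum>i<n. dist (complex_of_real (s i)) (complex_of_real (t i))) < \<epsilon>" using 3 by simp
  qed (use \<open>\<epsilon> > 0\<close> in auto)
qed

lemma abs_cont_on_lipschitz:
  assumes "\<And>x y. x \<in> {a..b} \<Longrightarrow> y \<in> {a..b} \<Longrightarrow> dist (F x) (F y) \<le> M * dist x y" "M \<ge> 0"
  shows "abs_cont_on a b F"
proof (rule abs_cont_on_dominated[OF abs_cont_on_of_real abs_cont_on_of_real \<open>M \<ge> 0\<close>])
  fix x y assume "x \<in> {a..b}" "y \<in> {a..b}"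
  then have "dist (F x) (F y) \<le> M * dist x y" by (rule assms)
  also have "\<dots> \<le> M * (dist x y + dist x y)" using \<open>M \<ge> 0\<close> by (intro mult_left_mono) auto
  finally show "dist (F x) (F y) \<le> M * (dist (complex_of_real x) (complex_of_real y) + dist (complex_of_real x) (complex_of_real y))"
    by (simp add: dist_of_real)
qed

lemma abs_cont_on_imp_continuous_on:
  assumes "abs_cont_on a b f"
  shows "continuous_on {a..b} f"
  unfolding continuous_on_iff
proof (intro ballI allI impI)
  fix x \<epsilon> :: real assume x: "x \<in> {a..b}" and "\<epsilon> > 0"
  obtain \<delta> where \<delta>: "\<delta> > 0" and H: "\<forall>n s t. nonoverlapping a b n s t \<longrightarrow> (\<Sum>i<n. t i - s i) < \<delta> \<longrightarrow>
      (\<Sum>i<n. dist (f (s i)) (f (t i))) < \<epsilon>"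
    by (rule abs_cont_onE[OF assms \<open>\<epsilon> > 0\<close>])
  show "\<exists>d>0. \<forall>x'\<in>{a..b}. dist x' x < d \<longrightarrow> dist (f x') (f x) < \<epsilon>"
  proof (intro exI[of _ \<delta>] conjI ballI impI \<delta>)
    fix y assume y: "y \<in> {a..b}" "dist y x < \<delta>"
    show "dist (f y) (f x) < \<epsilon>"
      using H[rule_format, of 1 "\<lambda>_. min x y" "\<lambda>_. max x y"] x y
      by (cases "x \<le> y") (auto simp: nonoverlapping_def dist_real_def dist_commute)
  qed
qed

text \<open>Both factors are bounded on the compact interval, so the increment of the product is
  dominated by the increments of the factors.\<close>

lemma abs_cont_on_mult:
  assumes f: "abs_cont_on a b f" and g: "abs_cont_on a b g"
  shows "abs_cont_on a b (\<lambda>x. f x * g x)"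
proof -
  have "bounded (f ` {a..b})" "bounded (g ` {a..b})"
    using f g by (auto intro!: compact_imp_bounded compact_continuous_image abs_cont_on_imp_continuous_on)
  then obtain A B where A: "\<And>x. x \<in> {a..b} \<Longrightarrow> norm (f x) \<le> A" and B: "\<And>x. x \<in> {a..b} \<Longrightarrow> norm (g x) \<le> B"
    unfolding bounded_iff by (metis image_eqI)
  define M where "M = max 0 (max A B)"
  show ?thesis
  proof (rule abs_cont_on_dominated[OF f g])
    show "M \<ge> 0" by (simp add: M_def)
    fix x y assume xy: "x \<in> {a..b}" "y \<in> {a..b}"
    have "f x * g x - f y * g y = (f x - f y) * g x + f y * (g x - g y)" by (simp add: algebra_simps)
    then have "dist (f x * g x) (f y * g y) \<le> norm (f x - f y) * norm (g x) + norm (f y) * norm (g x - g y)"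
      by (metis dist_norm norm_mult norm_triangle_ineq)
    also have "\<dots> \<le> norm (f x - f y) * M + M * norm (g x - g y)"
      using A[OF xy(2)] B[OF xy(1)] by (intro add_mono mult_left_mono mult_right_mono) (auto simp: M_def)
    finally show "dist (f x * g x) (f y * g y) \<le> M * (dist (f x) (f y) + dist (g x) (g y))"
      by (simp add: dist_norm algebra_simps)
  qed
qed

lemma abs_cont_on_const: "abs_cont_on a b (\<lambda>_. c)"
  by (rule abs_cont_on_lipschitz[of _ _ _ 0]) auto

lemma abs_cont_on_add:
  assumes f: "abs_cont_on a b f" and g: "abs_cont_on a b g"
  shows "abs_cont_on a b (\<lambda>x. f x + g x)"
  by (rule abs_cont_on_dominated[OF f g, of 1]) (auto simp: dist_triangle_add)

lemma abs_cont_on_cmult: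
  assumes f: "abs_cont_on a b f"
  shows "abs_cont_on a b (\<lambda>x. c * f x)"
  by (rule abs_cont_on_mult[OF abs_cont_on_const f])

lemma abs_cont_on_diff:
  assumes f: "abs_cont_on a b f" and g: "abs_cont_on a b g"
  shows "abs_cont_on a b (\<lambda>x. f x - g x)"
  using abs_cont_on_add[OF f abs_cont_on_cmult[OF g, of "-1"]] by simp

lemma abs_cont_on_cnj:
  assumes f: "abs_cont_on a b f"
  shows "abs_cont_on a b (\<lambda>x. cnj (f x))"
  by (rule abs_cont_on_dominated[OF f f, of 1]) (auto simp: dist_norm simp flip: complex_cnj_diff)

lemma abs_cont_on_cong:
  assumes "\<And>x. x \<in> {a..b} \<Longrightarrow> f x = g x" "abs_cont_on a b f"
  shows "abs_cont_on a b g"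
  by (rule abs_cont_on_dominated[OF assms(2,2), of 1]) (auto simp: assms(1))

lemma abs_cont_on_subset:
  assumes "abs_cont_on a b f" "a \<le> c" "d \<le> b"
  shows "abs_cont_on c d f"
  unfolding abs_cont_on_iff
proof (intro allI impI)
  fix \<epsilon> :: real assume "\<epsilon> > 0"
  obtain \<delta> where \<delta>: "\<delta> > 0" and H: "\<forall>n s t. nonoverlapping a b n s t \<longrightarrow> (\<Sum>i<n. t i - s i) < \<delta> \<longrightarrow>
      (\<Sum>i<n. dist (f (s i)) (f (t i))) < \<epsilon>"
    by (rule abs_cont_onE[OF assms(1) \<open>\<epsilon> > 0\<close>])
  show "\<exists>\<delta>>0. \<forall>n s t. nonoverlapping c d n s t \<longrightarrow> (\<Sum>i<n. t i - s i) < \<delta> \<longrightarrow> (\<Sum>i<n. dist (f (s i)) (f (t i))) < \<epsilon>"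
    using assms(2,3) by (intro exI[of _ \<delta>] conjI allI impI \<delta> H[rule_format]) (auto simp: nonoverlapping_def intro: order_trans)
qed

text \<open>Truncate \<open>norm (g x)\<close> at a height \<open>n\<close> for which the excess
  \<open>w\<close> has integral below \<open>\<epsilon>/2\<close>. The truncated part contributes at
  most \<open>n\<close> times the total length, which the choice of \<open>\<delta>\<close> makes at
  most \<open>\<epsilon>/2\<close>.\<close>

lemma abs_cont_on_indefinite_integral:
  assumes g: "g absolutely_integrable_on {a..b}"
  shows "abs_cont_on a b (\<lambda>x. integral {a..x} g)"
  unfolding abs_cont_on_iff
proof (intro allI impI)
  fix \<epsilon> :: real assume "\<epsilon> > 0"
  define r where "r x = norm (g x)" for x
  have rint: "r absolutely_integrable_on {a..b}" using g unfolding r_def by (rule absolutely_integrable_norm[unfolded o_def])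
  have min_int: "(\<lambda>x. min (r x) (real n)) absolutely_integrable_on {a..b}" for n
    by (rule absolutely_integrable_min_1[OF rint]) simp
  have "(\<lambda>n. integral {a..b} (\<lambda>x. min (r x) (real n))) \<longlonglongrightarrow> integral {a..b} r"
  proof (rule dominated_convergence(2))
    show "(\<lambda>x. min (r x) (real n)) integrable_on {a..b}" for n
      using min_int[of n] by (simp only: absolutely_integrable_on_def)
    show "r integrable_on {a..b}" using rint by (simp only: absolutely_integrable_on_def)
    show "norm (min (r x) (real n)) \<le> r x" for x n by (auto simp: r_def min_def)
    show "(\<lambda>n. min (r x) (real n)) \<longlonglongrightarrow> r x" for x
    proof (rule tendsto_eventually)
      obtain N where "r x \<le> real N" using real_arch_simple by blast
      then show "\<forall>\<^sub>F n in sequentially. min (r x) (real n) = r x"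
        unfolding eventually_sequentially by (intro exI[of _ N]) (auto simp: min_def)
    qed
  qed
  then have "\<forall>\<^sub>F n in sequentially. integral {a..b} r - \<epsilon>/2 < integral {a..b} (\<lambda>x. min (r x) (real n))"
    using \<open>\<epsilon> > 0\<close> by (intro order_tendstoD) auto
  then obtain n where n: "integral {a..b} r - \<epsilon>/2 < integral {a..b} (\<lambda>x. min (r x) (real n))"
    by (auto simp: eventually_sequentially)
  define w where "w x = r x - min (r x) (real n)" for x
  have rI: "r integrable_on {a..b}" and mI: "(\<lambda>x. min (r x) (real n)) integrable_on {a..b}"
    using rint min_int by (simp_all only: absolutely_integrable_on_def)
  then have wI: "w integrable_on {a..b}" unfolding w_def by (rule integrable_diff)
  have w: "integral {a..b} w < \<epsilon>/2"
    unfolding w_def using rI mI n by (subst integral_diff) auto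
  have w0: "w x \<ge> 0" for x by (auto simp: w_def)
  show "\<exists>\<delta>>0. \<forall>m s t. nonoverlapping a b m s t \<longrightarrow> (\<Sum>i<m. t i - s i) < \<delta> \<longrightarrow> (\<Sum>i<m. dist (integral {a..s i} g) (integral {a..t i} g)) < \<epsilon>"
  proof (intro exI[of _ "\<epsilon> / (2 * (real n + 1))"] conjI allI impI)
    show "\<epsilon> / (2 * (real n + 1)) > 0" using \<open>\<epsilon> > 0\<close> by simp
    fix m :: nat and s t :: "nat \<Rightarrow> real"
    assume no: "nonoverlapping a b m s t"
      and less: "(\<Sum>i<m. t i - s i) < \<epsilon> / (2 * (real n + 1))"
    note st = no[unfolded nonoverlapping_def, THEN conjunct1] and dj = no[unfolded nonoverlapping_def, THEN conjunct2]
    have gI: "g integrable_on {a..b}" using g by (simp only: absolutely_integrable_on_def)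
    have one: "dist (integral {a..s i} g) (integral {a..t i} g) \<le> integral {s i..t i} w + real n * (t i - s i)"
      if "i < m" for i
    proof -
      have sub: "{s i..t i} \<subseteq> {a..b}" using st that by auto
      have "g integrable_on {a..t i}" using gI st that by (meson integrable_on_subinterval atLeastatMost_subset_iff order_refl)
      then have "integral {a..s i} g + integral {s i..t i} g = integral {a..t i} g"
        using st that by (intro Henstock_Kurzweil_Integration.integral_combine) auto
      then have "integral {a..t i} g = integral {a..s i} g + integral {s i..t i} g" by simp
      then have "dist (integral {a..s i} g) (integral {a..t i} g) = norm (integral {s i..t i} g)"
        by (simp add: dist_norm)
      also have "\<dots> \<le> integral {s i..t i} (\<lambda>x. w x + real n)"
      proof (rule integral_norm_bound_integral)
        show "g integrable_on {s i..t i}" using gI sub by (rule integrable_on_subinterval)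
        show "(\<lambda>x. w x + real n) integrable_on {s i..t i}"
          using wI sub by (intro integrable_add) (auto intro: integrable_on_subinterval)
      qed (auto simp: w_def r_def)
      also have "\<dots> = integral {s i..t i} w + real n * (t i - s i)"
        using integrable_on_subinterval[OF wI sub] st that by (subst integral_add) auto
      finally show ?thesis .
    qed
    \<comment> \<open>On open intervals at most one summand is nonzero at each point, so the sum
      stays below \<open>w\<close>; closed ones could be counted twice at a common endpoint.\<close>
    have restr: "((\<lambda>x. if x \<in> {s i<..<t i} then w x else 0) has_integral integral {s i..t i} w) {a..b}" if "i < m" for i
    proof -
      have sub: "{s i..t i} \<subseteq> {a..b}" using st that by auto
      have "(w has_integral integral {s i..t i} w) {s i..t i}"
        by (rule integrable_integral[OF integrable_on_subinterval[OF wI sub]])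
      then have "(w has_integral integral {s i..t i} w) {s i<..<t i}"
        by (simp add: has_integral_Icc_iff_Ioo)
      then show ?thesis using sub by (subst has_integral_restrict) (auto intro: subset_trans[OF greaterThanLessThan_subseteq_atLeastAtMost_iff[THEN iffD2]])
    qed
    have "(\<Sum>i<m. integral {s i..t i} w) \<le> integral {a..b} w"
    proof (rule has_integral_le)
      show "((\<lambda>x. \<Sum>i<m. if x \<in> {s i<..<t i} then w x else 0) has_integral (\<Sum>i<m. integral {s i..t i} w)) {a..b}"
        using restr by (intro has_integral_sum) auto
      show "(w has_integral integral {a..b} w) {a..b}" using wI by (rule integrable_integral)
      fix x assume "x \<in> {a..b}"
      show "(\<Sum>i<m. if x \<in> {s i<..<t i} then w x else 0) \<le> w x"
      proof (cases "\<exists>j<m. x \<in> {s j<..<t j}")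
        case True
        then obtain j where j: "j < m" "x \<in> {s j<..<t j}" by blast
        have "(\<Sum>i<m. if x \<in> {s i<..<t i} then w x else 0) = (\<Sum>i<m. if i = j then w x else 0)"
        proof (intro sum.cong refl)
          fix i assume "i \<in> {..<m}"
          show "(if x \<in> {s i<..<t i} then w x else 0) = (if i = j then w x else 0)"
          proof (cases "i = j")
            case False
            then have "{s i<..<t i} \<inter> {s j<..<t j} = {}" using dj j(1) \<open>i \<in> {..<m}\<close> by blast
            then have "x \<notin> {s i<..<t i}" using j(2) by blast
            then show ?thesis using False by auto
          qed (use j in simp)
        qed
        also have "\<dots> = w x" using j by simp
        finally show ?thesis by simp
      next
        case False
        then have "(\<Sum>i<m. if x \<in> {s i<..<t i} then w x else 0) = 0" by (intro sum.neutral) auto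
        then show ?thesis using w0 by simp
      qed
    qed
    moreover have "real n * (\<Sum>i<m. t i - s i) \<le> real n * (\<epsilon> / (2 * (real n + 1)))"
      using less by (intro mult_left_mono) auto
    moreover have "(\<Sum>i<m. integral {s i..t i} w + real n * (t i - s i)) =
        (\<Sum>i<m. integral {s i..t i} w) + real n * (\<Sum>i<m. t i - s i)"
      by (simp only: sum.distrib sum_distrib_left)
    ultimately have "(\<Sum>i<m. integral {s i..t i} w + real n * (t i - s i)) < \<epsilon>/2 + real n * (\<epsilon> / (2 * (real n + 1)))"
      using w by linarith
    also have "\<dots> \<le> \<epsilon>/2 + \<epsilon>/2" using \<open>\<epsilon> > 0\<close> by (simp add: field_simps)
    finally have "(\<Sum>i<m. integral {s i..t i} w + real n * (t i - s i)) < \<epsilon>" by simp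
    moreover have "(\<Sum>i<m. dist (integral {a..s i} g) (integral {a..t i} g)) \<le> (\<Sum>i<m. integral {s i..t i} w + real n * (t i - s i))"
      using one by (intro sum_mono) auto
    ultimately show "(\<Sum>i<m. dist (integral {a..s i} g) (integral {a..t i} g)) < \<epsilon>" by linarith
  qed
qed

section \<open>Differentiability almost everywhere\<close>

text \<open>In a ball of radius \<open>\<delta>/4\<close> disjoint intervals have total length at
  most \<open>\<delta>/2\<close>, so absolute continuity (the gap estimate with \<open>G\<close>
  empty) keeps the sum of their increments below 1. Slopes of at least \<open>n = 2 / \<eta>\<close>
  then force the total length below \<open>\<eta>/2\<close>. Being negligible is a local property,
  so small balls suffice.\<close>

lemma abs_cont_on_derivates_bounded:
  assumes ac: "abs_cont_on a b f"
  shows "negligible {x\<in>{a<..<b}. \<forall>n>0. near_increments a b f x (\<lambda>u v. u \<ge> n * v)}"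
    (is "negligible ?E")
  unfolding locally_negligible_alt[of ?E]
proof
  fix x0 assume x0: "x0 \<in> ?E"
  let ?I = "\<lambda>i::real\<times>real. {fst i..snd i}"
  have "(1::real) > 0" by simp
  obtain \<delta> where \<delta>: "\<delta> > 0" and gaps: "gap_bound a b f \<delta> 1"
    by (rule abs_cont_on_gaps[OF ac \<open>(1::real) > 0\<close>])
  define V where "V = ?E \<inter> ball x0 (\<delta>/4)"
  have "negligible V"
    unfolding negligible_outer_le
  proof (intro allI impI)
    fix \<eta> :: real assume "\<eta> > 0"
    define n where "n = 2 / \<eta>"
    have "n > 0" using \<open>\<eta> > 0\<close> by (simp add: n_def)
    define K where "K = {(s,t). s < t \<and> a \<le> s \<and> t \<le> b \<and> {s..t} \<subseteq> ball x0 (\<delta>/4) \<and> Re (f t - f s) \<ge> n * (t - s)}"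
    have K: "s < t \<and> a \<le> s \<and> t \<le> b" if "(s,t) \<in> K" for s t using that by (auto simp: K_def)
    have cov: "\<exists>s t. (s,t) \<in> K \<and> s \<le> x \<and> x \<le> t \<and> t - s < d" if x: "x \<in> V" and "d > 0" for x d
    proof -
      obtain d1 where d1: "d1 > 0" "ball x d1 \<subseteq> ball x0 (\<delta>/4)"
        using x unfolding V_def by (meson IntD2 openE open_ball)
      have m0: "min d d1 > 0" using d1 \<open>d > 0\<close> by simp
      have "near_increments a b f x (\<lambda>u v. u \<ge> n * v)" using x \<open>n > 0\<close> by (simp add: V_def)
      from this[unfolded near_increments_def, rule_format, OF m0] obtain s t where st: "a \<le> s" "t \<le> b" "s \<le> x" "x \<le> t" "s < t" "t - s < min d d1" "Re (f t - f s) \<ge> n * (t - s)"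
        by blast
      then have "{s..t} \<subseteq> ball x d1" by (auto simp: dist_real_def)
      then have "(s,t) \<in> K" using st d1 unfolding K_def by blast
      then show ?thesis using st by auto
    qed
    have "\<eta>/2 > 0" using \<open>\<eta> > 0\<close> by simp
    obtain F Z where F: "finite F" "F \<subseteq> K" "disjoint_intervals F"
      and Z: "Z \<in> lmeasurable" "measure lebesgue Z < \<eta>/2" "V \<subseteq> (\<Union>i\<in>F. ?I i) \<union> Z"
      by (rule Vitali_cover_finite[OF K cov \<open>\<eta>/2 > 0\<close>])
    have FK: "a \<le> fst i \<and> fst i < snd i \<and> snd i \<le> b" "?I i \<subseteq> ball x0 (\<delta>/4)" "Re (f (snd i) - f (fst i)) \<ge> n * (snd i - fst i)"
      if "i \<in> F" for i
      using subsetD[OF F(2) that] by (simp_all add: K_def case_prod_beta)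
    define L where "L = (\<Sum>i\<in>F. snd i - fst i)"
    have m: "(\<Union>i\<in>F. ?I i) \<in> lmeasurable" "measure lebesgue (\<Union>i\<in>F. ?I i) = L"
      unfolding L_def by (rule measure_UN_intervals; use F FK in auto)+
    have "L \<le> measure lebesgue (ball x0 (\<delta>/4))"
      unfolding m(2)[symmetric] using m(1) FK(2) by (intro measure_mono_fmeasurable) (auto simp: fmeasurableD)
    also have "\<dots> = \<delta>/2" using \<delta> by (simp add: ball_eq_greaterThanLessThan)
    finally have "L < \<delta>" using \<delta> by simp
    then have "norm ((\<Sum>i\<in>F. f (snd i) - f (fst i)) - (\<Sum>j\<in>{}. f (snd j) - f (fst j))) < 1"
      by (intro gaps[unfolded gap_bound_def, rule_format] F FK) (auto simp: L_def)
    then have "Re (\<Sum>i\<in>F. f (snd i) - f (fst i)) < 1"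
      using complex_Re_le_cmod[of "\<Sum>i\<in>F. f (snd i) - f (fst i)"] by simp
    moreover have "n * L \<le> Re (\<Sum>i\<in>F. f (snd i) - f (fst i))"
      unfolding Re_sum L_def sum_distrib_left by (intro sum_mono FK)
    ultimately have "n * L < 1" by linarith
    then have "L < \<eta>/2" using \<open>\<eta> > 0\<close> by (simp add: n_def field_simps)
    have "measure lebesgue ((\<Union>i\<in>F. ?I i) \<union> Z) \<le> L + measure lebesgue Z"
      using m(1) Z(1) by (subst m(2)[symmetric], intro measure_Un_le) auto
    also have "\<dots> \<le> \<eta>" using Z(2) \<open>L < \<eta>/2\<close> by simp
    finally show "\<exists>T. V \<subseteq> T \<and> T \<in> lmeasurable \<and> measure lebesgue T \<le> \<eta>"
      using Z m(1) by (intro exI[of _ "(\<Union>i\<in>F. ?I i) \<union> Z"]) auto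
  qed
  then show "\<exists>U. openin (top_of_set ?E) U \<and> x0 \<in> U \<and> negligible U"
    using x0 \<delta> by (intro exI[of _ V]) (auto simp: V_def openin_open_Int)
qed

text \<open>Outside \<open>Y\<close> and \<open>Y'\<close> the difference quotients have finite
  upper and lower limits. If these differed, two rationals between them would place the point in one
  of the countably many null sets \<open>E p q\<close>.\<close>

lemma abs_cont_on_Re_differentiable_AE:
  assumes ac: "abs_cont_on a b f"
  shows "negligible {x\<in>{a<..<b}. \<nexists>D. ((\<lambda>x. Re (f x)) has_real_derivative D) (at x)}"
proof -
  let ?B = "near_increments a b f"
  define E where "E p q = {x\<in>{a<..<b}. ?B x (\<lambda>u v. u \<le> p * v) \<and> ?B x (\<lambda>u v. u \<ge> q * v)}" for p q :: real
  define Y where "Y = {x\<in>{a<..<b}. \<forall>n>0. ?B x (\<lambda>u v. u \<ge> n * v)}"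
  define Y' where "Y' = {x\<in>{a<..<b}. \<forall>n>0. ?B x (\<lambda>u v. u \<le> - n * v)}"
  have nE: "negligible (E p q)" if "p < q" for p q
    unfolding E_def by (rule abs_cont_on_derivates_agree[OF ac that])
  have nY: "negligible Y" unfolding Y_def by (rule abs_cont_on_derivates_bounded[OF ac])
  have "near_increments a b (\<lambda>x. - 1 * f x) x (\<lambda>u v. u \<ge> n * v) \<longleftrightarrow> ?B x (\<lambda>u v. u \<le> - n * v)" for x n
  proof -
    have "Re (- 1 * f t - - 1 * f s) \<ge> n * (t - s) \<longleftrightarrow> Re (f t - f s) \<le> - n * (t - s)" for s t by auto
    then show ?thesis unfolding near_increments_def by (simp only:)
  qed
  then have nY': "negligible Y'"
    using abs_cont_on_derivates_bounded[OF abs_cont_on_cmult[OF ac, of "- 1"]] unfolding Y'_def by (simp only:)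
  let ?R = "{r :: rat \<times> rat. fst r < snd r}"
  have "negligible (\<Union>r\<in>?R. E (of_rat (fst r)) (of_rat (snd r)))"
    by (rule negligible_countable_Union) (auto intro!: nE simp: of_rat_less)
  then have "negligible ((\<Union>r\<in>?R. E (of_rat (fst r)) (of_rat (snd r))) \<union> (Y \<union> Y'))"
    using nY nY' by (intro negligible_Un)
  moreover have "{x\<in>{a<..<b}. \<nexists>D. ((\<lambda>x. Re (f x)) has_real_derivative D) (at x)}
      \<subseteq> (\<Union>r\<in>?R. E (of_rat (fst r)) (of_rat (snd r))) \<union> (Y \<union> Y')"
  proof (rule subsetI, rule ccontr)
    fix x assume x: "x \<in> {x\<in>{a<..<b}. \<nexists>D. ((\<lambda>x. Re (f x)) has_real_derivative D) (at x)}"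
      and notin: "x \<notin> (\<Union>r\<in>?R. E (of_rat (fst r)) (of_rat (snd r))) \<union> (Y \<union> Y')"
    have xab: "a < x" "x < b" using x by auto
    define Q where "Q y = (Re (f y) - Re (f x)) / (y - x)" for y
    \<comment> \<open>For \<open>y\<close> on either side of \<open>x\<close>, the interval between
      them is one of those excluded near \<open>x\<close>. The increment over it is
      \<open>Q y * \<bar>y - x\<bar>\<close>, so one statement covers both sides.\<close>
    have ev: "\<forall>\<^sub>F y in at x. y \<noteq> x \<and> \<not> P (Q y * \<bar>y - x\<bar>) \<bar>y - x\<bar>" if B: "\<not> ?B x P" for P
    proof -
      obtain d where d: "d > 0" "\<forall>s t. a \<le> s \<and> s \<le> x \<and> x \<le> t \<and> t \<le> b \<and> s < t \<and> t - s < d \<longrightarrow> \<not> P (Re (f t - f s)) (t - s)"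
        using B unfolding near_increments_def by blast
      show ?thesis unfolding eventually_at
      proof (intro exI[of _ "min d (min (x - a) (b - x))"] conjI ballI impI)
        show "min d (min (x - a) (b - x)) > 0" using d(1) xab by simp
        fix y assume y: "y \<noteq> x \<and> dist y x < min d (min (x - a) (b - x))"
        then show "y \<noteq> x" by simp
        have y': "\<bar>y - x\<bar> < d" "\<bar>y - x\<bar> < x - a" "\<bar>y - x\<bar> < b - x" using y by (auto simp: dist_real_def)
        show "\<not> P (Q y * \<bar>y - x\<bar>) \<bar>y - x\<bar>"
        proof (cases "x < y")
          case True
          then have "\<not> P (Re (f y - f x)) (y - x)" using y' xab by (intro d(2)[rule_format]) auto
          then show ?thesis using True by (simp add: Q_def)
        next
          case False
          then have "\<not> P (Re (f x - f y)) (x - y)" using y y' xab by (intro d(2)[rule_format]) auto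
          moreover have "Q y * (x - y) = Re (f x - f y)" using y False by (simp add: Q_def field_simps)
          ultimately show ?thesis using False by simp
        qed
      qed
    qed
    let ?q = "\<lambda>y. ereal (Q y)"
    have up: "Limsup (at x) ?q \<le> ereal n" if "\<not> ?B x (\<lambda>u v. u \<ge> n * v)" for n
    proof (rule Limsup_bounded)
      show "\<forall>\<^sub>F y in at x. ?q y \<le> ereal n"
        using ev[OF that] by eventually_elim (auto simp: mult_less_cancel_right)
    qed
    have lo: "Liminf (at x) ?q \<ge> ereal n" if "\<not> ?B x (\<lambda>u v. u \<le> n * v)" for n
    proof (rule Liminf_bounded)
      show "\<forall>\<^sub>F y in at x. ereal n \<le> ?q y"
        using ev[OF that] by eventually_elim (auto simp: mult_less_cancel_right)
    qed
    have "\<exists>n>0. \<not> ?B x (\<lambda>u v. u \<ge> n * v)" "\<exists>n>0. \<not> ?B x (\<lambda>u v. u \<le> - n * v)"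
      using notin xab by (auto simp: Y_def Y'_def)
    then obtain n1 n2 where n: "Limsup (at x) ?q \<le> ereal n1" "Liminf (at x) ?q \<ge> ereal (- n2)" using up lo by blast
    have le: "Liminf (at x) ?q \<le> Limsup (at x) ?q" by (rule Liminf_le_Limsup) simp
    obtain l where l: "Liminf (at x) ?q = ereal l" using n le by (cases "Liminf (at x) ?q") auto
    obtain L where L: "Limsup (at x) ?q = ereal L" using n le l by (cases "Limsup (at x) ?q") auto
    have "L \<le> l"
    proof (rule ccontr)
      assume "\<not> L \<le> l"
      then obtain r1 where r1: "l < of_rat r1" "of_rat r1 < L" using of_rat_dense[of l L] by auto
      then obtain r2 where r2: "of_rat r1 < (of_rat r2 :: real)" "of_rat r2 < L" using of_rat_dense[of "of_rat r1" L] by auto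
      have "(r1, r2) \<in> ?R" using r2(1) by (simp add: of_rat_less)
      then have "x \<notin> E (of_rat r1) (of_rat r2)" using notin by fastforce
      then consider "\<not> ?B x (\<lambda>u v. u \<le> of_rat r1 * v)" | "\<not> ?B x (\<lambda>u v. u \<ge> of_rat r2 * v)" using xab by (auto simp: E_def)
      then show False
      proof cases
        case 1 then show ?thesis using lo[OF 1] l r1 by simp
      next
        case 2 then show ?thesis using up[OF 2] L r2 by simp
      qed
    qed
    then have "l = L" using le l L by simp
    then have "(?q \<longlongrightarrow> ereal l) (at x)" using l L by (subst tendsto_iff_Liminf_eq_Limsup) auto
    then have "(Q \<longlongrightarrow> l) (at x)" by simp
    then have "((\<lambda>x. Re (f x)) has_real_derivative l) (at x)"
      unfolding has_field_derivative_iff Q_def .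
    then show False using x by blast
  qed
  ultimately show ?thesis by (rule negligible_subset)
qed

text \<open>The imaginary part of \<open>f\<close> is the real part of
  \<open>- \<i> * f\<close>.\<close>

theorem abs_cont_on_differentiable_AE:
  assumes ac: "abs_cont_on a b f"
  shows "negligible {x\<in>{a<..<b}. \<nexists>D. (f has_vector_derivative D) (at x)}"
proof -
  have im: "Re (- \<i> * f x) = Im (f x)" for x by simp
  have "negligible ({x\<in>{a<..<b}. \<nexists>D. ((\<lambda>x. Re (f x)) has_real_derivative D) (at x)} \<union>
     {x\<in>{a<..<b}. \<nexists>D. ((\<lambda>x. Im (f x)) has_real_derivative D) (at x)})"
    using abs_cont_on_Re_differentiable_AE[OF ac]
      abs_cont_on_Re_differentiable_AE[OF abs_cont_on_cmult[OF ac, of "- \<i>"]] unfolding im by (rule negligible_Un)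
  moreover have "{x\<in>{a<..<b}. \<nexists>D. (f has_vector_derivative D) (at x)} \<subseteq>
     {x\<in>{a<..<b}. \<nexists>D. ((\<lambda>x. Re (f x)) has_real_derivative D) (at x)} \<union>
     {x\<in>{a<..<b}. \<nexists>D. ((\<lambda>x. Im (f x)) has_real_derivative D) (at x)}"
  proof (rule subsetI, rule ccontr)
    fix x assume x: "x \<in> {x\<in>{a<..<b}. \<nexists>D. (f has_vector_derivative D) (at x)}" and
      "x \<notin> {x\<in>{a<..<b}. \<nexists>D. ((\<lambda>x. Re (f x)) has_real_derivative D) (at x)} \<union>
     {x\<in>{a<..<b}. \<nexists>D. ((\<lambda>x. Im (f x)) has_real_derivative D) (at x)}"
    then obtain D1 D2 where "((\<lambda>x. Re (f x)) has_real_derivative D1) (at x)" "((\<lambda>x. Im (f x)) has_real_derivative D2) (at x)"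
      by auto
    then have "((\<lambda>x. Re (f x)) has_vector_derivative D1) (at x)" "((\<lambda>x. Im (f x)) has_vector_derivative D2) (at x)"
      by (simp_all add: has_real_derivative_iff_has_vector_derivative)
    then have "((\<lambda>x. Re (f x) *\<^sub>R 1 + Im (f x) *\<^sub>R \<i>) has_vector_derivative (D1 *\<^sub>R 1 + D2 *\<^sub>R \<i>)) (at x)"
      by (intro has_vector_derivative_add bounded_linear.has_vector_derivative[OF bounded_linear_scaleR_left])
    moreover have "(\<lambda>x. Re (f x) *\<^sub>R 1 + Im (f x) *\<^sub>R \<i>) = f" by (auto simp: complex_eq_iff)
    ultimately show False using x by auto
  qed
  ultimately show ?thesis by (rule negligible_subset)
qed

section \<open>The fundamental theorem of calculus\<close>

text \<open>Almost every point is the left end of arbitrarily short intervals with increment at most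
  \<open>e\<close> times their length. A finite Vitali subfamily fills \<open>{a..b}\<close> up to
  length \<open>\<delta>\<close>, and the gap estimate with the single outer interval
  \<open>(a,b)\<close> bounds the increment over the remainder by \<open>e\<close>.\<close>

lemma abs_cont_on_zero_derivative:
  assumes ac: "abs_cont_on a b f" and "a \<le> b" and N: "negligible N"
    and der: "\<And>x. x \<in> {a<..<b} - N \<Longrightarrow> (f has_vector_derivative 0) (at x)"
  shows "f b = f a"
proof (cases "a = b")
  case False
  then have "a < b" using \<open>a \<le> b\<close> by simp
  let ?I = "\<lambda>i::real\<times>real. {fst i..snd i}"
  have main: "norm (f b - f a) \<le> e * (b - a + 1)" if "e > 0" for e
  proof -
    obtain \<delta> where \<delta>: "\<delta> > 0" and gaps: "gap_bound a b f \<delta> e"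
      by (rule abs_cont_on_gaps[OF ac \<open>e > 0\<close>])
    define K where "K = {(s,t). s < t \<and> a \<le> s \<and> t \<le> b \<and> norm (f t - f s) \<le> e * (t - s)}"
    have K: "s < t \<and> a \<le> s \<and> t \<le> b" if "(s,t) \<in> K" for s t using that by (auto simp: K_def)
    have cov: "\<exists>s t. (s,t) \<in> K \<and> s \<le> x \<and> x \<le> t \<and> t - s < d" if x: "x \<in> {a<..<b} - N" and "d > 0" for x d
    proof -
      have "(f has_derivative (\<lambda>h. h *\<^sub>R 0)) (at x)" using der[OF x] by (simp add: has_vector_derivative_def)
      then obtain d1 where d1: "d1 > 0" "\<And>y. norm (y - x) < d1 \<Longrightarrow> norm (f y - f x) \<le> e * norm (y - x)"
        unfolding has_derivative_at_alt using \<open>e > 0\<close> by auto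
      define r where "r = min (b - x) (min d d1)"
      define y where "y = x + r / 2"
      have "r > 0" "r \<le> b - x" "r \<le> d" "r \<le> d1" using x d1 \<open>d > 0\<close> by (auto simp: r_def)
      then have y: "x < y" "y < b" "y - x < d" "y - x < d1" by (auto simp: y_def)
      then have "(x,y) \<in> K" using x d1(2)[of y] by (auto simp: K_def)
      then show ?thesis using y by (intro exI[of _ x] exI[of _ y]) auto
    qed
    obtain F Z where F: "finite F" "F \<subseteq> K" "disjoint_intervals F"
      and Z: "Z \<in> lmeasurable" "measure lebesgue Z < \<delta>" "{a<..<b} - N \<subseteq> (\<Union>i\<in>F. ?I i) \<union> Z"
      by (rule Vitali_cover_finite[OF K cov \<open>\<delta> > 0\<close>])
    have FK: "fst i < snd i" "a \<le> fst i" "snd i \<le> b" "norm (f (snd i) - f (fst i)) \<le> e * (snd i - fst i)"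
      if "i \<in> F" for i
      using subsetD[OF F(2) that] by (simp_all add: K_def case_prod_beta)
    define L where "L = (\<Sum>i\<in>F. snd i - fst i)"
    have m: "(\<Union>i\<in>F. ?I i) \<in> lmeasurable" "measure lebesgue (\<Union>i\<in>F. ?I i) = L"
      unfolding L_def by (rule measure_UN_intervals; use F FK in auto)+
    have "L \<le> measure lebesgue {a..b}"
      unfolding m(2)[symmetric]
    proof (rule measure_mono_fmeasurable)
      show "(\<Union>i\<in>F. ?I i) \<subseteq> {a..b}"
      proof (rule UN_least)
        fix i assume "i \<in> F"
        from FK(2,3)[OF this] show "?I i \<subseteq> {a..b}" by auto
      qed
    qed (use m(1) in auto)
    then have L: "L \<le> b - a" using \<open>a \<le> b\<close> by simp
    have Nm: "N \<in> lmeasurable" "measure lebesgue N = 0"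
      using N negligible_imp_measurable negligible_imp_measure0 by auto
    have "b - a = measure lebesgue {a<..<b}" using \<open>a \<le> b\<close> by simp
    also have "\<dots> \<le> measure lebesgue ((\<Union>i\<in>F. ?I i) \<union> (Z \<union> N))"
      using Z m(1) Nm(1) by (intro measure_mono_fmeasurable) auto
    also have "\<dots> \<le> L + measure lebesgue (Z \<union> N)"
      using Z m(1) Nm(1) by (subst m(2)[symmetric], intro measure_Un_le) auto
    also have "measure lebesgue (Z \<union> N) \<le> measure lebesgue Z + measure lebesgue N"
      using Z Nm(1) by (intro measure_Un_le) auto
    finally have "(b - a) - L < \<delta>" using Z(2) Nm(2) by simp
    then have "norm ((\<Sum>i\<in>{(a,b)}. f (snd i) - f (fst i)) - (\<Sum>j\<in>F. f (snd j) - f (fst j))) < e"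
      using FK F \<open>a < b\<close> by (intro gaps[unfolded gap_bound_def, rule_format]) (auto simp: L_def)
    moreover have "norm (\<Sum>j\<in>F. f (snd j) - f (fst j)) \<le> e * L"
      unfolding L_def sum_distrib_left by (intro sum_norm_le FK)
    moreover have "e * L \<le> e * (b - a)" using L \<open>e > 0\<close> by simp
    ultimately have "norm (f b - f a) \<le> e * (b - a) + e"
      using norm_triangle_sub[of "f b - f a" "\<Sum>j\<in>F. f (snd j) - f (fst j)"] by simp
    then show ?thesis by (simp add: algebra_simps)
  qed
  have "norm (f b - f a) \<le> 0 + \<epsilon>" if "\<epsilon> > 0" for \<epsilon>
    using main[of "\<epsilon> / (b - a + 1)"] that \<open>a < b\<close> by simp
  then have "norm (f b - f a) \<le> 0" by (rule field_le_epsilon)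
  then show ?thesis by simp
qed simp

text \<open>The difference of \<open>f\<close> and the indefinite integral of \<open>g\<close> is
  absolutely continuous with derivative zero almost everywhere, hence constant.\<close>

theorem abs_cont_on_FTC:
  assumes ac: "abs_cont_on a b f" and "a \<le> b" and N: "negligible N"
    and der: "\<And>x. x \<in> {a<..<b} - N \<Longrightarrow> (f has_vector_derivative g x) (at x)"
    and g: "g absolutely_integrable_on {a..b}"
  shows "(g has_integral (f b - f a)) {a..b}"
proof -
  have gi: "g integrable_on {a..b}" using g by (simp only: absolutely_integrable_on_def)
  define G where "G x = integral {a..x} g" for x
  let ?M = "{x\<in>{a<..<b}. \<not> (G has_vector_derivative g x) (at x)}"
  have "negligible (N \<union> ?M)"
    using indefinite_integral_has_vector_derivative_AE[OF gi] N unfolding G_def by (intro negligible_Un)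
  moreover have "abs_cont_on a b (\<lambda>x. f x - G x)"
    unfolding G_def by (rule abs_cont_on_diff[OF ac abs_cont_on_indefinite_integral[OF g]])
  moreover have "((\<lambda>x. f x - G x) has_vector_derivative 0) (at x)" if "x \<in> {a<..<b} - (N \<union> ?M)" for x
    using has_vector_derivative_diff[OF der[of x], of G "g x"] that by simp
  ultimately have "f b - G b = f a - G a" using \<open>a \<le> b\<close> by (intro abs_cont_on_zero_derivative[of a b "\<lambda>x. f x - G x" "N \<union> ?M"])
  moreover have "G a = 0" by (simp add: G_def)
  ultimately have "integral {a..b} g = f b - f a" by (simp add: G_def algebra_simps)
  then show ?thesis using integrable_integral[OF gi] by simp
qed

lemma AE_lebesgue_iff_negligible: "(AE x in lebesgue. P x) \<longleftrightarrow> (\<exists>N. negligible N \<and> (\<forall>x. x \<notin> N \<longrightarrow> P x))"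
  for P :: "real \<Rightarrow> bool"
proof
  assume "AE x in lebesgue. P x"
  then obtain N where "N \<in> null_sets lebesgue" "{x. \<not> P x} \<subseteq> N" by (auto simp: eventually_ae_filter)
  then show "\<exists>N. negligible N \<and> (\<forall>x. x \<notin> N \<longrightarrow> P x)" by (auto simp: negligible_iff_null_sets)
next
  assume "\<exists>N. negligible N \<and> (\<forall>x. x \<notin> N \<longrightarrow> P x)"
  then obtain N where "N \<in> null_sets lebesgue" "\<forall>x. x \<notin> N \<longrightarrow> P x" by (auto simp: negligible_iff_null_sets)
  then show "AE x in lebesgue. P x" by (auto simp: eventually_ae_filter)
qed

lemma AE_lebesgue_neq: "AE x in lebesgue. x \<noteq> (a::real)"
  unfolding AE_lebesgue_iff_negligible by (intro exI[of _ "{a}"]) auto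

lemma at_within_Ici_interior: "a < x \<Longrightarrow> at x within {a..} = at (x::real)"
  by (rule at_within_interior) (simp add: interior_real_atLeast)

lemma at_within_Ici_nontrivial: "a \<le> x \<Longrightarrow> at x within {a..} \<noteq> bot" for x :: real
proof
  assume "a \<le> x" "at x within {a..} = bot"
  moreover have "at x within {x<..} \<le> at x within {a..}" using \<open>a \<le> x\<close> by (intro at_le) auto
  ultimately have "at x within {x<..} = bot" by (simp add: bot_unique)
  then show False by simp
qed

lemma hl_deriv_eqI: "a \<le> x \<Longrightarrow> (f has_vector_derivative D) (at x within {a..}) \<Longrightarrow> hl_deriv a f x = D"
  unfolding hl_deriv_def by (rule vector_derivative_within[OF at_within_Ici_nontrivial])

text \<open>The half-line is exhausted by bounded intervals. To the right of \<open>a\<close> the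
  two-sided derivative is the one that \<open>hl_deriv\<close> selects; \<open>a\<close> itself
  joins the null set.\<close>

lemma loc_abs_cont_deriv_AE:
  assumes "loc_abs_cont a f"
  shows "AE x\<in>{a..} in lebesgue. (f has_vector_derivative hl_deriv a f x) (at x)"
proof -
  let ?M = "\<lambda>n::nat. {x\<in>{a<..<a + real n}. \<nexists>D. (f has_vector_derivative D) (at x)}"
  have "negligible (\<Union>n. ?M n)"
  proof (rule negligible_countable_Union)
    show "negligible A" if "A \<in> range ?M" for A
    proof -
      obtain n where "A = ?M n" using \<open>A \<in> range ?M\<close> by blast
      moreover have "abs_cont_on a (a + real n) f" using assms by (simp add: loc_abs_cont_def)
      ultimately show ?thesis using abs_cont_on_differentiable_AE by simp
    qed
  qed simp
  then have "negligible ((\<Union>n. ?M n) \<union> {a})" by (intro negligible_Un) auto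
  moreover have "(f has_vector_derivative hl_deriv a f x) (at x)" if "x \<notin> (\<Union>n. ?M n) \<union> {a}" "x \<in> {a..}" for x
  proof -
    have "a < x" using that by auto
    obtain n where "x < a + real n" using reals_Archimedean2[of "x - a"] by (auto simp: algebra_simps)
    moreover have "x \<notin> ?M n" using that(1) by blast
    ultimately obtain D where D: "(f has_vector_derivative D) (at x)" using \<open>a < x\<close> by auto
    then have "hl_deriv a f x = D" using hl_deriv_eqI[of a x f D] \<open>a < x\<close> by (simp add: at_within_Ici_interior)
    then show ?thesis using D by simp
  qed
  ultimately show ?thesis unfolding AE_lebesgue_iff_negligible by blast
qed

lemma loc_abs_cont_FTC:
  assumes f: "loc_abs_cont a f" and "a \<le> c" "c \<le> d"
    and der: "AE x\<in>{a..} in lebesgue. (f has_vector_derivative g x) (at x)"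
    and g: "g absolutely_integrable_on {c..d}"
  shows "(g has_integral (f d - f c)) {c..d}"
proof -
  obtain N where "negligible N" "\<And>x. x \<notin> N \<Longrightarrow> x \<in> {a..} \<Longrightarrow> (f has_vector_derivative g x) (at x)"
    using der unfolding AE_lebesgue_iff_negligible by blast
  moreover have "abs_cont_on c d f" using f \<open>a \<le> c\<close> \<open>c \<le> d\<close> unfolding loc_abs_cont_def
    by (intro abs_cont_on_subset[of a d f c d]) auto
  ultimately show ?thesis using g \<open>c \<le> d\<close> \<open>a \<le> c\<close> by (intro abs_cont_on_FTC) auto
qed

section \<open>Differential expressions on the half-line\<close>

lemma at_within_Icc_Ici: "x < b \<Longrightarrow> at x within {a..b} = at x within {a..}" for x :: real
  by (rule at_within_nhd[of _ "{..<b}"]) auto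

lemma loc_abs_cont_imp_continuous_on:
  assumes "loc_abs_cont a f"
  shows "continuous_on {a..} f"
  unfolding continuous_on_eq_continuous_within
proof
  fix x assume "x \<in> {a..}"
  then have "continuous_on {a..x + 1} f"
    using assms by (intro abs_cont_on_imp_continuous_on) (auto simp: loc_abs_cont_def)
  then have "continuous (at x within {a..x+1}) f" using \<open>x \<in> {a..}\<close> by (auto simp: continuous_on_eq_continuous_within)
  then show "continuous (at x within {a..}) f" by (simp add: at_within_Icc_Ici)
qed

lemma loc_abs_cont_cong:
  assumes "\<And>x. a \<le> x \<Longrightarrow> f x = g x" "loc_abs_cont a f"
  shows "loc_abs_cont a g"
  using assms(2) unfolding loc_abs_cont_def
  by (auto intro: abs_cont_on_cong[of a _ f g] simp: assms(1))

lemma loc_abs_cont_indefinite_integral: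
  assumes "\<And>b. b \<ge> a \<Longrightarrow> g absolutely_integrable_on {a..b}"
  shows "loc_abs_cont a (\<lambda>x. c + integral {a..x} g)"
  unfolding loc_abs_cont_def
  by (intro allI impI abs_cont_on_add abs_cont_on_const abs_cont_on_indefinite_integral assms)

lemma indefinite_integral_deriv_AE:
  fixes g :: "real \<Rightarrow> 'a::euclidean_space"
  assumes "\<And>b. b \<ge> a \<Longrightarrow> g integrable_on {a..b}"
  shows "AE x\<in>{a..} in lebesgue. ((\<lambda>x. integral {a..x} g) has_vector_derivative g x) (at x)"
proof -
  let ?M = "\<lambda>n::nat. {x\<in>{a<..<a + real n}. \<not> ((\<lambda>x. integral {a..x} g) has_vector_derivative g x) (at x)}"
  have "negligible (\<Union>n. ?M n)"
  proof (rule negligible_countable_Union)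
    show "negligible A" if "A \<in> range ?M" for A
    proof -
      obtain n where "A = ?M n" using \<open>A \<in> range ?M\<close> by blast
      then show ?thesis using indefinite_integral_has_vector_derivative_AE[OF assms[of "a + real n"]] by simp
    qed
  qed simp
  then have "negligible ((\<Union>n. ?M n) \<union> {a})" by (intro negligible_Un) auto
  moreover have "((\<lambda>x. integral {a..x} g) has_vector_derivative g x) (at x)" if "x \<notin> (\<Union>n. ?M n) \<union> {a}" "x \<in> {a..}" for x
  proof -
    have "a < x" using that by auto
    obtain n where "x < a + real n" using reals_Archimedean2[of "x - a"] by (auto simp: algebra_simps)
    moreover have "x \<notin> ?M n" using that(1) by blast
    ultimately show ?thesis using \<open>a < x\<close> by auto
  qed
  ultimately show ?thesis unfolding AE_lebesgue_iff_negligible by blast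
qed

lemma integral_has_vector_derivative_Ici:
  fixes f :: "real \<Rightarrow> 'a::banach"
  assumes "continuous_on {a..} f" "a \<le> x"
  shows "((\<lambda>x. c + integral {a..x} f) has_vector_derivative f x) (at x within {a..})"
proof -
  have "((\<lambda>x. integral {a..x} f) has_vector_derivative f x) (at x within {a..x+1})"
    using assms by (intro integral_has_vector_derivative) (auto intro: continuous_on_subset)
  then have "((\<lambda>x. integral {a..x} f) has_vector_derivative f x) (at x within {a..})" by (simp add: at_within_Icc_Ici)
  then show ?thesis using has_vector_derivative_add[OF has_vector_derivative_const] by fastforce
qed

lemma has_vector_derivative_Ici_integral:
  fixes f :: "real \<Rightarrow> 'a::banach"
  assumes "\<And>x. a \<le> x \<Longrightarrow> (y has_vector_derivative f x) (at x within {a..})" "a \<le> x"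
  shows "(f has_integral (y x - y a)) {a..x}"
proof (rule fundamental_theorem_of_calculus[OF \<open>a \<le> x\<close>])
  fix t assume "t \<in> {a..x}"
  then show "(y has_vector_derivative f t) (at t within {a..x})"
    by (intro has_vector_derivative_within_subset[OF assms(1)]) auto
qed

lemma loc_abs_cont_C1:
  assumes y: "\<And>x. a \<le> x \<Longrightarrow> (y has_vector_derivative f x) (at x within {a..})" and f: "continuous_on {a..} f"
  shows "loc_abs_cont a y"
proof (rule loc_abs_cont_cong)
  show "loc_abs_cont a (\<lambda>x. y a + integral {a..x} f)"
    using f by (intro loc_abs_cont_indefinite_integral absolutely_integrable_continuous_real) (auto intro: continuous_on_subset)
  show "y a + integral {a..x} f = y x" if "a \<le> x" for x
    using integral_unique[OF has_vector_derivative_Ici_integral[OF y that]] by simp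
qed

lemma twice_acI:
  assumes y: "\<And>x. a \<le> x \<Longrightarrow> (y has_vector_derivative y1 x) (at x within {a..})" and y1: "loc_abs_cont a y1"
  shows "twice_ac a y" "\<And>x. a \<le> x \<Longrightarrow> hl_deriv a y x = y1 x"
proof -
  show h: "hl_deriv a y x = y1 x" if "a \<le> x" for x by (rule hl_deriv_eqI[OF that y[OF that]])
  have "y differentiable_on {a..}"
    using y unfolding differentiable_on_def by (meson atLeast_iff differentiableI_vector)
  moreover have "loc_abs_cont a y" by (rule loc_abs_cont_C1[OF y loc_abs_cont_imp_continuous_on[OF y1]])
  moreover have "loc_abs_cont a (hl_deriv a y)" by (rule loc_abs_cont_cong[OF _ y1]) (simp add: h)
  ultimately show "twice_ac a y" by (simp add: twice_ac_def)
qed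

lemma twice_acD:
  assumes "twice_ac a y"
  shows "a \<le> x \<Longrightarrow> (y has_vector_derivative hl_deriv a y x) (at x within {a..})"
    "loc_abs_cont a y" "loc_abs_cont a (hl_deriv a y)"
    "continuous_on {a..} y" "continuous_on {a..} (hl_deriv a y)"
    "AE x\<in>{a..} in lebesgue. (hl_deriv a y has_vector_derivative hl_deriv a (hl_deriv a y) x) (at x)"
proof -
  show "a \<le> x \<Longrightarrow> (y has_vector_derivative hl_deriv a y x) (at x within {a..})"
    using assms unfolding twice_ac_def differentiable_on_def hl_deriv_def by (simp add: vector_derivative_works)
  show y: "loc_abs_cont a y" and y1: "loc_abs_cont a (hl_deriv a y)" using assms by (auto simp: twice_ac_def)
  show "continuous_on {a..} y" "continuous_on {a..} (hl_deriv a y)" using y y1 loc_abs_cont_imp_continuous_on by auto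
  show "AE x\<in>{a..} in lebesgue. (hl_deriv a y has_vector_derivative hl_deriv a (hl_deriv a y) x) (at x)"
    by (rule loc_abs_cont_deriv_AE[OF y1])
qed

text \<open>Evaluates \<open>lop\<close> from explicit candidates for both derivatives. Agreement of
  \<open>hl_deriv a y\<close> with \<open>y1\<close> on the open half-line carries over the
  derivative of \<open>y1\<close>.\<close>

lemma lop_AE:
  assumes y: "\<And>x. a \<le> x \<Longrightarrow> hl_deriv a y x = y1 x"
    and y1: "AE x\<in>{a..} in lebesgue. (y1 has_vector_derivative y2 x) (at x)"
  shows "AE x\<in>{a..} in lebesgue. lop a q y x = - y2 x + complex_of_real (q x) * y x"
  using y1 AE_lebesgue_neq[of a]
proof eventually_elim
  case (elim x)
  show ?case
  proof
    assume "x \<in> {a..}"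
    then have "a < x" using elim by auto
    have "(y1 has_vector_derivative y2 x) (at x)" using elim \<open>x \<in> {a..}\<close> by blast
    then have "(hl_deriv a y has_vector_derivative y2 x) (at x)"
      by (rule has_vector_derivative_transform_within_open[where S="{a<..}"]) (use y \<open>a < x\<close> in auto)
    then have "hl_deriv a (hl_deriv a y) x = y2 x" using \<open>a < x\<close>
      by (intro hl_deriv_eqI) (auto intro: has_vector_derivative_at_within)
    then show "lop a q y x = - y2 x + complex_of_real (q x) * y x" by (simp add: lop_def)
  qed
qed

lemma hl_deriv2_eq_lop: "hl_deriv a (hl_deriv a y) x = complex_of_real (q x) * y x - lop a q y x"
  by (simp add: lop_def)

lemma twice_ac_lincomb:
  assumes f: "twice_ac a f" and g: "twice_ac a g"
  shows "twice_ac a (\<lambda>x. c * f x + d * g x)"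
    "a \<le> x \<Longrightarrow> hl_deriv a (\<lambda>x. c * f x + d * g x) x = c * hl_deriv a f x + d * hl_deriv a g x"
    "AE x\<in>{a..} in lebesgue. lop a q (\<lambda>x. c * f x + d * g x) x = c * lop a q f x + d * lop a q g x"
proof -
  let ?y1 = "\<lambda>x. c * hl_deriv a f x + d * hl_deriv a g x"
  have y1: "((\<lambda>x. c * f x + d * g x) has_vector_derivative ?y1 x) (at x within {a..})" if "a \<le> x" for x
    using twice_acD(1)[OF f that] twice_acD(1)[OF g that]
    by (intro has_vector_derivative_add has_vector_derivative_mult_right)
  have ac: "loc_abs_cont a ?y1"
    using twice_acD(3)[OF f] twice_acD(3)[OF g] unfolding loc_abs_cont_def
    by (auto intro!: abs_cont_on_add abs_cont_on_cmult)
  show "twice_ac a (\<lambda>x. c * f x + d * g x)"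
    "a \<le> x \<Longrightarrow> hl_deriv a (\<lambda>x. c * f x + d * g x) x = ?y1 x"
    using twice_acI[OF y1 ac] by auto
  have "AE x\<in>{a..} in lebesgue. (?y1 has_vector_derivative
      c * hl_deriv a (hl_deriv a f) x + d * hl_deriv a (hl_deriv a g) x) (at x)"
    using twice_acD(6)[OF f] twice_acD(6)[OF g]
    by eventually_elim (auto intro!: has_vector_derivative_add has_vector_derivative_mult_right)
  from lop_AE[OF twice_acI(2)[OF y1 ac] this, where q=q]
  show "AE x\<in>{a..} in lebesgue. lop a q (\<lambda>x. c * f x + d * g x) x = c * lop a q f x + d * lop a q g x"
    by (simp add: lop_def algebra_simps)
qed

text \<open>The Leibniz rule, meant for cut-off factors. Continuity of \<open>c2\<close> makes
  \<open>c1\<close> locally absolutely continuous, so that the derivative of the product is so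
  too.\<close>

lemma twice_ac_mult_C2:
  fixes c c1 c2 :: "real \<Rightarrow> real"
  assumes z: "twice_ac a z"
    and c: "\<And>x. (c has_real_derivative c1 x) (at x)" "\<And>x. (c1 has_real_derivative c2 x) (at x)"
    and c2: "continuous_on UNIV c2"
  shows "twice_ac a (\<lambda>x. of_real (c x) * z x)"
    "\<And>x. a \<le> x \<Longrightarrow> hl_deriv a (\<lambda>x. of_real (c x) * z x) x = of_real (c x) * hl_deriv a z x + of_real (c1 x) * z x"
    "AE x\<in>{a..} in lebesgue. lop a q (\<lambda>x. of_real (c x) * z x) x =
       of_real (c x) * lop a q z x - 2 * of_real (c1 x) * hl_deriv a z x - of_real (c2 x) * z x"
proof -
  let ?y1 = "\<lambda>x. of_real (c x) * hl_deriv a z x + of_real (c1 x) * z x"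
  have oc: "((\<lambda>x. complex_of_real (c x)) has_vector_derivative of_real (c1 x)) (at x within S)"
    "((\<lambda>x. complex_of_real (c1 x)) has_vector_derivative of_real (c2 x)) (at x within S)" for x S
    using c[of x] by (auto intro!: has_vector_derivative_of_real has_field_derivative_at_within)
  have y1: "((\<lambda>x. of_real (c x) * z x) has_vector_derivative ?y1 x) (at x within {a..})" if "a \<le> x" for x
    using has_vector_derivative_mult[OF oc(1) twice_acD(1)[OF z that]] .
  have cc1: "continuous_on S c1" for S using c(2) by (meson DERIV_isCont continuous_at_imp_continuous_on)
  have lc: "loc_abs_cont a (\<lambda>x. complex_of_real (c x))"
    by (rule loc_abs_cont_C1[OF oc(1)]) (intro continuous_intros cc1)
  have lc1: "loc_abs_cont a (\<lambda>x. complex_of_real (c1 x))"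
    by (rule loc_abs_cont_C1[OF oc(2)]) (intro continuous_intros continuous_on_subset[OF c2] subset_UNIV)
  have ac: "loc_abs_cont a ?y1"
    using twice_acD(2,3)[OF z] lc lc1 unfolding loc_abs_cont_def
    by (auto intro!: abs_cont_on_add abs_cont_on_mult)
  show "twice_ac a (\<lambda>x. of_real (c x) * z x)"
    "\<And>x. a \<le> x \<Longrightarrow> hl_deriv a (\<lambda>x. of_real (c x) * z x) x = ?y1 x"
    using twice_acI[OF y1 ac] by auto
  have "AE x\<in>{a..} in lebesgue. (?y1 has_vector_derivative
      (of_real (c x) * hl_deriv a (hl_deriv a z) x + of_real (c1 x) * hl_deriv a z x) +
      (of_real (c1 x) * hl_deriv a z x + of_real (c2 x) * z x)) (at x)"
    using twice_acD(6)[OF z] AE_lebesgue_neq[of a]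
  proof eventually_elim
    case (elim x)
    show ?case
    proof
      assume "x \<in> {a..}"
      then have z1: "(z has_vector_derivative hl_deriv a z x) (at x)"
        using twice_acD(1)[OF z, of x] elim by (simp add: at_within_Ici_interior)
      have z2: "(hl_deriv a z has_vector_derivative hl_deriv a (hl_deriv a z) x) (at x)" using elim \<open>x \<in> {a..}\<close> by blast
      show "(?y1 has_vector_derivative
      (of_real (c x) * hl_deriv a (hl_deriv a z) x + of_real (c1 x) * hl_deriv a z x) +
      (of_real (c1 x) * hl_deriv a z x + of_real (c2 x) * z x)) (at x)"
        by (intro has_vector_derivative_add has_vector_derivative_mult oc z1 z2)
    qed
  qed
  from lop_AE[OF twice_acI(2)[OF y1 ac] this, where q=q]
  show "AE x\<in>{a..} in lebesgue. lop a q (\<lambda>x. of_real (c x) * z x) x =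
       of_real (c x) * lop a q z x - 2 * of_real (c1 x) * hl_deriv a z x - of_real (c2 x) * z x"
    by (simp add: lop_def algebra_simps)
qed

lemma absolutely_integrable_continuous_mult:
  fixes f g :: "real \<Rightarrow> complex"
  assumes "continuous_on {c..d} f" "g absolutely_integrable_on {c..d}"
  shows "(\<lambda>x. f x * g x) absolutely_integrable_on {c..d}"
proof (rule absolutely_integrable_bounded_measurable_product[OF bilinear_conv_bounded_bilinear[THEN iffD2, OF bounded_bilinear_mult]])
  show "f \<in> borel_measurable (lebesgue_on {c..d})" by (rule continuous_imp_measurable_on_sets_lebesgue[OF assms(1)]) simp
  show "bounded (f ` {c..d})" using assms(1) by (intro compact_imp_bounded compact_continuous_image) auto
qed (use assms in auto)

section \<open>Solvability of the initial value problem\<close>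

context
  fixes a :: real and r :: "real \<Rightarrow> real"
  assumes r: "\<And>b. b \<ge> a \<Longrightarrow> r absolutely_integrable_on {a..b}"
begin

text \<open>In the supremum norm weighted by the inverse of \<open>weight\<close>, the integral operator of the first-order
  system \<open>y' = y1\<close>, \<open>y1' = r y\<close> is a contraction with factor 1/2, on the whole half-line at once.\<close>

definition weight :: "real \<Rightarrow> real" where
  "weight x = exp (2 * integral {a..x} (\<lambda>s. 1 + \<bar>r s\<bar>))"

lemma one_plus_abs_integrable: "a \<le> b \<Longrightarrow> (\<lambda>s. complex_of_real (1 + \<bar>r s\<bar>)) absolutely_integrable_on {a..b}"
  "a \<le> b \<Longrightarrow> (\<lambda>s. 1 + \<bar>r s\<bar>) absolutely_integrable_on {a..b}"
proof -
  show 1: "(\<lambda>s. 1 + \<bar>r s\<bar>) absolutely_integrable_on {a..b}" if "a \<le> b" for b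
    using absolutely_integrable_norm[OF r[OF that]] by (intro set_integral_add) (auto simp: o_def)
  show "(\<lambda>s. complex_of_real (1 + \<bar>r s\<bar>)) absolutely_integrable_on {a..b}" if "a \<le> b" for b
    using absolutely_integrable_linear[OF 1[OF that] bounded_linear_of_real] by (simp add: o_def)
qed

lemma one_plus_abs_integral_of_real: "a \<le> x \<Longrightarrow> integral {a..x} (\<lambda>s. complex_of_real (1 + \<bar>r s\<bar>)) = of_real (integral {a..x} (\<lambda>s. 1 + \<bar>r s\<bar>))"
  using integral_linear[OF _ bounded_linear_of_real, of "\<lambda>s. 1 + \<bar>r s\<bar>" "{a..x}"] one_plus_abs_integrable(2)[of x]
  by (simp add: o_def absolutely_integrable_on_def)

lemma weight_ge1: "a \<le> x \<Longrightarrow> weight x \<ge> 1"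
  unfolding weight_def using one_plus_abs_integrable(2)[of x] by (simp add: absolutely_integrable_on_def integral_nonneg)

text \<open>The exponential is Lipschitz below \<open>2 * ?R b\<close>, a bound for its argument on
  \<open>{a..b}\<close>, and the argument is an absolutely continuous indefinite integral.\<close>

lemma loc_abs_cont_weight: "loc_abs_cont a (\<lambda>x. complex_of_real (weight x))"
  unfolding loc_abs_cont_def
proof (intro allI impI)
  fix b assume "a \<le> b"
  let ?R = "\<lambda>x. integral {a..x} (\<lambda>s. 1 + \<bar>r s\<bar>)"
  let ?f = "\<lambda>x. 0 + integral {a..x} (\<lambda>s. complex_of_real (1 + \<bar>r s\<bar>))"
  have f: "abs_cont_on a b ?f"
    using loc_abs_cont_indefinite_integral[of a "\<lambda>s. complex_of_real (1 + \<bar>r s\<bar>)" 0] one_plus_abs_integrable(1) \<open>a \<le> b\<close>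
    unfolding loc_abs_cont_def by blast
  have mono: "?R x \<le> ?R b" if "x \<in> {a..b}" for x
    using one_plus_abs_integrable(2)[of x] one_plus_abs_integrable(2)[of b] that
    by (intro integral_subset_le) (auto simp: absolutely_integrable_on_def)
  show "abs_cont_on a b (\<lambda>x. complex_of_real (weight x))"
  proof (rule abs_cont_on_dominated[OF f f, of "2 * exp (2 * ?R b)"])
    fix x y assume xy: "x \<in> {a..b}" "y \<in> {a..b}"
    have "\<bar>exp (2 * ?R x) - exp (2 * ?R y)\<bar> \<le> exp (2 * ?R b) * \<bar>2 * ?R x - 2 * ?R y\<bar>"
    proof -
      have *: "exp v - exp u \<le> exp M * (v - u)" if "u \<le> v" "v \<le> M" for u v M :: real
      proof -
        have "1 - (v - u) \<le> exp (- (v - u))" using exp_ge_add_one_self[of "- (v - u)"] by linarith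
        then have "exp v * (1 - (v - u)) \<le> exp v * exp (- (v - u))" by (intro mult_left_mono) auto
        then have "exp v - exp u \<le> exp v * (v - u)" by (simp add: algebra_simps flip: exp_add)
        also have "\<dots> \<le> exp M * (v - u)" using that by (intro mult_right_mono) auto
        finally show ?thesis .
      qed
      show ?thesis
      proof (cases "?R x \<le> ?R y")
        case True then show ?thesis using *[of "2 * ?R x" "2 * ?R y" "2 * ?R b"] mono[OF xy(2)] by simp
      next
        case False then show ?thesis using *[of "2 * ?R y" "2 * ?R x" "2 * ?R b"] mono[OF xy(1)] by simp
      qed
    qed
    also have "\<dots> = 2 * exp (2 * ?R b) * dist (?f x) (?f y)"
    proof -
      have "dist (?f x) (?f y) = \<bar>?R x - ?R y\<bar>"
        using xy one_plus_abs_integral_of_real[of x] one_plus_abs_integral_of_real[of y] by (simp add: dist_of_real dist_real_def)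
      moreover have "\<bar>2 * ?R x - 2 * ?R y\<bar> = 2 * \<bar>?R x - ?R y\<bar>" by (auto simp: abs_if)
      ultimately show ?thesis by (simp only: ac_simps)
    qed
    also have "\<dots> \<le> 2 * exp (2 * ?R b) * (dist (?f x) (?f y) + dist (?f x) (?f y))"
      by (intro mult_left_mono) auto
    finally show "dist (complex_of_real (weight x)) (complex_of_real (weight y)) \<le> 2 * exp (2 * ?R b) * (dist (?f x) (?f y) + dist (?f x) (?f y))"
      by (simp add: dist_of_real dist_real_def weight_def)
  qed simp
qed

lemma continuous_on_weight: "continuous_on {a..} weight"
proof -
  have "continuous_on {a..} (\<lambda>x. Re (complex_of_real (weight x)))"
    by (intro continuous_intros loc_abs_cont_imp_continuous_on loc_abs_cont_weight)
  then show ?thesis by simp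
qed

text \<open>\<open>weight\<close> has value 1 at \<open>a\<close> and derivative
  \<open>2 * weight * (1 + \<bar>r\<bar>)\<close> almost everywhere. The 2 here is the source of the
  contraction factor 1/2.\<close>

lemma weight_has_integral:
  assumes "a \<le> b"
  shows "((\<lambda>s. weight s * (1 + \<bar>r s\<bar>)) has_integral ((weight b - 1) / 2)) {a..b}"
proof -
  let ?g = "\<lambda>s. complex_of_real (2 * weight s) * complex_of_real (1 + \<bar>r s\<bar>)"
  have "AE x\<in>{a..} in lebesgue. ((\<lambda>x. complex_of_real (weight x)) has_vector_derivative ?g x) (at x)"
    using indefinite_integral_deriv_AE[of a "\<lambda>s. 1 + \<bar>r s\<bar>"] one_plus_abs_integrable(2)
  proof (simp add: absolutely_integrable_on_def, elim eventually_mono, intro impI)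
    fix x assume "a \<le> x \<longrightarrow> ((\<lambda>x. integral {a..x} (\<lambda>s. 1 + \<bar>r s\<bar>)) has_vector_derivative 1 + \<bar>r x\<bar>) (at x)" "a \<le> x"
    then have "((\<lambda>x. integral {a..x} (\<lambda>s. 1 + \<bar>r s\<bar>)) has_real_derivative 1 + \<bar>r x\<bar>) (at x)"
      by (simp add: has_real_derivative_iff_has_vector_derivative)
    then have "(weight has_real_derivative weight x * (2 * (1 + \<bar>r x\<bar>))) (at x)"
      unfolding weight_def by (auto intro!: derivative_eq_intros)
    then have "((\<lambda>x. complex_of_real (weight x)) has_vector_derivative of_real (weight x * (2 * (1 + \<bar>r x\<bar>)))) (at x)"
      by (intro has_vector_derivative_of_real) (simp add: has_real_derivative_iff_has_vector_derivative)
    then show "((\<lambda>x. complex_of_real (weight x)) has_vector_derivative 2 * complex_of_real (weight x) * (1 + complex_of_real \<bar>r x\<bar>)) (at x)"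
      by (simp add: algebra_simps)
  qed
  moreover have "?g absolutely_integrable_on {a..b}"
    using assms by (intro absolutely_integrable_continuous_mult one_plus_abs_integrable continuous_intros continuous_on_subset[OF continuous_on_weight]) auto
  ultimately have "(?g has_integral complex_of_real (weight b) - complex_of_real (weight a)) {a..b}"
    using assms by (intro loc_abs_cont_FTC[OF loc_abs_cont_weight]) auto
  from has_integral_linear[OF this bounded_linear_Re]
  have "((\<lambda>s. 2 * weight s * (1 + \<bar>r s\<bar>)) has_integral weight b - weight a) {a..b}" by (simp add: o_def)
  from has_integral_mult_right[OF this, of "1/2"]
  have "((\<lambda>s. 1/2 * (2 * weight s * (1 + \<bar>r s\<bar>))) has_integral 1/2 * (weight b - weight a)) {a..b}" .
  moreover have "(\<lambda>s. 1/2 * (2 * weight s * (1 + \<bar>r s\<bar>))) = (\<lambda>s. weight s * (1 + \<bar>r s\<bar>))" by auto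
  moreover have "1/2 * (weight b - weight a) = (weight b - 1) / 2" by (simp add: weight_def)
  ultimately show ?thesis by (simp only:)
qed

text \<open>\<open>z1\<close> and \<open>z2\<close> stand for the unknowns \<open>y\<close> and
  \<open>y1\<close> divided by \<open>weight\<close>. Together the two integrands are at most
  \<open>B * weight * (1 + \<bar>r\<bar>)\<close>, whose integral is known exactly.\<close>

lemma weight_bound:
  fixes z1 z2 :: "real \<Rightarrow> complex"
  assumes "continuous_on {a..} z1" "continuous_on {a..} z2"
    and B: "\<And>s. a \<le> s \<Longrightarrow> norm (z1 s) \<le> B" "\<And>s. a \<le> s \<Longrightarrow> norm (z2 s) \<le> B" and "a \<le> x"
  shows "(\<lambda>s. of_real (weight s) * z2 s) absolutely_integrable_on {a..x}"
    "(\<lambda>s. of_real (weight s) * z1 s * of_real (r s)) absolutely_integrable_on {a..x}"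
    "norm (integral {a..x} (\<lambda>s. of_real (weight s) * z2 s), integral {a..x} (\<lambda>s. of_real (weight s) * z1 s * of_real (r s)))
      \<le> B / 2 * weight x"
proof -
  have gx: "continuous_on {a..x} weight" by (rule continuous_on_subset[OF continuous_on_weight]) auto
  have z: "continuous_on {a..x} z1" "continuous_on {a..x} z2" using assms(1,2) by (auto intro: continuous_on_subset)
  show 1: "(\<lambda>s. of_real (weight s) * z2 s) absolutely_integrable_on {a..x}"
    by (intro absolutely_integrable_continuous_real continuous_intros gx z)
  have "(\<lambda>s. complex_of_real (r s)) absolutely_integrable_on {a..x}"
    using absolutely_integrable_linear[OF r[OF \<open>a \<le> x\<close>] bounded_linear_of_real] by (simp add: o_def)
  then show 2: "(\<lambda>s. of_real (weight s) * z1 s * of_real (r s)) absolutely_integrable_on {a..x}"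
    by (intro absolutely_integrable_continuous_mult continuous_intros gx z)
  have n1: "(\<lambda>s. norm (of_real (weight s) * z2 s)) integrable_on {a..x}"
    and n2: "(\<lambda>s. norm (of_real (weight s) * z1 s * of_real (r s))) integrable_on {a..x}"
    using 1 2 by (auto simp only: absolutely_integrable_on_def)
  have "norm (integral {a..x} (\<lambda>s. of_real (weight s) * z2 s), integral {a..x} (\<lambda>s. of_real (weight s) * z1 s * of_real (r s)))
     \<le> norm (integral {a..x} (\<lambda>s. of_real (weight s) * z2 s)) + norm (integral {a..x} (\<lambda>s. of_real (weight s) * z1 s * of_real (r s)))"
    by (rule norm_Pair_le)
  also have "\<dots> \<le> integral {a..x} (\<lambda>s. norm (of_real (weight s) * z2 s)) + integral {a..x} (\<lambda>s. norm (of_real (weight s) * z1 s * of_real (r s)))"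
    using 1 2 n1 n2 by (intro add_mono integral_norm_bound_integral) (auto simp only: absolutely_integrable_on_def)
  also have "\<dots> = integral {a..x} (\<lambda>s. norm (of_real (weight s) * z2 s) + norm (of_real (weight s) * z1 s * of_real (r s)))"
    by (rule integral_add[OF n1 n2, symmetric])
  also have "\<dots> \<le> B * ((weight x - 1) / 2)"
  proof (rule has_integral_le[OF integrable_integral has_integral_mult_right[OF weight_has_integral[OF \<open>a \<le> x\<close>]]])
    show "(\<lambda>s. norm (of_real (weight s) * z2 s) + norm (of_real (weight s) * z1 s * of_real (r s))) integrable_on {a..x}"
      by (rule integrable_add[OF n1 n2])
    fix s assume "s \<in> {a..x}"
    then have s: "a \<le> s" by simp
    have g0: "0 \<le> weight s" using weight_ge1[OF s] by simp
    have "norm (of_real (weight s) * z2 s) + norm (of_real (weight s) * z1 s * of_real (r s))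
        = weight s * norm (z2 s) + weight s * norm (z1 s) * \<bar>r s\<bar>" using g0 by (simp add: norm_mult)
    also have "\<dots> \<le> weight s * B + weight s * B * \<bar>r s\<bar>"
      using B[OF s] g0 by (intro add_mono mult_left_mono mult_right_mono) auto
    finally show "norm (of_real (weight s) * z2 s) + norm (of_real (weight s) * z1 s * of_real (r s)) \<le> B * (weight s * (1 + \<bar>r s\<bar>))"
      by (simp add: algebra_simps)
  qed
  also have "\<dots> \<le> B / 2 * weight x" using order_trans[OF norm_ge_zero B(1)[OF order_refl]] by (simp add: field_simps)
  finally show "norm (integral {a..x} (\<lambda>s. of_real (weight s) * z2 s), integral {a..x} (\<lambda>s. of_real (weight s) * z1 s * of_real (r s)))
      \<le> B / 2 * weight x" .
qed

text \<open>The Banach fixed point theorem for \<open>T\<close> on the complete space of bounded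
  continuous functions; the unknown is the pair \<open>(y, y1)\<close> divided by
  \<open>weight\<close>. Functions in this space live on the whole line, so \<open>max a x\<close>
  continues the image of \<open>T\<close> by its value at \<open>a\<close> to the left of
  \<open>a\<close>.\<close>

lemma linear_system_solvable:
  obtains y y1 :: "real \<Rightarrow> complex" where "continuous_on {a..} y" "continuous_on {a..} y1"
    "\<And>x. a \<le> x \<Longrightarrow> y x = c0 + integral {a..x} y1"
    "\<And>x. a \<le> x \<Longrightarrow> y1 x = c1 + integral {a..x} (\<lambda>s. y s * of_real (r s))"
proof -
  define I where "I Z x = (integral {a..x} (\<lambda>s. of_real (weight s) * snd (Z s)),
     integral {a..x} (\<lambda>s. of_real (weight s) * fst (Z s) * of_real (r s)))" for Z :: "real \<Rightarrow> complex \<times> complex" and x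
  define T where "T Z x = inverse (weight (max a x)) *\<^sub>R ((c0, c1) + I Z (max a x))" for Z x
  have cZ: "continuous_on {a..} (\<lambda>x. fst (apply_bcontfun Z x))" "continuous_on {a..} (\<lambda>x. snd (apply_bcontfun Z x))"
    for Z :: "real \<Rightarrow>\<^sub>C (complex \<times> complex)"
    by (intro continuous_intros continuous_on_apply_bcontfun)+
  have nf: "norm (fst p) \<le> norm p" "norm (snd p) \<le> norm p" for p :: "complex \<times> complex"
    by (metis norm_fst_le prod.collapse) (metis norm_snd_le prod.collapse)
  have bI: "norm (I Z x) \<le> B / 2 * weight x" if "continuous_on {a..} Z" "\<And>s. norm (Z s) \<le> B" "a \<le> x" for Z :: "real \<Rightarrow> complex \<times> complex" and B x
    unfolding I_def
    using that by (intro weight_bound(3) continuous_intros) (auto intro: order_trans[OF nf(1)] order_trans[OF nf(2)])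
  have IZ: "(\<lambda>s. of_real (weight s) * snd (Z s)) absolutely_integrable_on {a..x}"
    "(\<lambda>s. of_real (weight s) * fst (Z s) * of_real (r s)) absolutely_integrable_on {a..x}"
    if "continuous_on {a..} Z" "\<And>s. norm (Z s) \<le> B" "a \<le> x" for Z :: "real \<Rightarrow> complex \<times> complex" and B x
    using that weight_bound(1,2)[of "\<lambda>s. fst (Z s)" "\<lambda>s. snd (Z s)" B x] by (auto intro!: continuous_intros intro: order_trans[OF nf(1)] order_trans[OF nf(2)])
  have Idiff: "I Z x - I Z' x = I (\<lambda>s. Z s - Z' s) x"
    if "continuous_on {a..} Z" "\<And>s. norm (Z s) \<le> B" "continuous_on {a..} Z'" "\<And>s. norm (Z' s) \<le> B'" "a \<le> x" for Z Z' B B' x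
    using IZ[OF that(1,2,5)] IZ[OF that(3,4,5)] unfolding I_def
    by (simp add: absolutely_integrable_on_def integral_diff[symmetric] algebra_simps)
  have Tb: "T Z \<in> bcontfun" if Z: "continuous_on {a..} Z" "\<And>s. norm (Z s) \<le> B" for Z B
  proof (rule bcontfun_normI)
    have "loc_abs_cont a (\<lambda>x. 0 + integral {a..x} (\<lambda>s. of_real (weight s) * snd (Z s)))"
      "loc_abs_cont a (\<lambda>x. 0 + integral {a..x} (\<lambda>s. of_real (weight s) * fst (Z s) * of_real (r s)))"
      using IZ[OF Z] by (intro loc_abs_cont_indefinite_integral; simp)+
    then have cI: "continuous_on {a..} (I Z)"
      unfolding I_def by (intro continuous_on_Pair) (auto dest!: loc_abs_cont_imp_continuous_on)
    have "continuous_on UNIV (\<lambda>x. I Z (max a x))"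
      by (rule continuous_on_compose2[OF cI]) (auto intro!: continuous_intros)
    moreover have "continuous_on UNIV (\<lambda>x. weight (max a x))"
      by (rule continuous_on_compose2[OF continuous_on_weight]) (auto intro!: continuous_intros)
    moreover have "weight (max a x) \<noteq> 0" for x using weight_ge1[of "max a x"] by simp
    ultimately show "continuous_on UNIV (T Z)" unfolding T_def by (intro continuous_intros) auto
    fix x
    have g: "weight (max a x) \<ge> 1" by (rule weight_ge1) simp
    have "norm (T Z x) = norm ((c0, c1) + I Z (max a x)) / weight (max a x)"
      using g by (simp add: T_def divide_inverse mult.commute)
    also have "\<dots> \<le> (norm (c0, c1) + B / 2 * weight (max a x)) / weight (max a x)"
      using g bI[OF Z, of "max a x"] by (intro divide_right_mono order_trans[OF norm_triangle_ineq] add_left_mono) auto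
    also have "\<dots> = norm (c0, c1) / weight (max a x) + B / 2" using g by (simp add: add_divide_distrib)
    also have "\<dots> \<le> norm (c0, c1) + B / 2" using g by (simp add: divide_le_eq mult_left_le le_divide_eq mult_le_cancel_left1)
    finally show "norm (T Z x) \<le> norm (c0, c1) + B / 2" .
  qed
  have bZ: "continuous_on {a..} (apply_bcontfun Z)" "norm (apply_bcontfun Z s) \<le> norm Z" for Z :: "real \<Rightarrow>\<^sub>C (complex \<times> complex)" and s
    by (auto intro: norm_bounded)
  define F where "F Z = Bcontfun (T (apply_bcontfun Z))" for Z :: "real \<Rightarrow>\<^sub>C (complex \<times> complex)"
  have F: "apply_bcontfun (F Z) = T (apply_bcontfun Z)" for Z
    unfolding F_def by (rule Bcontfun_inverse[OF Tb[OF bZ]])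
  have "\<exists>!Z. F Z = Z"
  proof (rule banach_fix_type[of "1/2"])
    show "\<forall>Z Z'. dist (F Z) (F Z') \<le> 1/2 * dist Z Z'"
    proof (intro allI dist_bound)
      fix Z Z' :: "real \<Rightarrow>\<^sub>C (complex \<times> complex)" and x
      let ?x = "max a x"
      have g: "weight ?x \<ge> 1" by (rule weight_ge1) simp
      have "dist (T Z x) (T Z' x) = norm (inverse (weight ?x) *\<^sub>R (I Z ?x - I Z' ?x))"
        unfolding T_def dist_norm by (simp add: scaleR_diff_right[symmetric])
      also have "I Z ?x - I Z' ?x = I (\<lambda>s. Z s - Z' s) ?x" by (rule Idiff[OF bZ bZ]) simp
      also have "norm (inverse (weight ?x) *\<^sub>R I (\<lambda>s. Z s - Z' s) ?x) \<le> inverse (weight ?x) * (dist Z Z' / 2 * weight ?x)"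
        unfolding norm_scaleR using g
        by (intro mult_mono bI continuous_intros bZ(1)) (auto simp: dist_bounded[of Z _ Z'] simp flip: dist_norm)
      also have "\<dots> = 1/2 * dist Z Z'" using g by simp
      finally show "dist (apply_bcontfun (F Z) x) (apply_bcontfun (F Z') x) \<le> 1/2 * dist Z Z'" unfolding F .
    qed
  qed auto
  then obtain Z where Z: "F Z = Z" by blast
  define y where "y x = of_real (weight x) * fst (apply_bcontfun Z x)" for x
  define y1 where "y1 x = of_real (weight x) * snd (apply_bcontfun Z x)" for x
  have fixp: "weight x *\<^sub>R apply_bcontfun Z x = (c0, c1) + I Z x" if "a \<le> x" for x
  proof -
    have "apply_bcontfun Z x = inverse (weight x) *\<^sub>R ((c0, c1) + I Z x)"
    proof -
      have "apply_bcontfun Z x = T (apply_bcontfun Z) x" using F[of Z] by (simp only: Z)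
      moreover have "max a x = x" using that by simp
      ultimately show ?thesis by (simp only: T_def)
    qed
    moreover have "weight x \<noteq> 0" using weight_ge1[OF that] by simp
    ultimately show ?thesis by simp
  qed
  show thesis
  proof (rule that[of y y1])
    show "continuous_on {a..} y" "continuous_on {a..} y1"
      unfolding y_def y1_def by (intro continuous_intros continuous_on_weight cZ)+
    show "y x = c0 + integral {a..x} y1" if "a \<le> x" for x
      using arg_cong[OF fixp[OF that], of fst] by (simp add: y_def y1_def[abs_def] I_def scaleR_conv_of_real)
    show "y1 x = c1 + integral {a..x} (\<lambda>s. y s * of_real (r s))" if "a \<le> x" for x
      using arg_cong[OF fixp[OF that], of snd] by (simp add: y1_def y_def I_def scaleR_conv_of_real)
  qed
qed

end

text \<open>The first-order system with \<open>r = q - l\<close>. The second component is an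
  indefinite integral, hence locally absolutely continuous, and satisfies the differential equation
  almost everywhere.\<close>

theorem is_solution_exists:
  assumes q: "locally_summable a q"
  obtains y where "is_solution a q (of_real l) y" "y a = c0" "hl_deriv a y a = c1"
proof -
  have r: "(\<lambda>s. q s - l) absolutely_integrable_on {a..b}" if "a \<le> b" for b
    using q that by (intro set_integral_diff) (auto simp: locally_summable_def)
  obtain y y1 :: "real \<Rightarrow> complex" where c: "continuous_on {a..} y" "continuous_on {a..} y1"
    and y: "\<And>x. a \<le> x \<Longrightarrow> y x = c0 + integral {a..x} y1"
    and y1: "\<And>x. a \<le> x \<Longrightarrow> y1 x = c1 + integral {a..x} (\<lambda>s. y s * of_real (q s - l))"
    using linear_system_solvable[OF r, of c0 c1] by blast
  have ai: "(\<lambda>s. y s * of_real (q s - l)) absolutely_integrable_on {a..b}" if "a \<le> b" for b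
  proof (rule absolutely_integrable_continuous_mult)
    show "(\<lambda>s. complex_of_real (q s - l)) absolutely_integrable_on {a..b}"
      using absolutely_integrable_linear[OF r[OF that] bounded_linear_of_real] by (simp add: o_def)
  qed (use c(1) in \<open>auto intro: continuous_on_subset\<close>)
  have d: "(y has_vector_derivative y1 x) (at x within {a..})" if "a \<le> x" for x
    using integral_has_vector_derivative_Ici[OF c(2) that, of c0]
    by (rule has_vector_derivative_transform[rotated 2]) (use y that in auto)
  have ac: "loc_abs_cont a y1"
    by (rule loc_abs_cont_cong[OF y1[symmetric] loc_abs_cont_indefinite_integral[OF ai]])
  have "AE x\<in>{a..} in lebesgue. (y1 has_vector_derivative y x * of_real (q x - l)) (at x)"
  proof -
    have "AE x\<in>{a..} in lebesgue. ((\<lambda>x. integral {a..x} (\<lambda>s. y s * of_real (q s - l))) has_vector_derivative y x * of_real (q x - l)) (at x)"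
      by (rule indefinite_integral_deriv_AE) (rule set_lebesgue_integral_eq_integral(1)[OF ai])
    then show ?thesis using AE_lebesgue_neq[of a]
  proof eventually_elim
    case (elim x)
    show ?case
    proof
      assume "x \<in> {a..}"
      then have "a < x" and "((\<lambda>x. integral {a..x} (\<lambda>s. y s * of_real (q s - l))) has_vector_derivative y x * of_real (q x - l)) (at x)"
        using elim by auto
      then have "((\<lambda>x. c1 + integral {a..x} (\<lambda>s. y s * of_real (q s - l))) has_vector_derivative 0 + y x * of_real (q x - l)) (at x)"
        by (intro has_vector_derivative_add has_vector_derivative_const)
      then have "(y1 has_vector_derivative 0 + y x * of_real (q x - l)) (at x)"
        by (rule has_vector_derivative_transform_within_open[where S="{a<..}"]) (use \<open>a < x\<close> y1 in auto)
      then show "(y1 has_vector_derivative y x * of_real (q x - l)) (at x)" by simp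
    qed
  qed
  qed
  from lop_AE[OF twice_acI(2)[OF d ac] this, where q=q]
  have "AE x\<in>{a..} in lebesgue. lop a q y x = of_real l * y x" by (simp add: algebra_simps)
  then have "is_solution a q (of_real l) y" using twice_acI(1)[OF d ac] by (simp add: is_solution_def)
  moreover have "y a = c0" using y[of a] by simp
  moreover have "hl_deriv a y a = c1" using twice_acI(2)[OF d ac, of a] y1[of a] by simp
  ultimately show thesis by (rule that)
qed

section \<open>Square integrable functions and cut-offs\<close>

text \<open>Completeness of Lebesgue measure: the part of a preimage inside the exceptional null set
  is measurable whatever it is.\<close>

lemma borel_measurable_lebesgue_AE_cong:
  fixes f g :: "real \<Rightarrow> complex"
  assumes f: "f \<in> borel_measurable lebesgue" and ae: "AE x in lebesgue. f x = g x"
  shows "g \<in> borel_measurable lebesgue"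
proof (rule measurableI)
  fix S :: "complex set" assume S: "S \<in> sets borel"
  obtain N where N: "negligible N" "\<And>x. x \<notin> N \<Longrightarrow> f x = g x" using ae unfolding AE_lebesgue_iff_negligible by blast
  have "f -` S \<inter> space lebesgue \<in> sets lebesgue" using f S by (rule measurable_sets)
  moreover have "N \<in> sets lebesgue" "g -` S \<inter> N \<in> sets lebesgue"
    using N(1) negligible_subset[OF N(1), of "g -` S \<inter> N"] by (auto intro: negligible_imp_sets)
  ultimately have "(f -` S \<inter> space lebesgue - N) \<union> (g -` S \<inter> N) \<in> sets lebesgue" by blast
  moreover have "(f -` S \<inter> space lebesgue - N) \<union> (g -` S \<inter> N) = g -` S \<inter> space lebesgue" using N(2) by auto
  ultimately show "g -` S \<inter> space lebesgue \<in> sets lebesgue" by simp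
qed simp

lemma set_borel_measurable_AE_cong:
  fixes f g :: cfun
  assumes f: "set_borel_measurable lebesgue S f" and ae: "AE x in lebesgue. x \<in> S \<longrightarrow> f x = g x"
  shows "set_borel_measurable lebesgue S g"
  unfolding set_borel_measurable_def
proof (rule borel_measurable_lebesgue_AE_cong)
  show "(\<lambda>x. indicat_real S x *\<^sub>R f x) \<in> borel_measurable lebesgue" using f by (simp add: set_borel_measurable_def)
  show "AE x in lebesgue. indicat_real S x *\<^sub>R f x = indicat_real S x *\<^sub>R g x"
    using ae by eventually_elim (auto simp: indicator_def)
qed

lemma set_borel_measurable_mult_cnj:
  assumes "set_borel_measurable lebesgue S f" "set_borel_measurable lebesgue S g"
  shows "set_borel_measurable lebesgue S (\<lambda>x. f x * cnj (g x))"
proof -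
  have "(\<lambda>x. (indicat_real S x *\<^sub>R f x) * cnj (indicat_real S x *\<^sub>R g x)) \<in> borel_measurable lebesgue"
    using assms unfolding set_borel_measurable_def
    by (intro borel_measurable_times borel_measurable_continuous_on[where f=cnj]) (auto intro: continuous_intros)
  moreover have "(\<lambda>x. (indicat_real S x *\<^sub>R f x) * cnj (indicat_real S x *\<^sub>R g x)) = (\<lambda>x. indicat_real S x *\<^sub>R (f x * cnj (g x)))"
    by (auto simp: indicator_def)
  ultimately show ?thesis by (simp add: set_borel_measurable_def)
qed

lemma set_borel_measurable_lincomb:
  fixes f g :: cfun
  assumes "set_borel_measurable lebesgue S f" "set_borel_measurable lebesgue S g"
  shows "set_borel_measurable lebesgue S (\<lambda>x. c * f x + d * g x)"
proof -
  have "(\<lambda>x. c * (indicat_real S x *\<^sub>R f x) + d * (indicat_real S x *\<^sub>R g x)) \<in> borel_measurable lebesgue"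
    using assms unfolding set_borel_measurable_def by measurable
  moreover have "(\<lambda>x. c * (indicat_real S x *\<^sub>R f x) + d * (indicat_real S x *\<^sub>R g x)) = (\<lambda>x. indicat_real S x *\<^sub>R (c * f x + d * g x))"
    by (auto simp: indicator_def)
  ultimately show ?thesis by (simp add: set_borel_measurable_def)
qed

lemma set_borel_measurable_cmod2:
  fixes f :: cfun
  assumes "set_borel_measurable lebesgue S f"
  shows "set_borel_measurable lebesgue S (\<lambda>x. (cmod (f x))\<^sup>2)"
proof -
  have "(\<lambda>x. (cmod (indicat_real S x *\<^sub>R f x))\<^sup>2) \<in> borel_measurable lebesgue"
    using assms unfolding set_borel_measurable_def by measurable
  moreover have "(\<lambda>x. (cmod (indicat_real S x *\<^sub>R f x))\<^sup>2) = (\<lambda>x. indicat_real S x *\<^sub>R (cmod (f x))\<^sup>2)"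
    by (auto simp: indicator_def)
  ultimately show ?thesis by (simp add: set_borel_measurable_def)
qed

abbreviation sq_norm_on :: "real set \<Rightarrow> cfun \<Rightarrow> real" where
  "sq_norm_on S f \<equiv> integral S (\<lambda>x. (cmod (f x))\<^sup>2)"

lemma L2D: "f \<in> L2 a \<Longrightarrow> set_borel_measurable lebesgue {a..} f"
  "f \<in> L2 a \<Longrightarrow> (\<lambda>x. (cmod (f x))\<^sup>2) absolutely_integrable_on {a..}"
  by (auto simp: L2_def)

lemma L2_AE_cong:
  assumes f: "f \<in> L2 a" and ae: "AE x\<in>{a..} in lebesgue. f x = g x"
  shows "g \<in> L2 a"
proof -
  have m: "set_borel_measurable lebesgue {a..} g" by (rule set_borel_measurable_AE_cong[OF L2D(1)[OF f] ae])
  have "(\<lambda>x. (cmod (g x))\<^sup>2) absolutely_integrable_on {a..}"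
    using L2D(2)[OF f] set_borel_measurable_cmod2[OF m]
    by (rule set_integrable_bound) (use ae in eventually_elim, auto)
  then show ?thesis using m by (simp add: L2_def)
qed

lemma L2_lincomb:
  assumes f: "f \<in> L2 a" and g: "g \<in> L2 a"
  shows "(\<lambda>x. c * f x + d * g x) \<in> L2 a"
proof -
  have m: "set_borel_measurable lebesgue {a..} (\<lambda>x. c * f x + d * g x)"
    by (rule set_borel_measurable_lincomb[OF L2D(1)[OF f] L2D(1)[OF g]])
  have "(\<lambda>x. (cmod (c * f x + d * g x))\<^sup>2) absolutely_integrable_on {a..}"
  proof (rule set_integrable_bound[OF _ set_borel_measurable_cmod2[OF m]])
    show "(\<lambda>x. 2 * (cmod c)\<^sup>2 * (cmod (f x))\<^sup>2 + 2 * (cmod d)\<^sup>2 * (cmod (g x))\<^sup>2) absolutely_integrable_on {a..}"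
      using L2D(2)[OF f] L2D(2)[OF g] by (intro set_integral_add set_integrable_mult_right)
    show "AE x\<in>{a..} in lebesgue. norm ((cmod (c * f x + d * g x))\<^sup>2) \<le>
        norm (2 * (cmod c)\<^sup>2 * (cmod (f x))\<^sup>2 + 2 * (cmod d)\<^sup>2 * (cmod (g x))\<^sup>2)"
    proof (intro AE_I2 impI)
      fix x
      have "(cmod (c * f x + d * g x))\<^sup>2 \<le> (cmod (c * f x) + cmod (d * g x))\<^sup>2"
        by (intro power_mono norm_triangle_ineq) auto
      also have "\<dots> \<le> 2 * (cmod (c * f x))\<^sup>2 + 2 * (cmod (d * g x))\<^sup>2"
        using sum_squares_bound[of "cmod (c * f x)" "cmod (d * g x)"] by (simp add: power2_sum)
      also have "\<dots> = 2 * (cmod c)\<^sup>2 * (cmod (f x))\<^sup>2 + 2 * (cmod d)\<^sup>2 * (cmod (g x))\<^sup>2"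
        by (simp add: norm_mult power_mult_distrib)
      finally show "norm ((cmod (c * f x + d * g x))\<^sup>2) \<le>
        norm (2 * (cmod c)\<^sup>2 * (cmod (f x))\<^sup>2 + 2 * (cmod d)\<^sup>2 * (cmod (g x))\<^sup>2)" by simp
    qed
  qed
  then show ?thesis using m by (simp add: L2_def)
qed

lemma L2_mult_integrable:
  assumes f: "f \<in> L2 a" and g: "g \<in> L2 a"
  shows "set_integrable lebesgue {a..} (\<lambda>x. f x * cnj (g x))"
proof (rule set_integrable_bound)
  show "set_integrable lebesgue {a..} (\<lambda>x. (cmod (f x))\<^sup>2 + (cmod (g x))\<^sup>2)"
    using L2D(2)[OF f] L2D(2)[OF g] by (rule set_integral_add)
  show "set_borel_measurable lebesgue {a..} (\<lambda>x. f x * cnj (g x))"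
    by (rule set_borel_measurable_mult_cnj[OF L2D(1)[OF f] L2D(1)[OF g]])
  show "AE x\<in>{a..} in lebesgue. norm (f x * cnj (g x)) \<le> norm ((cmod (f x))\<^sup>2 + (cmod (g x))\<^sup>2)"
  proof (intro AE_I2 impI)
    fix x
    have "2 * (cmod (f x) * cmod (g x)) \<le> (cmod (f x))\<^sup>2 + (cmod (g x))\<^sup>2"
      using sum_squares_bound[of "cmod (f x)" "cmod (g x)"] by simp
    moreover have "0 \<le> cmod (f x) * cmod (g x)" by simp
    ultimately show "norm (f x * cnj (g x)) \<le> norm ((cmod (f x))\<^sup>2 + (cmod (g x))\<^sup>2)"
      unfolding norm_mult complex_mod_cnj real_norm_def by linarith
  qed
qed

lemma ip_eq_integral:
  assumes "f \<in> L2 a" "g \<in> L2 a"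
  shows "ip a f g = integral {a..} (\<lambda>x. f x * cnj (g x))" "(\<lambda>x. f x * cnj (g x)) integrable_on {a..}"
  unfolding ip_def using set_lebesgue_integral_eq_integral[OF L2_mult_integrable[OF assms]] by auto

lemma ip_cnj: "ip a g f = cnj (ip a f g)"
proof -
  have "ip a g f = (LINT x|lebesgue. cnj (indicat_real {a..} x *\<^sub>R (f x * cnj (g x))))"
    unfolding ip_def set_lebesgue_integral_def by (intro Bochner_Integration.integral_cong) (auto simp: mult.commute)
  also have "\<dots> = cnj (ip a f g)" unfolding ip_def set_lebesgue_integral_def by (rule Bochner_Integration.integral_cnj)
  finally show ?thesis .
qed

lemma ip_lincomb_left:
  assumes "f \<in> L2 a" "g \<in> L2 a" "h \<in> L2 a"
  shows "ip a (\<lambda>x. c * f x + d * g x) h = c * ip a f h + d * ip a g h"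
proof -
  have "ip a (\<lambda>x. c * f x + d * g x) h = (LINT x:{a..}|lebesgue. c * (f x * cnj (h x)) + d * (g x * cnj (h x)))"
    unfolding ip_def by (simp add: algebra_simps)
  also have "\<dots> = c * ip a f h + d * ip a g h"
    unfolding ip_def
    by (subst set_integral_add(2)) (auto intro!: set_integrable_mult_right L2_mult_integrable assms)
  finally show ?thesis .
qed

lemma ip_lincomb_right:
  assumes "f \<in> L2 a" "g \<in> L2 a" "h \<in> L2 a"
  shows "ip a h (\<lambda>x. c * f x + d * g x) = cnj c * ip a h f + cnj d * ip a h g"
  using arg_cong[OF ip_lincomb_left[OF assms, of c d], of cnj]
  by (simp add: ip_cnj[of a f h] ip_cnj[of a g h] ip_cnj[of a "\<lambda>x. c * f x + d * g x" h])

lemma ip_AE_cong: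
  assumes f: "f \<in> L2 a" and g: "g \<in> L2 a" and ae: "AE x\<in>{a..} in lebesgue. f x = f' x"
  shows "ip a f g = ip a f' g"
proof -
  have f': "f' \<in> L2 a" by (rule L2_AE_cong[OF f ae])
  obtain N where N: "negligible N" "\<And>x. x \<notin> N \<Longrightarrow> x \<in> {a..} \<Longrightarrow> f x = f' x"
    using ae unfolding AE_lebesgue_iff_negligible by blast
  show ?thesis unfolding ip_eq_integral(1)[OF f g] ip_eq_integral(1)[OF f' g]
    by (rule integral_spike[OF N(1)]) (use N(2) in auto)
qed

lemma ip_scale_left:
  assumes "f \<in> L2 a" "h \<in> L2 a"
  shows "ip a (\<lambda>x. c * f x) h = c * ip a f h"
  using ip_lincomb_left[OF assms(1,1,2), of c 0] by simp

lemma Re_ip_self: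
  assumes "f \<in> L2 a"
  shows "Re (ip a f f) \<ge> 0" "ip a f f = of_real (Re (ip a f f))" "Re (ip a f f) = sq_norm_on {a..} f"
proof -
  have "ip a f f = (LINT x:{a..}|lebesgue. of_real ((cmod (f x))\<^sup>2))"
    unfolding ip_def complex_norm_square by simp
  then have e: "ip a f f = of_real (LINT x:{a..}|lebesgue. (cmod (f x))\<^sup>2)" by (simp only: set_integral_complex_of_real)
  then show "ip a f f = of_real (Re (ip a f f))" by simp
  show e2: "Re (ip a f f) = sq_norm_on {a..} f"
    using e set_lebesgue_integral_eq_integral(2)[OF L2D(2)[OF assms]] by simp
  show "Re (ip a f f) \<ge> 0" unfolding e2 by (rule integral_nonneg) (use L2D(2)[OF assms] in \<open>auto simp: absolutely_integrable_on_def\<close>)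
qed

lemma continuous_Ici_set_borel_measurable:
  fixes f :: cfun
  assumes "continuous_on {a..} f"
  shows "set_borel_measurable lebesgue {a..} f"
proof -
  have "f \<in> borel_measurable (lebesgue_on {a..})" by (rule continuous_imp_measurable_on_sets_lebesgue[OF assms]) simp
  then show ?thesis by (simp add: set_borel_measurable_def borel_measurable_restrict_space_iff)
qed

lemma integral_Ici_eq:
  fixes F :: "real \<Rightarrow> 'a::banach"
  assumes "\<And>x. x > b \<Longrightarrow> F x = 0"
  shows "integral {a..} F = integral {a..b} F" "F integrable_on {a..} \<longleftrightarrow> F integrable_on {a..b}"
proof -
  have e: "{x \<in> {a..} - {a..b}. F x \<noteq> 0} = {}" "{x \<in> {a..b} - {a..}. F x \<noteq> 0} = {}"
    using assms by (auto simp: not_le)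
  show "integral {a..} F = integral {a..b} F" by (rule integral_spike_set) (simp_all only: e negligible_empty)
  show "F integrable_on {a..} \<longleftrightarrow> F integrable_on {a..b}"
    using e integrable_spike_set[of F "{a..}" "{a..b}"] integrable_spike_set[of F "{a..b}" "{a..}"] negligible_empty by metis
qed

lemma L2_continuous_compact_support:
  assumes c: "continuous_on {a..} f" and z: "\<And>x. x > b \<Longrightarrow> f x = 0"
  shows "f \<in> L2 a"
proof -
  have "(\<lambda>x. (cmod (f x))\<^sup>2) integrable_on {a..b}"
    by (intro integrable_continuous_interval continuous_intros continuous_on_subset[OF c]) auto
  then have "(\<lambda>x. (cmod (f x))\<^sup>2) integrable_on {a..}" by (subst integral_Ici_eq(2)[of b]) (auto simp: z)
  then have "(\<lambda>x. (cmod (f x))\<^sup>2) absolutely_integrable_on {a..}" by (rule nonnegative_absolutely_integrable_1) auto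
  then show ?thesis using continuous_Ici_set_borel_measurable[OF c] by (simp add: L2_def)
qed

text \<open>On a bounded interval \<open>cmod (f x)\<close> is dominated by the integrable function
  \<open>(cmod (f x))\<^sup>2 + 1\<close>.\<close>

lemma L2_locally_absolutely_integrable:
  assumes f: "f \<in> L2 a" and "a \<le> c"
  shows "f absolutely_integrable_on {c..d}"
proof (rule set_integrable_bound)
  have s: "set_integrable lebesgue {c..d} (\<lambda>x. (cmod (f x))\<^sup>2)"
    by (rule set_integrable_subset[OF L2D(2)[OF f]]) (use \<open>a \<le> c\<close> in auto)
  have "(\<lambda>x. 1::real) absolutely_integrable_on {c..d}"
    by (intro absolutely_integrable_continuous_real continuous_intros)
  with s show "set_integrable lebesgue {c..d} (\<lambda>x. (cmod (f x))\<^sup>2 + 1)" by (rule set_integral_add)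
  have "(\<lambda>x. indicat_real {c..d} x *\<^sub>R (indicat_real {a..} x *\<^sub>R f x)) \<in> borel_measurable lebesgue"
    using L2D(1)[OF f] unfolding set_borel_measurable_def
    by (rule borel_measurable_scaleR[OF borel_measurable_indicator, rotated]) simp
  moreover have "(\<lambda>x. indicat_real {c..d} x *\<^sub>R (indicat_real {a..} x *\<^sub>R f x)) = (\<lambda>x. indicat_real {c..d} x *\<^sub>R f x)"
    using \<open>a \<le> c\<close> by (auto simp: indicator_def)
  ultimately show "set_borel_measurable lebesgue {c..d} f" by (simp add: set_borel_measurable_def)
  show "AE x in lebesgue. x \<in> {c..d} \<longrightarrow> norm (f x) \<le> norm ((cmod (f x))\<^sup>2 + 1)"
  proof (intro AE_I2 impI)
    fix x
    show "norm (f x) \<le> norm ((cmod (f x))\<^sup>2 + 1)"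
    proof -
      have "2 * cmod (f x) \<le> (cmod (f x))\<^sup>2 + 1" using sum_squares_bound[of "cmod (f x)" 1] by simp
      then show ?thesis using norm_ge_zero[of "f x"] unfolding real_norm_def by linarith
    qed
  qed
qed

section \<open>Elements of H_+ and Green's formula on an interval\<close>

lemma HplusD:
  assumes "y \<in> Hplus a q"
  shows "y \<in> L2 a" "twice_ac a y" "lop a q y \<in> L2 a"
  using assms by (auto simp: Hplus_def)

lemma Hplus_lincomb:
  assumes f: "f \<in> Hplus a q" and g: "g \<in> Hplus a q"
  shows "(\<lambda>x. c * f x + d * g x) \<in> Hplus a q"
    "hl_deriv a (\<lambda>x. c * f x + d * g x) a = c * hl_deriv a f a + d * hl_deriv a g a"
    "h \<in> L2 a \<Longrightarrow> ip a (lop a q (\<lambda>x. c * f x + d * g x)) h = c * ip a (lop a q f) h + d * ip a (lop a q g) h"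
proof -
  note F = HplusD[OF f] and G = HplusD[OF g]
  have l: "(\<lambda>x. c * lop a q f x + d * lop a q g x) \<in> L2 a" by (rule L2_lincomb[OF F(3) G(3)])
  have ae: "AE x\<in>{a..} in lebesgue. c * lop a q f x + d * lop a q g x = lop a q (\<lambda>x. c * f x + d * g x) x"
    using twice_ac_lincomb(3)[OF F(2) G(2), where c=c and d=d and q=q] by eventually_elim auto
  show "(\<lambda>x. c * f x + d * g x) \<in> Hplus a q"
    using L2_lincomb[OF F(1) G(1)] twice_ac_lincomb(1)[OF F(2) G(2)] L2_AE_cong[OF l ae] by (simp add: Hplus_def)
  show "hl_deriv a (\<lambda>x. c * f x + d * g x) a = c * hl_deriv a f a + d * hl_deriv a g a"
    by (rule twice_ac_lincomb(2)[OF F(2) G(2)]) simp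
  show "ip a (lop a q (\<lambda>x. c * f x + d * g x)) h = c * ip a (lop a q f) h + d * ip a (lop a q g) h" if "h \<in> L2 a"
    using ip_AE_cong[OF l that ae] ip_lincomb_left[OF F(3) G(3) that] by simp
qed

text \<open>The integrand is almost everywhere the derivative of the Wronskian \<open>?W\<close>;
  the potential cancels because \<open>q\<close> is real.\<close>

lemma Green_interval:
  assumes q: "locally_summable a q" and y: "y \<in> Hplus a q" and z: "z \<in> Hplus a q" and "a \<le> b"
  shows "((\<lambda>x. lop a q y x * cnj (z x) - y x * cnj (lop a q z x)) has_integral
    (hl_deriv a y a * cnj (z a) - y a * cnj (hl_deriv a z a)) - (hl_deriv a y b * cnj (z b) - y b * cnj (hl_deriv a z b))) {a..b}"
proof -
  note Y = HplusD[OF y] and Z = HplusD[OF z]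
  let ?W = "\<lambda>x. y x * cnj (hl_deriv a z x) - hl_deriv a y x * cnj (z x)"
  let ?g = "\<lambda>x. lop a q y x * cnj (z x) - y x * cnj (lop a q z x)"
  have ac: "loc_abs_cont a ?W"
    using twice_acD(2,3)[OF Y(2)] twice_acD(2,3)[OF Z(2)] unfolding loc_abs_cont_def
    by (auto intro!: abs_cont_on_diff abs_cont_on_mult abs_cont_on_cnj)
  have "AE x\<in>{a..} in lebesgue. (?W has_vector_derivative ?g x) (at x)"
    using twice_acD(6)[OF Y(2)] twice_acD(6)[OF Z(2)] AE_lebesgue_neq[of a]
  proof eventually_elim
    case (elim x)
    show ?case
    proof
      assume "x \<in> {a..}"
      then have d: "(y has_vector_derivative hl_deriv a y x) (at x)" "(z has_vector_derivative hl_deriv a z x) (at x)"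
        using twice_acD(1)[OF Y(2), of x] twice_acD(1)[OF Z(2), of x] elim by (simp_all add: at_within_Ici_interior)
      have d2: "(hl_deriv a y has_vector_derivative hl_deriv a (hl_deriv a y) x) (at x)"
        "(hl_deriv a z has_vector_derivative hl_deriv a (hl_deriv a z) x) (at x)"
        using elim \<open>x \<in> {a..}\<close> by simp_all
      have "(?W has_vector_derivative
         (y x * cnj (hl_deriv a (hl_deriv a z) x) + hl_deriv a y x * cnj (hl_deriv a z x))
         - (hl_deriv a y x * cnj (hl_deriv a z x) + hl_deriv a (hl_deriv a y) x * cnj (z x))) (at x)"
        by (intro has_vector_derivative_diff has_vector_derivative_mult has_vector_derivative_cnj d d2)
      then show "(?W has_vector_derivative ?g x) (at x)"
        unfolding hl_deriv2_eq_lop[where q=q] by (simp add: algebra_simps)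
    qed
  qed
  moreover have "?g absolutely_integrable_on {a..b}"
    by (rule set_integrable_subset[OF set_integral_diff(1)[OF L2_mult_integrable[OF Y(3) Z(1)] L2_mult_integrable[OF Y(1) Z(3)]]]) auto
  ultimately have "(?g has_integral ?W b - ?W a) {a..b}" using \<open>a \<le> b\<close> by (intro loc_abs_cont_FTC[OF ac]) auto
  then show ?thesis by (simp add: algebra_simps)
qed

lemma Green_compact_support:
  assumes q: "locally_summable a q" and y: "y \<in> Hplus a q" and z: "z \<in> Hplus a q" and "a \<le> b"
    and z0: "\<And>x. b \<le> x \<Longrightarrow> z x = 0" "hl_deriv a z b = 0"
    and lz0: "AE x\<in>{a..} in lebesgue. b < x \<longrightarrow> lop a q z x = 0"
  shows "ip a (lop a q y) z - ip a y (lop a q z) = hl_deriv a y a * cnj (z a) - y a * cnj (hl_deriv a z a)"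
proof -
  note Y = HplusD[OF y] and Z = HplusD[OF z]
  let ?g = "\<lambda>x. lop a q y x * cnj (z x) - y x * cnj (lop a q z x)"
  obtain N where N: "negligible N" "\<And>x. x \<notin> N \<Longrightarrow> x \<in> {a..} \<Longrightarrow> b < x \<Longrightarrow> lop a q z x = 0"
    using lz0 unfolding AE_lebesgue_iff_negligible by blast
  have "ip a (lop a q y) z - ip a y (lop a q z) = integral {a..} ?g"
    unfolding ip_eq_integral(1)[OF Y(3) Z(1)] ip_eq_integral(1)[OF Y(1) Z(3)]
    by (rule integral_diff[symmetric]) (rule ip_eq_integral(2)[OF Y(3) Z(1)], rule ip_eq_integral(2)[OF Y(1) Z(3)])
  also have "\<dots> = integral {a..b} ?g"
  proof (rule integral_spike_set)
    show "negligible {x \<in> {a..} - {a..b}. ?g x \<noteq> 0}"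
      by (rule negligible_subset[OF N(1)]) (use N(2) z0(1) in force)
    have "{x \<in> {a..b} - {a..}. ?g x \<noteq> 0} = {}" by auto
    then show "negligible {x \<in> {a..b} - {a..}. ?g x \<noteq> 0}" by (simp only: negligible_empty)
  qed
  also have "\<dots> = hl_deriv a y a * cnj (z a) - y a * cnj (hl_deriv a z a)"
    using integral_unique[OF Green_interval[OF q y z \<open>a \<le> b\<close>]] z0(1)[of b] z0(2) by simp
  finally show ?thesis .
qed

text \<open>A twice continuously differentiable cut-off: 1 on the negative half-line and 0 beyond 1.\<close>

definition cutf :: "real \<Rightarrow> real" where
  "cutf t = (max 0 (1 - (max 0 t)^3))^3"
definition cutf1 :: "real \<Rightarrow> real" where
  "cutf1 t = - 9 * (max 0 (1 - (max 0 t)^3))^2 * (max 0 t)^2"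
definition cutf2 :: "real \<Rightarrow> real" where
  "cutf2 t = 54 * (max 0 (1 - (max 0 t)^3)) * (max 0 t)^4 - 18 * (max 0 (1 - (max 0 t)^3))^2 * max 0 t"

text \<open>The exponent is at least 2, so both one-sided derivatives vanish at the kink.\<close>

lemma max_power_deriv:
  "((\<lambda>t::real. (max 0 t) ^ Suc (Suc n)) has_real_derivative real (Suc (Suc n)) * (max 0 t) ^ Suc n) (at t)"
proof -
  consider "t > 0" | "t < 0" | "t = 0" by linarith
  then show ?thesis
  proof cases
    case 1
    have "((\<lambda>t::real. t ^ Suc (Suc n)) has_real_derivative real (Suc (Suc n)) * t ^ Suc n) (at t)"
      using DERIV_pow[of "Suc (Suc n)" t] by simp
    then have "((\<lambda>t::real. (max 0 t) ^ Suc (Suc n)) has_real_derivative real (Suc (Suc n)) * t ^ Suc n) (at t)"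
      by (rule has_field_derivative_transform_within_open[where S="{0<..}"]) (use 1 in auto)
    then show ?thesis using 1 by simp
  next
    case 2
    have "((\<lambda>t::real. 0) has_real_derivative 0) (at t)" by simp
    then have "((\<lambda>t::real. (max 0 t) ^ Suc (Suc n)) has_real_derivative 0) (at t)"
      by (rule has_field_derivative_transform_within_open[where S="{..<0}"]) (use 2 in auto)
    then show ?thesis using 2 by simp
  next
    case 3
    have "((\<lambda>h::real. ((max 0 (t + h)) ^ Suc (Suc n) - (max 0 t) ^ Suc (Suc n)) / h) \<longlongrightarrow> 0) (at 0)"
    proof (rule Lim_null_comparison[where g="\<lambda>h. \<bar>h\<bar> ^ Suc n"])
      show "\<forall>\<^sub>F h in at 0. norm (((max 0 (t + h)) ^ Suc (Suc n) - (max 0 t) ^ Suc (Suc n)) / h) \<le> \<bar>h\<bar> ^ Suc n"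
      proof (rule always_eventually, rule allI)
        fix h :: real
        show "norm (((max 0 (t + h)) ^ Suc (Suc n) - (max 0 t) ^ Suc (Suc n)) / h) \<le> \<bar>h\<bar> ^ Suc n"
        proof (cases "h > 0")
          case True
          then show ?thesis using 3 by (simp add: abs_mult)
        next
          case False
          then have "max 0 (t + h) = 0" using 3 by simp
          then have "((max 0 (t + h)) ^ Suc (Suc n) - (max 0 t) ^ Suc (Suc n)) / h = 0" using 3 by simp
          then show ?thesis by (simp only: norm_zero zero_le_power abs_ge_zero)
        qed
      qed
      have "((\<lambda>h::real. \<bar>h\<bar> ^ Suc n) \<longlongrightarrow> \<bar>0\<bar> ^ Suc n) (at 0)" by (intro tendsto_intros)
      then show "((\<lambda>h::real. \<bar>h\<bar> ^ Suc n) \<longlongrightarrow> 0) (at 0)" by simp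
    qed
    then show ?thesis using 3 by (simp add: DERIV_def)
  qed
qed

lemma cutf_deriv: "(cutf has_real_derivative cutf1 t) (at t)" "(cutf1 has_real_derivative cutf2 t) (at t)"
proof -
  have m3: "((\<lambda>t::real. (max 0 t) ^ 3) has_real_derivative 3 * (max 0 t) ^ 2) (at t)" for t
    using max_power_deriv[of 1 t] by (simp add: numeral_eq_Suc)
  have m2: "((\<lambda>t::real. (max 0 t) ^ 2) has_real_derivative 2 * max 0 t) (at t)" for t
    using max_power_deriv[of 0 t] by (simp add: numeral_eq_Suc)
  have u: "((\<lambda>t::real. 1 - (max 0 t) ^ 3) has_real_derivative - (3 * (max 0 t) ^ 2)) (at t)"
    using DERIV_diff[OF DERIV_const m3[of t], of 1] by simp
  have "(cutf has_real_derivative 3 * (max 0 (1 - (max 0 t)^3)) ^ 2 * (- (3 * (max 0 t) ^ 2))) (at t)"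
    unfolding cutf_def[abs_def] using DERIV_chain2[OF m3 u] .
  then show "(cutf has_real_derivative cutf1 t) (at t)" by (simp add: cutf1_def mult.assoc)
  have "((\<lambda>t::real. - 9 * ((max 0 (1 - (max 0 t)^3))^2 * (max 0 t)^2)) has_real_derivative
     - 9 * (2 * max 0 (1 - (max 0 t)^3) * (- (3 * (max 0 t) ^ 2)) * (max 0 t)^2 + 2 * max 0 t * (max 0 (1 - (max 0 t)^3))^2)) (at t)"
    by (intro DERIV_cmult DERIV_mult DERIV_chain2[OF m2 u] m2)
  moreover have "(\<lambda>t::real. - 9 * ((max 0 (1 - (max 0 t)^3))^2 * (max 0 t)^2)) = cutf1"
    by (auto simp: cutf1_def)
  moreover have "- 9 * (2 * max 0 (1 - (max 0 t)^3) * (- (3 * (max 0 t) ^ 2)) * (max 0 t)^2 + 2 * max 0 t * (max 0 (1 - (max 0 t)^3))^2) = cutf2 t"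
    unfolding cutf2_def by algebra
  ultimately show "(cutf1 has_real_derivative cutf2 t) (at t)" by (simp only:)
qed

lemma cutf_continuous: "continuous_on S cutf" "continuous_on S cutf1" "continuous_on S cutf2"
  unfolding cutf_def[abs_def] cutf1_def[abs_def] cutf2_def[abs_def] by (intro continuous_intros)+

lemma cutf_left: "t \<le> 0 \<Longrightarrow> cutf t = 1" "t \<le> 0 \<Longrightarrow> cutf1 t = 0" "t \<le> 0 \<Longrightarrow> cutf2 t = 0"
  by (simp_all add: cutf_def cutf1_def cutf2_def max_absorb1)

lemma cutf_right: "t \<ge> 1 \<Longrightarrow> cutf t = 0" "t \<ge> 1 \<Longrightarrow> cutf1 t = 0" "t \<ge> 1 \<Longrightarrow> cutf2 t = 0"
proof -
  assume "t \<ge> 1"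
  then have "max 0 t \<ge> 1" by simp
  then have "(max 0 t) ^ 3 \<ge> 1" by (rule one_le_power)
  then have "max 0 (1 - (max 0 t)^3) = 0" by simp
  then show "cutf t = 0" "cutf1 t = 0" "cutf2 t = 0" unfolding cutf_def cutf1_def cutf2_def by simp_all
qed

text \<open>For \<open>t < 1\<close> all the powers that occur lie in \<open>[0,1]\<close>, so the
  coefficients decide: 9 for the first derivative, \<open>54 + 18 = 72\<close> for the
  second.\<close>

lemma cutf_bound: "\<bar>cutf t\<bar> \<le> 1" "\<bar>cutf1 t\<bar> \<le> 9" "\<bar>cutf2 t\<bar> \<le> 72"
proof -
  define m where "m = max 0 t"
  define u where "u = max 0 (1 - m^3)"
  have "m \<ge> 0" by (simp add: m_def)
  then have u: "0 \<le> u" "u \<le> 1" by (auto simp: u_def)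
  show "\<bar>cutf t\<bar> \<le> 1" unfolding cutf_def m_def[symmetric] u_def[symmetric] using u by (simp add: power_le_one)
  have "\<bar>cutf1 t\<bar> \<le> 9 \<and> \<bar>cutf2 t\<bar> \<le> 72"
  proof (cases "t \<ge> 1")
    case True then show ?thesis using cutf_right by simp
  next
    case False
    then have m1: "m \<le> 1" by (simp add: m_def)
    have p: "0 \<le> u^2 * m^2" "u^2 * m^2 \<le> 1" "0 \<le> u * m^4" "u * m^4 \<le> 1" "0 \<le> u^2 * m" "u^2 * m \<le> 1"
      using u \<open>m \<ge> 0\<close> m1 by (auto intro!: mult_le_one power_le_one)
    show ?thesis unfolding cutf1_def cutf2_def m_def[symmetric] u_def[symmetric] using p by (auto simp: abs_le_iff)
  qed
  then show "\<bar>cutf1 t\<bar> \<le> 9" "\<bar>cutf2 t\<bar> \<le> 72" by auto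
qed

definition cutoff :: "real \<Rightarrow> real \<Rightarrow> cfun \<Rightarrow> cfun" where
  "cutoff b \<epsilon> z = (\<lambda>x. of_real (cutf ((x - b) / \<epsilon>)) * z x)"

text \<open>The Leibniz expansion of \<open>lop\<close> on the cut-off, with
  \<open>lop a q z\<close> replaced by a continuous representative \<open>k\<close>. Unlike
  \<open>lop\<close> itself, which is arbitrary on a null set, this admits pointwise bounds.\<close>

definition lop_cutoff :: "real \<Rightarrow> real \<Rightarrow> real \<Rightarrow> cfun \<Rightarrow> cfun \<Rightarrow> cfun" where
  "lop_cutoff a b \<epsilon> z k = (\<lambda>x. of_real (cutf ((x - b) / \<epsilon>)) * k x
     - 2 * of_real (cutf1 ((x - b) / \<epsilon>) / \<epsilon>) * hl_deriv a z x - of_real (cutf2 ((x - b) / \<epsilon>) / \<epsilon>^2) * z x)"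

lemma cutoff_props:
  assumes z: "twice_ac a z" and k: "continuous_on {a..} k"
    and lz: "AE x\<in>{a..} in lebesgue. lop a q z x = k x" and "\<epsilon> > 0"
  shows "cutoff b \<epsilon> z \<in> Hplus a q"
    "x \<le> b \<Longrightarrow> cutoff b \<epsilon> z x = z x"
    "a \<le> x \<Longrightarrow> x \<le> b \<Longrightarrow> hl_deriv a (cutoff b \<epsilon> z) x = hl_deriv a z x"
    "x \<ge> b + \<epsilon> \<Longrightarrow> cutoff b \<epsilon> z x = 0"
    "a \<le> x \<Longrightarrow> x \<ge> b + \<epsilon> \<Longrightarrow> hl_deriv a (cutoff b \<epsilon> z) x = 0"
    "AE x\<in>{a..} in lebesgue. lop a q (cutoff b \<epsilon> z) x = lop_cutoff a b \<epsilon> z k x"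
    "continuous_on {a..} (lop_cutoff a b \<epsilon> z k)"
    "x \<ge> b + \<epsilon> \<Longrightarrow> lop_cutoff a b \<epsilon> z k x = 0"
    "x \<le> b \<Longrightarrow> lop_cutoff a b \<epsilon> z k x = k x"
proof -
  let ?t = "\<lambda>x. (x - b) / \<epsilon>"
  have t: "(?t has_real_derivative 1 / \<epsilon>) (at x)" for x using \<open>\<epsilon> > 0\<close> by (auto intro!: derivative_eq_intros)
  have d1: "((\<lambda>x. cutf (?t x)) has_real_derivative cutf1 (?t x) / \<epsilon>) (at x)" for x
    using DERIV_chain2[OF cutf_deriv(1) t, of x] by simp
  have d2: "((\<lambda>x. cutf1 (?t x) / \<epsilon>) has_real_derivative cutf2 (?t x) / \<epsilon>^2) (at x)" for x
    using DERIV_cdivide[OF DERIV_chain2[OF cutf_deriv(2) t, of x], of \<epsilon>] by (simp add: power2_eq_square)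
  have ct: "continuous_on S ?t" for S using \<open>\<epsilon> > 0\<close> by (intro continuous_intros) auto
  have cc: "continuous_on S (\<lambda>x. cutf (?t x))" "continuous_on S (\<lambda>x. cutf1 (?t x))" "continuous_on S (\<lambda>x. cutf2 (?t x))" for S
    by (rule continuous_on_compose2[OF cutf_continuous(1) ct subset_UNIV],
        rule continuous_on_compose2[OF cutf_continuous(2) ct subset_UNIV],
        rule continuous_on_compose2[OF cutf_continuous(3) ct subset_UNIV])
  have "continuous_on UNIV (\<lambda>x. cutf2 (?t x) / \<epsilon>^2)" by (intro continuous_on_divide cc(3) continuous_on_const) (use \<open>\<epsilon> > 0\<close> in auto)
  note m = twice_ac_mult_C2[OF z d1 d2 this, folded cutoff_def]
  note zc = twice_acD(4,5)[OF z]
  have tle: "?t x \<le> 0" if "x \<le> b" for x using that \<open>\<epsilon> > 0\<close> by (simp add: divide_le_0_iff)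
  have tge: "?t x \<ge> 1" if "x \<ge> b + \<epsilon>" for x using that \<open>\<epsilon> > 0\<close> by simp
  show le: "x \<le> b \<Longrightarrow> cutoff b \<epsilon> z x = z x" for x using cutf_left(1)[OF tle] by (simp add: cutoff_def)
  show ge: "x \<ge> b + \<epsilon> \<Longrightarrow> cutoff b \<epsilon> z x = 0" for x using cutf_right(1)[OF tge] by (simp add: cutoff_def)
  show "a \<le> x \<Longrightarrow> x \<le> b \<Longrightarrow> hl_deriv a (cutoff b \<epsilon> z) x = hl_deriv a z x"
    using m(2) cutf_left[OF tle] by simp
  show "a \<le> x \<Longrightarrow> x \<ge> b + \<epsilon> \<Longrightarrow> hl_deriv a (cutoff b \<epsilon> z) x = 0"
    using m(2) cutf_right[OF tge] by simp
  show cl: "continuous_on {a..} (lop_cutoff a b \<epsilon> z k)"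
    unfolding lop_cutoff_def using \<open>\<epsilon> > 0\<close> by (intro continuous_intros cc zc k) auto
  show gel: "x \<ge> b + \<epsilon> \<Longrightarrow> lop_cutoff a b \<epsilon> z k x = 0" for x
    using cutf_right[OF tge] by (simp add: lop_cutoff_def)
  show "x \<le> b \<Longrightarrow> lop_cutoff a b \<epsilon> z k x = k x"
    using cutf_left[OF tle] by (simp add: lop_cutoff_def)
  show ae: "AE x\<in>{a..} in lebesgue. lop a q (cutoff b \<epsilon> z) x = lop_cutoff a b \<epsilon> z k x"
    using m(3)[of q] lz by eventually_elim (auto simp: lop_cutoff_def)
  have "cutoff b \<epsilon> z \<in> L2 a"
    by (rule L2_continuous_compact_support[OF twice_acD(4)[OF m(1)], of "b + \<epsilon>"]) (simp add: ge)
  moreover have "lop a q (cutoff b \<epsilon> z) \<in> L2 a"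
  proof (rule L2_AE_cong)
    show "lop_cutoff a b \<epsilon> z k \<in> L2 a" by (rule L2_continuous_compact_support[OF cl, of "b + \<epsilon>"]) (simp add: gel)
    show "AE x\<in>{a..} in lebesgue. lop_cutoff a b \<epsilon> z k x = lop a q (cutoff b \<epsilon> z) x"
      using ae by eventually_elim auto
  qed
  ultimately show "cutoff b \<epsilon> z \<in> Hplus a q" using m(1) by (simp add: Hplus_def)
qed

section \<open>The energy form\<close>

lemma is_solution_props:
  assumes "is_solution a q (of_real l) y"
  shows "twice_ac a y" "AE x\<in>{a..} in lebesgue. lop a q y x = of_real l * y x"
    "continuous_on {a..} (\<lambda>x. of_real l * y x)"
proof -
  show t: "twice_ac a y" and "AE x\<in>{a..} in lebesgue. lop a q y x = of_real l * y x"
    using assms by (auto simp: is_solution_def)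
  show "continuous_on {a..} (\<lambda>x. of_real l * y x)" by (intro continuous_intros twice_acD(4)[OF t])
qed

text \<open>\<open>z\<close> vanishes at \<open>b\<close>, so cutting it off within distance \<open>\<epsilon>\<close> costs only \<open>O(\<epsilon>)\<close> of energy:
  \<open>z\<close> is of order \<open>\<epsilon>\<close> there, and the differential expression of order \<open>1/\<epsilon>\<close>.\<close>

lemma cutoff_small:
  assumes z: "twice_ac a z" and k: "continuous_on {a..} k" and "a \<le> b" and zb: "z b = 0"
  obtains C where "C \<ge> 0" "\<And>\<epsilon> x. 0 < \<epsilon> \<Longrightarrow> \<epsilon> \<le> 1 \<Longrightarrow> x \<in> {b..b + \<epsilon>} \<Longrightarrow> cmod (cutoff b \<epsilon> z x) \<le> C * \<epsilon>"
    "\<And>\<epsilon> x. 0 < \<epsilon> \<Longrightarrow> \<epsilon> \<le> 1 \<Longrightarrow> x \<in> {b..b + \<epsilon>} \<Longrightarrow> cmod (lop_cutoff a b \<epsilon> z k x * cnj (cutoff b \<epsilon> z x)) \<le> C"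
proof -
  have c: "continuous_on {b..b+1} k" "continuous_on {b..b+1} (hl_deriv a z)"
    using k twice_acD(5)[OF z] \<open>a \<le> b\<close> by (auto intro: continuous_on_subset)
  then have "bounded (k ` {b..b+1})" "bounded (hl_deriv a z ` {b..b+1})"
    by (auto intro!: compact_imp_bounded compact_continuous_image)
  then obtain M1 M2 where M1: "\<And>x. x \<in> {b..b+1} \<Longrightarrow> cmod (k x) \<le> M1" and M2: "\<And>x. x \<in> {b..b+1} \<Longrightarrow> cmod (hl_deriv a z x) \<le> M2"
    unfolding bounded_iff by (metis image_eqI)
  define M where "M = max 0 (max M1 M2)"
  have M0: "M \<ge> 0" by (simp add: M_def)
  have Mk: "cmod (k x) \<le> M" and Mz: "cmod (hl_deriv a z x) \<le> M" if "x \<in> {b..b+1}" for x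
    using M1[OF that] M2[OF that] by (auto simp: M_def)
  have zM: "cmod (z x) \<le> M * (x - b)" if "x \<in> {b..b+1}" for x
  proof -
    have "(hl_deriv a z has_integral (z x - z b)) {b..x}"
    proof (rule fundamental_theorem_of_calculus)
      fix t assume "t \<in> {b..x}"
      then show "(z has_vector_derivative hl_deriv a z t) (at t within {b..x})"
        using \<open>a \<le> b\<close> by (intro has_vector_derivative_within_subset[OF twice_acD(1)[OF z]]) auto
    qed (use that in auto)
    then have "cmod (z x - z b) \<le> M * measure lborel {b..x}"
      using Mz that M0 by (intro has_integral_bound[of M "hl_deriv a z" "z x - z b" b x, unfolded cbox_interval]) auto
    then show ?thesis using that zb by simp
  qed
  show thesis
  \<comment> \<open>The expression is at most \<open>M + 90 * M / \<epsilon>\<close> with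
    \<open>90 = 2 * 9 + 72\<close>; times \<open>M * \<epsilon>\<close> this is at most
    \<open>91 * M\<^sup>2\<close>. The summand \<open>M\<close> serves the first bound.\<close>
  proof (rule that[of "M + 91 * M\<^sup>2"])
    show "M + 91 * M\<^sup>2 \<ge> 0" using M0 by simp
    fix \<epsilon> x :: real assume e: "0 < \<epsilon>" "\<epsilon> \<le> 1" and x: "x \<in> {b..b + \<epsilon>}"
    have x1: "x \<in> {b..b+1}" using x e by auto
    let ?t = "(x - b) / \<epsilon>"
    have ze: "cmod (z x) \<le> M * \<epsilon>" using zM[OF x1] mult_left_mono[of "x - b" \<epsilon> M] x M0 by auto
    have "cmod (cutoff b \<epsilon> z x) \<le> 1 * (M * \<epsilon>)"
      unfolding cutoff_def norm_mult norm_of_real using ze cutf_bound(1)[of ?t] by (intro mult_mono) auto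
    then have cu: "cmod (cutoff b \<epsilon> z x) \<le> M * \<epsilon>" by simp
    also have "\<dots> \<le> (M + 91 * M\<^sup>2) * \<epsilon>" using e by (intro mult_right_mono) auto
    finally show "cmod (cutoff b \<epsilon> z x) \<le> (M + 91 * M\<^sup>2) * \<epsilon>" .
    have "cmod (lop_cutoff a b \<epsilon> z k x) \<le> cmod (of_real (cutf ?t) * k x)
       + cmod (2 * of_real (cutf1 ?t / \<epsilon>) * hl_deriv a z x) + cmod (of_real (cutf2 ?t / \<epsilon>^2) * z x)"
      unfolding lop_cutoff_def by (meson add_right_mono norm_triangle_ineq4 order_trans)
    also have "\<dots> = \<bar>cutf ?t\<bar> * cmod (k x) + 2 * (\<bar>cutf1 ?t\<bar> / \<epsilon>) * cmod (hl_deriv a z x) + \<bar>cutf2 ?t\<bar> / \<epsilon>^2 * cmod (z x)"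
      using e by (simp add: norm_mult norm_divide norm_power)
    also have "\<dots> \<le> 1 * M + 2 * (9 / \<epsilon>) * M + 72 / \<epsilon>^2 * (M * \<epsilon>)"
      using cutf_bound[of ?t] Mk[OF x1] Mz[OF x1] ze e M0
      by (intro add_mono mult_mono divide_right_mono mult_left_mono) auto
    also have "\<dots> = M + 90 * M / \<epsilon>" using e by (simp add: field_simps power2_eq_square)
    finally have "cmod (lop_cutoff a b \<epsilon> z k x) * cmod (cutoff b \<epsilon> z x) \<le> (M + 90 * M / \<epsilon>) * (M * \<epsilon>)"
      using cu M0 e by (intro mult_mono) auto
    also have "\<dots> = M\<^sup>2 * \<epsilon> + 90 * M\<^sup>2" using e by (simp add: field_simps power2_eq_square)
    also have "\<dots> \<le> M + 91 * M\<^sup>2" using e M0 mult_left_mono[of \<epsilon> 1 "M\<^sup>2"] by simp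
    finally show "cmod (lop_cutoff a b \<epsilon> z k x * cnj (cutoff b \<epsilon> z x)) \<le> M + 91 * M\<^sup>2" by (simp add: norm_mult)
  qed
qed

text \<open>Up to \<open>b\<close> the cut-off is \<open>z\<close> itself, so the error is an
  integral over \<open>{b..b + \<epsilon>}\<close> only. This turns integrals over
  \<open>{a..b}\<close> into limits of inner products of elements of H_+; with \<open>b = a\<close>
  the limits are 0.\<close>

lemma ip_cutoff:
  assumes z: "twice_ac a z" and k: "continuous_on {a..} k" and "a \<le> b" and zb: "z b = 0"
    and lz: "AE x\<in>{a..} in lebesgue. lop a q z x = k x"
  obtains C where "\<forall>\<epsilon>. 0 < \<epsilon> \<longrightarrow> \<epsilon> \<le> 1 \<longrightarrow>
    cmod (ip a (lop a q (cutoff b \<epsilon> z)) (cutoff b \<epsilon> z) - integral {a..b} (\<lambda>x. k x * cnj (z x))) \<le> C * \<epsilon>"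
    "\<forall>\<epsilon> f. 0 < \<epsilon> \<longrightarrow> \<epsilon> \<le> 1 \<longrightarrow> f \<in> L2 a \<longrightarrow>
      cmod (ip a f (cutoff b \<epsilon> z) - integral {a..b} (\<lambda>x. f x * cnj (z x))) \<le> C * \<epsilon> * integral {b..b+1} (\<lambda>x. cmod (f x))"
proof -
  obtain C where C: "C \<ge> 0" "\<And>\<epsilon> x. 0 < \<epsilon> \<Longrightarrow> \<epsilon> \<le> 1 \<Longrightarrow> x \<in> {b..b + \<epsilon>} \<Longrightarrow> cmod (cutoff b \<epsilon> z x) \<le> C * \<epsilon>"
    "\<And>\<epsilon> x. 0 < \<epsilon> \<Longrightarrow> \<epsilon> \<le> 1 \<Longrightarrow> x \<in> {b..b + \<epsilon>} \<Longrightarrow> cmod (lop_cutoff a b \<epsilon> z k x * cnj (cutoff b \<epsilon> z x)) \<le> C"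
    using cutoff_small[OF z k \<open>a \<le> b\<close> zb] by blast
  note cp = cutoff_props[OF z k lz, where b=b]
  have split: "ip a f (cutoff b \<epsilon> z) = integral {a..b} (\<lambda>x. f x * cnj (z x)) + integral {b..b+\<epsilon>} (\<lambda>x. f x * cnj (cutoff b \<epsilon> z x))"
    "(\<lambda>x. f x * cnj (cutoff b \<epsilon> z x)) integrable_on {b..b+\<epsilon>}"
    if e: "0 < \<epsilon>" and f: "f \<in> L2 a" for \<epsilon> f
  proof -
    let ?F = "\<lambda>x. f x * cnj (cutoff b \<epsilon> z x)"
    have w: "cutoff b \<epsilon> z \<in> L2 a" using HplusD(1)[OF cp(1)[OF e]] .
    have z0: "?F x = 0" if "x > b + \<epsilon>" for x using cp(4)[OF e, where x=x] that by simp
    have "?F integrable_on {a..}" by (rule ip_eq_integral(2)[OF f w])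
    then have i: "?F integrable_on {a..b+\<epsilon>}" using integral_Ici_eq(2)[of "b+\<epsilon>" ?F a] z0 by blast
    show "?F integrable_on {b..b+\<epsilon>}" by (rule integrable_on_subinterval[OF i]) (use \<open>a \<le> b\<close> in auto)
    have "ip a f (cutoff b \<epsilon> z) = integral {a..b+\<epsilon>} ?F"
      unfolding ip_eq_integral(1)[OF f w] by (rule integral_Ici_eq(1)) (rule z0)
    also have "\<dots> = integral {a..b} ?F + integral {b..b+\<epsilon>} ?F"
      using \<open>a \<le> b\<close> e i by (intro Henstock_Kurzweil_Integration.integral_combine[symmetric]) auto
    also have "integral {a..b} ?F = integral {a..b} (\<lambda>x. f x * cnj (z x))"
      by (rule integral_cong) (use cp(2)[OF e] in auto)
    finally show "ip a f (cutoff b \<epsilon> z) = integral {a..b} (\<lambda>x. f x * cnj (z x)) + integral {b..b+\<epsilon>} ?F" .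
  qed
  show thesis
  proof (rule that[of C]; intro allI impI)
    fix \<epsilon> :: real assume e: "0 < \<epsilon>" "\<epsilon> \<le> 1"
    have L: "lop_cutoff a b \<epsilon> z k \<in> L2 a"
      by (rule L2_continuous_compact_support[OF cp(7)[OF e(1)], of "b + \<epsilon>"]) (use cp(8)[OF e(1)] in auto)
    have w: "cutoff b \<epsilon> z \<in> L2 a" using HplusD(1)[OF cp(1)[OF e(1)]] .
    have "AE x\<in>{a..} in lebesgue. lop_cutoff a b \<epsilon> z k x = lop a q (cutoff b \<epsilon> z) x"
      using cp(6)[OF e(1)] by eventually_elim auto
    from ip_AE_cong[OF L w this] have "ip a (lop a q (cutoff b \<epsilon> z)) (cutoff b \<epsilon> z) = ip a (lop_cutoff a b \<epsilon> z k) (cutoff b \<epsilon> z)" by simp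
    also have "\<dots> = integral {a..b} (\<lambda>x. lop_cutoff a b \<epsilon> z k x * cnj (z x)) + integral {b..b+\<epsilon>} (\<lambda>x. lop_cutoff a b \<epsilon> z k x * cnj (cutoff b \<epsilon> z x))"
      by (rule split(1)[OF e(1) L])
    also have "integral {a..b} (\<lambda>x. lop_cutoff a b \<epsilon> z k x * cnj (z x)) = integral {a..b} (\<lambda>x. k x * cnj (z x))"
      by (rule integral_cong) (use cp(9)[OF e(1)] in auto)
    finally have eq: "ip a (lop a q (cutoff b \<epsilon> z)) (cutoff b \<epsilon> z) - integral {a..b} (\<lambda>x. k x * cnj (z x)) =
        integral {b..b+\<epsilon>} (\<lambda>x. lop_cutoff a b \<epsilon> z k x * cnj (cutoff b \<epsilon> z x))" by simp
    have "cmod (integral {b..b+\<epsilon>} (\<lambda>x. lop_cutoff a b \<epsilon> z k x * cnj (cutoff b \<epsilon> z x))) \<le> integral {b..b+\<epsilon>} (\<lambda>x. C)"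
      by (rule integral_norm_bound_integral[OF split(2)[OF e(1) L]]) (use C(3)[OF e] in auto)
    then show "cmod (ip a (lop a q (cutoff b \<epsilon> z)) (cutoff b \<epsilon> z) - integral {a..b} (\<lambda>x. k x * cnj (z x))) \<le> C * \<epsilon>"
      using e unfolding eq by (simp add: mult.commute)
  next
    fix \<epsilon> :: real and f assume e: "0 < \<epsilon>" "\<epsilon> \<le> 1" and f: "f \<in> L2 a"
    have fi: "(\<lambda>x. cmod (f x)) integrable_on {b..b+1}"
      using absolutely_integrable_norm[OF L2_locally_absolutely_integrable[OF f \<open>a \<le> b\<close>, of "b+1"]]
      by (simp add: absolutely_integrable_on_def o_def)
    then have fi2: "(\<lambda>x. cmod (f x)) integrable_on {b..b+\<epsilon>}" by (rule integrable_on_subinterval) (use e in auto)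
    have "cmod (integral {b..b+\<epsilon>} (\<lambda>x. f x * cnj (cutoff b \<epsilon> z x))) \<le> integral {b..b+\<epsilon>} (\<lambda>x. C * \<epsilon> * cmod (f x))"
    proof (rule integral_norm_bound_integral[OF split(2)[OF e(1) f]])
      show "(\<lambda>x. C * \<epsilon> * cmod (f x)) integrable_on {b..b+\<epsilon>}" by (rule integrable_on_mult_right[OF fi2])
      fix x assume "x \<in> {b..b+\<epsilon>}"
      from mult_right_mono[OF C(2)[OF e this] norm_ge_zero[of "f x"]]
      show "cmod (f x * cnj (cutoff b \<epsilon> z x)) \<le> C * \<epsilon> * cmod (f x)" by (simp add: norm_mult mult.commute)
    qed
    also have "\<dots> = C * \<epsilon> * integral {b..b+\<epsilon>} (\<lambda>x. cmod (f x))" by simp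
    also have "\<dots> \<le> C * \<epsilon> * integral {b..b+1} (\<lambda>x. cmod (f x))"
      using C(1) e by (intro mult_left_mono integral_subset_le fi fi2) auto
    finally show "cmod (ip a f (cutoff b \<epsilon> z) - integral {a..b} (\<lambda>x. f x * cnj (z x))) \<le> C * \<epsilon> * integral {b..b+1} (\<lambda>x. cmod (f x))"
      unfolding split(1)[OF e(1) f] by simp
  qed
qed

text \<open>Both initial values of a solution of \<open>l(y) = 0\<close> are free, and the cut-off
  starts only at \<open>a\<close>, where value and derivative are retained.\<close>

lemma boundary_data_attained:
  assumes q: "locally_summable a q"
  obtains p k where "p \<in> Hplus a q" "p a = c0" "hl_deriv a p a = c1"
    "\<forall>x\<ge>a+1. p x = 0" "\<forall>x\<ge>a+1. hl_deriv a p x = 0"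
    "AE x\<in>{a..} in lebesgue. lop a q p x = k x" "continuous_on {a..} k" "\<forall>x\<ge>a+1. k x = 0"
proof -
  obtain y where y: "is_solution a q (of_real 0) y" "y a = c0" "hl_deriv a y a = c1"
    using is_solution_exists[OF q] by blast
  note s = is_solution_props[OF y(1)]
  note cp = cutoff_props[OF s(1,3,2) zero_less_one, where b=a]
  show thesis
  proof (rule that)
    show "cutoff a 1 y \<in> Hplus a q" by (rule cp(1))
    show "cutoff a 1 y a = c0" "hl_deriv a (cutoff a 1 y) a = c1" using cp(2)[where x=a] cp(3)[where x=a] y by auto
    show "\<forall>x\<ge>a+1. cutoff a 1 y x = 0" using cp(4) by blast
    show "\<forall>x\<ge>a+1. hl_deriv a (cutoff a 1 y) x = 0"
    proof (intro allI impI)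
      fix x assume "a + 1 \<le> x"
      then show "hl_deriv a (cutoff a 1 y) x = 0" by (intro cp(5)) auto
    qed
    show "AE x\<in>{a..} in lebesgue. lop a q (cutoff a 1 y) x = lop_cutoff a a 1 y (\<lambda>x. of_real 0 * y x) x" by (rule cp(6))
    show "continuous_on {a..} (lop_cutoff a a 1 y (\<lambda>x. of_real 0 * y x))" by (rule cp(7))
    show "\<forall>x\<ge>a+1. lop_cutoff a a 1 y (\<lambda>x. of_real 0 * y x) x = 0" using cp(8) by blast
  qed
qed

section \<open>Green's formula on the half-line and positivity of the energy\<close>

locale halfline_form =
  fixes a :: real and q :: "real \<Rightarrow> real"
  assumes summable: "locally_summable a q"
    and symmetric: "symmetric_on a (Adot_dom a q) (lop a q)"
    and nonneg: "nonneg_on a (Adot_dom a q) (lop a q)"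
begin

abbreviation "H \<equiv> Hplus a q"
abbreviation "L \<equiv> lop a q"
abbreviation "D y \<equiv> hl_deriv a y a"

lemma Green:
  assumes y: "y \<in> H" and z: "z \<in> H"
  shows "ip a (L y) z - ip a y (L z) = D y * cnj (z a) - y a * cnj (D z)"
proof -
  define B where "B y z = ip a (L y) z - ip a y (L z)" for y z
  define W where "W y z = D y * cnj (z a) - y a * cnj (D z)" for y z
  have Bsym: "B z y = - cnj (B y z)" for y z by (simp add: B_def ip_cnj[of a y "L z"] ip_cnj[of a "L y" z])
  have Wsym: "W z y = - cnj (W y z)" for y z by (simp add: W_def)
  have Blin: "B (\<lambda>x. 1 * f x + (- 1) * g x) h = B f h - B g h" if "f \<in> H" "g \<in> H" "h \<in> H" for f g h
    unfolding B_def Hplus_lincomb(3)[OF that(1,2) HplusD(1)[OF that(3)]]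
      ip_lincomb_left[OF HplusD(1)[OF that(1)] HplusD(1)[OF that(2)] HplusD(3)[OF that(3)]] by simp
  obtain p k where p: "p \<in> H" "p a = y a" "D p = D y" "\<forall>x\<ge>a+1. p x = 0" "\<forall>x\<ge>a+1. hl_deriv a p x = 0"
    "AE x\<in>{a..} in lebesgue. L p x = k x" "continuous_on {a..} k" "\<forall>x\<ge>a+1. k x = 0"
    by (rule boundary_data_attained[OF summable, of "y a" "D y"])
  obtain r j where r: "r \<in> H" "r a = z a" "D r = D z" "\<forall>x\<ge>a+1. r x = 0" "\<forall>x\<ge>a+1. hl_deriv a r x = 0"
    "AE x\<in>{a..} in lebesgue. L r x = j x" "continuous_on {a..} j" "\<forall>x\<ge>a+1. j x = 0"
    by (rule boundary_data_attained[OF summable, of "z a" "D z"])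
  have Bp: "B f p = W f p" if "f \<in> H" for f
    unfolding B_def W_def
  proof (rule Green_compact_support[OF summable that p(1), of "a + 1"])
    show "AE x\<in>{a..} in lebesgue. a + 1 < x \<longrightarrow> L p x = 0" using p(6) by eventually_elim (use p(8) in auto)
  qed (use p in auto)
  have Br: "B f r = W f r" if "f \<in> H" for f
    unfolding B_def W_def
  proof (rule Green_compact_support[OF summable that r(1), of "a + 1"])
    show "AE x\<in>{a..} in lebesgue. a + 1 < x \<longrightarrow> L r x = 0" using r(6) by eventually_elim (use r(8) in auto)
  qed (use r in auto)
  let ?y0 = "\<lambda>x. 1 * y x + (- 1) * p x" and ?z0 = "\<lambda>x. 1 * z x + (- 1) * r x"
  have y0: "?y0 \<in> H" "?y0 \<in> Adot_dom a q"
    using Hplus_lincomb(1,2)[OF y p(1), of 1 "- 1"] p by (auto simp: Adot_dom_def)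
  have z0: "?z0 \<in> H" "?z0 \<in> Adot_dom a q"
    using Hplus_lincomb(1,2)[OF z r(1), of 1 "- 1"] r by (auto simp: Adot_dom_def)
  \<comment> \<open>The corrected functions lie in the domain of the minimal operator. Expanding
    \<open>B\<close> expresses \<open>B y z\<close> through terms with one argument among
    \<open>p\<close> and \<open>r\<close>, where the formula is known by compact support.\<close>
  have "0 = B ?y0 ?z0" using symmetric y0(2) z0(2) unfolding B_def symmetric_on_def by simp
  also have "\<dots> = B y ?z0 - B p ?z0" by (rule Blin[OF y p(1) z0(1)])
  also have "B y ?z0 = - cnj (B ?z0 y)" by (rule Bsym)
  also have "B ?z0 y = B z y - B r y" by (rule Blin[OF z r(1) y])
  also have "B p ?z0 = - cnj (B ?z0 p)" by (rule Bsym)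
  also have "B ?z0 p = B z p - B r p" by (rule Blin[OF z r(1) p(1)])
  finally have "B y z = - cnj (B r y) - cnj (B z p) + cnj (B r p)"
    using Bsym[of y z] by (simp add: algebra_simps)
  also have "\<dots> = W y r - cnj (W z p) + cnj (W r p)"
    using Bsym[of r y] Br[OF y] Bp[OF z] Bp[OF r(1)] by simp
  also have "\<dots> = W y z" using p r by (simp add: W_def algebra_simps)
  finally show ?thesis by (simp add: B_def W_def)
qed

text \<open>Integration by parts shows that \<open>E y y\<close> is the energy, the integral of \<open>|y'|\<^sup>2 + q |y|\<^sup>2\<close>; this form of it
  needs no integrability of the single terms.\<close>

definition E :: "cfun \<Rightarrow> cfun \<Rightarrow> complex" where
  "E y z = ip a (L y) z - D y * cnj (z a)"

definition Q :: "cfun \<Rightarrow> real" where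
  "Q y = Re (E y y)"

text \<open>Subtracting the boundary term \<open>D y * cnj (z a)\<close> removes exactly the
  asymmetry that Green's formula exhibits.\<close>

lemma E_hermitian: "y \<in> H \<Longrightarrow> z \<in> H \<Longrightarrow> E z y = cnj (E y z)"
proof -
  assume "y \<in> H" "z \<in> H"
  then have "ip a (L y) z = ip a y (L z) + (D y * cnj (z a) - y a * cnj (D z))" using Green[of y z] by (simp add: algebra_simps)
  then show ?thesis unfolding E_def by (simp add: ip_cnj[of a y "L z"])
qed

lemma E_self: "y \<in> H \<Longrightarrow> ip a (L y) y = of_real (Q y) + D y * cnj (y a)"
proof -
  assume "y \<in> H"
  then have "Im (E y y) = 0" using E_hermitian[of y y] by (metis Reals_cnj_iff complex_is_Real_iff)
  then have "E y y = of_real (Q y)" by (simp add: Q_def complex_eq_iff)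
  then show ?thesis by (simp add: E_def algebra_simps)
qed

lemma E_lincomb: "f \<in> H \<Longrightarrow> g \<in> H \<Longrightarrow> h \<in> H \<Longrightarrow> E (\<lambda>x. c * f x + d * g x) h = c * E f h + d * E g h"
  using Hplus_lincomb(2,3)[of f a q g] HplusD(1)[of h] by (simp add: E_def algebra_simps)

lemma Q_lincomb:
  assumes f: "f \<in> H" and g: "g \<in> H"
  shows "Q (\<lambda>x. c * f x + d * g x) = (cmod c)\<^sup>2 * Q f + (cmod d)\<^sup>2 * Q g + 2 * Re (c * cnj d * E f g)"
proof -
  let ?y = "\<lambda>x. c * f x + d * g x"
  have y: "?y \<in> H" by (rule Hplus_lincomb(1)[OF f g])
  have "E f ?y = cnj c * E f f + cnj d * E f g"
    using E_hermitian[OF y f] E_lincomb[OF f g f, of c d] E_hermitian[OF f f] E_hermitian[OF f g] by simp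
  moreover have "E g ?y = cnj c * cnj (E f g) + cnj d * E g g"
    using E_hermitian[OF y g] E_lincomb[OF f g g, of c d] E_hermitian[OF g g] E_hermitian[OF f g] by simp
  ultimately have "E ?y ?y = (c * cnj c) * E f f + (d * cnj d) * E g g + (c * cnj d * E f g + cnj (c * cnj d * E f g))"
    using E_lincomb[OF f g y, of c d] by (simp add: algebra_simps)
  moreover have "c * cnj c = of_real ((cmod c)\<^sup>2)" "d * cnj d = of_real ((cmod d)\<^sup>2)"
    by (simp_all only: complex_norm_square)
  moreover have "Re (of_real r * A + of_real s * B + (t + cnj t)) = r * Re A + s * Re B + 2 * Re t" for r s A B t
    by simp
  ultimately show ?thesis by (simp only: Q_def)
qed

lemma inverse_Suc_bounds: "0 < inverse (real (Suc n))" "inverse (real (Suc n)) \<le> 1"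
  by (auto simp: field_simps)

text \<open>Adding multiples of these functions changes \<open>y'(a)\<close> at no cost in energy.\<close>

lemma unit_derivative_sequence:
  obtains z :: "nat \<Rightarrow> cfun" where "\<And>n. z n \<in> H" "\<And>n. z n a = 0" "\<And>n. D (z n) = 1"
    "(\<lambda>n. Q (z n)) \<longlonglongrightarrow> 0" "\<And>f. f \<in> L2 a \<Longrightarrow> (\<lambda>n. ip a f (z n)) \<longlonglongrightarrow> 0"
proof -
  obtain y where y: "is_solution a q (of_real 0) y" "y a = 0" "D y = 1"
    using is_solution_exists[OF summable] by blast
  note s = is_solution_props[OF y(1)]
  obtain C where C: "\<forall>\<epsilon>. 0 < \<epsilon> \<longrightarrow> \<epsilon> \<le> 1 \<longrightarrow>
    cmod (ip a (L (cutoff a \<epsilon> y)) (cutoff a \<epsilon> y) - integral {a..a} (\<lambda>x. of_real 0 * y x * cnj (y x))) \<le> C * \<epsilon>"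
    "\<forall>\<epsilon> f. 0 < \<epsilon> \<longrightarrow> \<epsilon> \<le> 1 \<longrightarrow> f \<in> L2 a \<longrightarrow>
      cmod (ip a f (cutoff a \<epsilon> y) - integral {a..a} (\<lambda>x. f x * cnj (y x))) \<le> C * \<epsilon> * integral {a..a+1} (\<lambda>x. cmod (f x))"
    by (rule ip_cutoff[OF s(1,3) order_refl y(2) s(2)])
  define z where "z n = cutoff a (inverse (real (Suc n))) y" for n
  note cp = cutoff_props[OF s(1,3,2), where b=a]
  have zn: "z n \<in> H" "z n a = 0" "D (z n) = 1" for n
    using cp(1)[OF inverse_Suc_bounds(1)[of n]] cp(2,3)[OF inverse_Suc_bounds(1)[of n], where x=a] y unfolding z_def by simp_all
  show thesis
  proof (rule that[OF zn])
    have "(\<lambda>n. C * inverse (real (Suc n))) \<longlonglongrightarrow> C * 0" by (intro tendsto_mult tendsto_const LIMSEQ_inverse_real_of_nat)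
    then have lim: "(\<lambda>n. C * inverse (real (Suc n))) \<longlonglongrightarrow> 0" by simp
    have "(\<lambda>n. ip a (L (z n)) (z n)) \<longlonglongrightarrow> 0"
      by (rule Lim_null_comparison[OF _ lim]) (use C(1)[rule_format, OF inverse_Suc_bounds] in \<open>auto simp: z_def\<close>)
    from tendsto_Re[OF this] show "(\<lambda>n. Q (z n)) \<longlonglongrightarrow> 0" using zn by (simp add: Q_def E_def)
    fix f assume f: "f \<in> L2 a"
    have "(\<lambda>n. C * inverse (real (Suc n)) * integral {a..a+1} (\<lambda>x. cmod (f x))) \<longlonglongrightarrow> 0 * integral {a..a+1} (\<lambda>x. cmod (f x))"
      by (intro tendsto_mult tendsto_const lim)
    then have lim2: "(\<lambda>n. C * inverse (real (Suc n)) * integral {a..a+1} (\<lambda>x. cmod (f x))) \<longlonglongrightarrow> 0" by simp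
    show "(\<lambda>n. ip a f (z n)) \<longlonglongrightarrow> 0"
      by (rule Lim_null_comparison[OF _ lim2]) (use C(2)[rule_format, OF inverse_Suc_bounds f] in \<open>auto simp: z_def\<close>)
  qed
qed

text \<open>The hypothesis on the minimal operator also asks for \<open>D y = 0\<close>. Subtracting
  \<open>D y\<close> times the unit derivative sequence arranges this, and the energy of the
  corrected functions tends to \<open>Q y\<close>.\<close>

lemma Q_nonneg:
  assumes y: "y \<in> H" and "y a = 0"
  shows "Q y \<ge> 0"
proof -
  obtain z where z: "\<And>n. z n \<in> H" "\<And>n. z n a = 0" "\<And>n. D (z n) = 1"
    "(\<lambda>n. Q (z n)) \<longlonglongrightarrow> 0" "\<And>f. f \<in> L2 a \<Longrightarrow> (\<lambda>n. ip a f (z n)) \<longlonglongrightarrow> 0"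
    by (rule unit_derivative_sequence) (rule that)
  \<comment> \<open>The values \<open>z n a\<close> vanish, so no boundary term remains and the
    mixed terms tend to 0 as well.\<close>
  have Ez: "E y (z n) = ip a (L y) (z n)" for n using z(2) by (simp add: E_def)
  let ?w = "\<lambda>n x. 1 * y x + (- D y) * z n x"
  have "Q (?w n) \<ge> 0" for n
  proof -
    have "?w n \<in> Adot_dom a q"
      using Hplus_lincomb(1,2)[OF y z(1)[of n], of 1 "- D y"] z(2,3) \<open>y a = 0\<close> by (simp add: Adot_dom_def)
    then have "0 \<le> Re (ip a (L (?w n)) (?w n))" using nonneg by (auto simp: nonneg_on_def)
    then show ?thesis using z(2) \<open>y a = 0\<close> by (simp add: Q_def E_def)
  qed
  moreover have "(\<lambda>n. Q (?w n)) \<longlonglongrightarrow> (cmod 1)\<^sup>2 * Q y + (cmod (- D y))\<^sup>2 * 0 + 2 * Re (1 * cnj (- D y) * 0)"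
    unfolding Q_lincomb[OF y z(1)] Ez
    by (intro tendsto_intros z(4) z(5)[OF HplusD(3)[OF y]])
  ultimately show ?thesis by (intro LIMSEQ_le_const[of "\<lambda>n. Q (?w n)"]) auto
qed

text \<open>Cut-offs beyond \<open>b\<close> are elements of H_+ vanishing at \<open>a\<close>.
  Their non-negative energies converge to the integral over \<open>{a..b}\<close>.\<close>

lemma Dirichlet_nonneg:
  assumes z: "twice_ac a z" and k: "continuous_on {a..} k" and "a \<le> b" and zb: "z b = 0" "z a = 0"
    and lz: "AE x\<in>{a..} in lebesgue. L z x = k x"
  shows "Re (integral {a..b} (\<lambda>x. k x * cnj (z x))) \<ge> 0"
proof -
  let ?I = "integral {a..b} (\<lambda>x. k x * cnj (z x))"
  obtain C where C: "\<forall>\<epsilon>. 0 < \<epsilon> \<longrightarrow> \<epsilon> \<le> 1 \<longrightarrow> cmod (ip a (L (cutoff b \<epsilon> z)) (cutoff b \<epsilon> z) - ?I) \<le> C * \<epsilon>"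
    by (rule ip_cutoff[OF z k \<open>a \<le> b\<close> zb(1) lz])
  let ?w = "\<lambda>n. cutoff b (inverse (real (Suc n))) z"
  note cp = cutoff_props[OF z k lz, where b=b]
  have "Re (ip a (L (?w n)) (?w n)) \<ge> 0" for n
  proof -
    have w: "?w n a = 0" using cp(2)[OF inverse_Suc_bounds(1)[of n], where x=a] \<open>a \<le> b\<close> zb(2) by simp
    show ?thesis using Q_nonneg[OF cp(1)[OF inverse_Suc_bounds(1)] w] unfolding Q_def E_def w by simp
  qed
  moreover have "(\<lambda>n. ip a (L (?w n)) (?w n)) \<longlonglongrightarrow> ?I"
  proof (rule Lim_transform2)
    have "(\<lambda>n. C * inverse (real (Suc n))) \<longlonglongrightarrow> C * 0" by (intro tendsto_mult tendsto_const LIMSEQ_inverse_real_of_nat)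
    then have lim: "(\<lambda>n. C * inverse (real (Suc n))) \<longlonglongrightarrow> 0" by simp
    show "(\<lambda>n. ?I - ip a (L (?w n)) (?w n)) \<longlonglongrightarrow> 0"
      by (rule Lim_null_comparison[OF _ lim]) (use C[rule_format, OF inverse_Suc_bounds] in \<open>auto simp: norm_minus_commute\<close>)
  qed simp
  ultimately show ?thesis by (intro LIMSEQ_le_const[OF tendsto_Re]) auto
qed

end

section \<open>Weyl solutions below the spectrum\<close>

lemma integrable_Ici_nonneg:
  fixes F :: "real \<Rightarrow> real"
  assumes c: "continuous_on {a..} F" and nn: "\<And>x. F x \<ge> 0" and B: "\<And>b. a \<le> b \<Longrightarrow> integral {a..b} F \<le> B"
  shows "F integrable_on {a..}"
proof -
  define f where "f k x = (if x \<le> a + real k then F x else 0)" for k :: nat and x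
  have z: "f k x = 0" if "x > a + real k" for k x using that by (simp add: f_def)
  have i: "F integrable_on {a..a + real k}" for k
    by (rule integrable_continuous_interval[OF continuous_on_subset[OF c]]) auto
  have eq: "f k integrable_on {a..a + real k}" "integral {a..a + real k} (f k) = integral {a..a + real k} F" for k
    using integrable_cong[of "{a..a + real k}" "f k" F] i integral_cong[of "{a..a + real k}" "f k" F] by (auto simp: f_def)
  have "F integrable_on {a..} \<and> ((\<lambda>k. integral {a..} (f k)) \<longlongrightarrow> integral {a..} F) sequentially"
  proof (rule monotone_convergence_increasing)
    show "f k integrable_on {a..}" for k using eq(1) integral_Ici_eq(2)[of "a + real k" "f k" a] z by blast
    show "f k x \<le> f (Suc k) x" for k x using nn[of x] by (auto simp: f_def)
    show "(\<lambda>k. f k x) \<longlonglongrightarrow> F x" for x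
    proof (rule tendsto_eventually)
      obtain N where "x - a \<le> real N" using real_arch_simple by blast
      then show "\<forall>\<^sub>F k in sequentially. f k x = F x"
        unfolding eventually_sequentially by (intro exI[of _ N]) (auto simp: f_def)
    qed
    have "integral {a..} (f k) = integral {a..a + real k} F" for k
      using integral_Ici_eq(1)[of "a + real k" "f k" a] z eq(2) by simp
    moreover have "0 \<le> integral {a..a + real k} F" for k using nn i by (intro integral_nonneg) auto
    ultimately show "bounded (range (\<lambda>k. integral {a..} (f k)))"
      using B[of "a + real _"] by (intro boundedI[of _ B]) auto
  qed
  then show ?thesis by simp
qed

lemma cmod_add_sq_le: "(cmod (x + y))\<^sup>2 \<le> 2 * (cmod x)\<^sup>2 + 2 * (cmod y)\<^sup>2"
proof -
  have "(cmod (x + y))\<^sup>2 \<le> (cmod x + cmod y)\<^sup>2" by (intro power_mono norm_triangle_ineq) auto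
  also have "\<dots> \<le> 2 * (cmod x)\<^sup>2 + 2 * (cmod y)\<^sup>2"
    using sum_squares_bound[of "cmod x" "cmod y"] by (simp add: power2_sum)
  finally show ?thesis .
qed

lemma continuous_sq_integrable:
  assumes "continuous_on {a..} (f :: cfun)" "a \<le> c"
  shows "(\<lambda>x. (cmod (f x))\<^sup>2) integrable_on {c..d}"
  by (intro integrable_continuous_interval continuous_intros continuous_on_subset[OF assms(1)]) (use assms(2) in auto)

lemma integral_sq_add_le:
  fixes f g :: cfun
  assumes "continuous_on {a..} f" "continuous_on {a..} g"
  shows "sq_norm_on {a..b} (\<lambda>x. f x + g x) \<le> 2 * sq_norm_on {a..b} f + 2 * sq_norm_on {a..b} g"
proof -
  note f = continuous_sq_integrable[OF assms(1) order_refl, of b] and g = continuous_sq_integrable[OF assms(2) order_refl, of b]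
  have fg: "(\<lambda>x. (cmod (f x + g x))\<^sup>2) integrable_on {a..b}"
    by (rule continuous_sq_integrable[OF _ order_refl]) (intro continuous_intros assms)
  have "sq_norm_on {a..b} (\<lambda>x. f x + g x) \<le> integral {a..b} (\<lambda>x. 2 * (cmod (f x))\<^sup>2 + 2 * (cmod (g x))\<^sup>2)"
    by (rule integral_le[OF fg]) (intro integrable_add integrable_on_mult_right f g, rule cmod_add_sq_le)
  also have "\<dots> = 2 * sq_norm_on {a..b} f + 2 * sq_norm_on {a..b} g"
    by (subst integral_add) (auto intro: integrable_on_mult_right f g)
  finally show ?thesis .
qed

context halfline_form
begin

lemma phi_props:
  "is_solution a q (of_real l) (phi1 a q (of_real l))" "phi1 a q (of_real l) a = 0" "D (phi1 a q (of_real l)) = 1"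
  "is_solution a q (of_real l) (phi2 a q (of_real l))" "phi2 a q (of_real l) a = - 1" "D (phi2 a q (of_real l)) = 0"
proof -
  have "\<exists>y. is_solution a q (of_real l) y \<and> y a = 0 \<and> D y = 1" by (rule is_solution_exists[OF summable]) blast
  from someI_ex[OF this] show "is_solution a q (of_real l) (phi1 a q (of_real l))" "phi1 a q (of_real l) a = 0" "D (phi1 a q (of_real l)) = 1"
    by (auto simp: phi1_def)
  have "\<exists>y. is_solution a q (of_real l) y \<and> y a = - 1 \<and> D y = 0" by (rule is_solution_exists[OF summable]) blast
  from someI_ex[OF this] show "is_solution a q (of_real l) (phi2 a q (of_real l))" "phi2 a q (of_real l) a = - 1" "D (phi2 a q (of_real l)) = 0"
    by (auto simp: phi2_def)
qed

lemma phi1_integral_pos: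
  assumes "a < b"
  shows "sq_norm_on {a..b} (phi1 a q (of_real l)) > 0"
proof -
  let ?y = "phi1 a q (of_real l)"
  note y = is_solution_props[OF phi_props(1)[of l]]
  have c: "continuous_on {a..b} (\<lambda>x. (cmod (?y x))\<^sup>2)"
    by (intro continuous_intros continuous_on_subset[OF twice_acD(4)[OF y(1)]]) auto
  have "sq_norm_on {a..b} ?y \<noteq> 0"
  proof
    assume "sq_norm_on {a..b} ?y = 0"
    then have y0: "?y x = 0" if "x \<in> {a..b}" for x
      using integral_eq_0_iff[OF c assms] that by simp
    have "(?y has_vector_derivative 0) (at a within {a..b})"
      by (rule has_vector_derivative_transform[OF _ _ has_vector_derivative_const[of 0]]) (use y0 assms in auto)
    then have "(?y has_vector_derivative 0) (at a within {a..})" using assms by (simp add: at_within_Icc_Ici)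
    then have "D ?y = 0" by (intro hl_deriv_eqI) auto
    then show False using phi_props(3)[of l] by simp
  qed
  moreover have "sq_norm_on {a..b} ?y \<ge> 0"
    by (rule integral_nonneg[OF integrable_continuous_interval[OF c]]) auto
  ultimately show ?thesis by simp
qed

text \<open>A zero at \<open>b\<close> would make \<open>phi1\<close> a Dirichlet eigenfunction on
  \<open>{a..b}\<close> with the negative eigenvalue \<open>l\<close>.\<close>

lemma phi1_nonzero:
  assumes "l < 0" "a < b"
  shows "phi1 a q (of_real l) b \<noteq> 0"
proof
  let ?y = "phi1 a q (of_real l)"
  assume "?y b = 0"
  note y = is_solution_props[OF phi_props(1)[of l]]
  have "0 \<le> Re (integral {a..b} (\<lambda>x. of_real l * ?y x * cnj (?y x)))"
    using \<open>?y b = 0\<close> assms phi_props(2)[of l] by (intro Dirichlet_nonneg y) auto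
  also have "(\<lambda>x. of_real l * ?y x * cnj (?y x)) = (\<lambda>x. of_real (l * (cmod (?y x))\<^sup>2))"
    by (simp only: of_real_mult complex_norm_square mult.assoc)
  also have "integral {a..b} \<dots> = of_real (integral {a..b} (\<lambda>x. l * (cmod (?y x))\<^sup>2))"
    using integral_linear[OF integrable_on_mult_right[OF continuous_sq_integrable[OF twice_acD(4)[OF y(1)] order_refl]] bounded_linear_of_real, of b l]
    by (simp only: o_def)
  finally have "0 \<le> l * sq_norm_on {a..b} ?y" by simp
  then show False using phi1_integral_pos[OF \<open>a < b\<close>, of l] \<open>l < 0\<close> by (simp add: zero_le_mult_iff)
qed

text \<open>The norm bound \<open>1 / \<bar>l\<bar>\<close> for the resolvent of the non-negative
  Dirichlet operator on \<open>{a..b}\<close>. What matters later is that it is independent of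
  \<open>b\<close>.\<close>

lemma Dirichlet_resolvent_bound:
  assumes "l < 0" "a \<le> b" and z: "twice_ac a z" and f: "continuous_on {a..} f" and zb: "z b = 0" "z a = 0"
    and lz: "AE x\<in>{a..} in lebesgue. L z x = of_real l * z x + f x"
  shows "l\<^sup>2 * sq_norm_on {a..b} z \<le> sq_norm_on {a..b} f"
proof -
  note zc = twice_acD(4)[OF z]
  have cz: "continuous_on {a..b} z" and cf: "continuous_on {a..b} f" using zc f by (auto intro: continuous_on_subset)
  let ?F = "\<lambda>x. (of_real l * z x + f x) * cnj (z x)"
  have Fi: "?F integrable_on {a..b}" by (intro integrable_continuous_interval continuous_intros cz cf)
  have "0 \<le> Re (integral {a..b} ?F)"
    by (intro Dirichlet_nonneg[OF z _ \<open>a \<le> b\<close> zb lz] continuous_intros zc f)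
  also have "\<dots> = integral {a..b} (\<lambda>x. Re (?F x))"
    using integral_linear[OF Fi bounded_linear_Re] by (simp only: o_def)
  also have "\<dots> \<le> integral {a..b} (\<lambda>x. l / 2 * (cmod (z x))\<^sup>2 + 1 / (- 2 * l) * (cmod (f x))\<^sup>2)"
  proof (rule integral_le)
    show "(\<lambda>x. Re (?F x)) integrable_on {a..b}" by (intro integrable_continuous_interval continuous_intros cz cf)
    show "(\<lambda>x. l / 2 * (cmod (z x))\<^sup>2 + 1 / (- 2 * l) * (cmod (f x))\<^sup>2) integrable_on {a..b}"
      by (intro integrable_continuous_interval continuous_intros cz cf)
    fix x
    have e: "?F x = of_real (l * (cmod (z x))\<^sup>2) + f x * cnj (z x)"
      by (simp only: of_real_mult complex_norm_square distrib_right mult.assoc)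
    have "Re (?F x) = l * (cmod (z x))\<^sup>2 + Re (f x * cnj (z x))" unfolding e by simp
    also have "Re (f x * cnj (z x)) \<le> cmod (f x) * cmod (z x)" by (metis complex_Re_le_cmod norm_mult complex_mod_cnj)
    also have "cmod (f x) * cmod (z x) \<le> - l / 2 * (cmod (z x))\<^sup>2 + 1 / (- 2 * l) * (cmod (f x))\<^sup>2"
    proof -
      \<comment> \<open>Completing the square with this weight spends half of
        \<open>l * (cmod (z x))\<^sup>2\<close>; the other half yields the bound.\<close>
      have "0 \<le> (- l * cmod (z x) - cmod (f x))\<^sup>2 / (- 2 * l)" using \<open>l < 0\<close> by (intro divide_nonneg_pos) auto
      also have "\<dots> = - l / 2 * (cmod (z x))\<^sup>2 + 1 / (- 2 * l) * (cmod (f x))\<^sup>2 - cmod (f x) * cmod (z x)"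
        using \<open>l < 0\<close> by (simp add: power2_eq_square field_simps)
      finally show ?thesis by simp
    qed
    finally show "Re (?F x) \<le> l / 2 * (cmod (z x))\<^sup>2 + 1 / (- 2 * l) * (cmod (f x))\<^sup>2" by simp
  qed
  also have "\<dots> = l / 2 * sq_norm_on {a..b} z + 1 / (- 2 * l) * sq_norm_on {a..b} f"
  proof -
    have "(\<lambda>x. l / 2 * (cmod (z x))\<^sup>2) integrable_on {a..b}" "(\<lambda>x. 1 / (- 2 * l) * (cmod (f x))\<^sup>2) integrable_on {a..b}"
      by (intro integrable_continuous_interval continuous_intros cz cf)+
    from integral_add[OF this] show ?thesis by simp
  qed
  finally show ?thesis using \<open>l < 0\<close> by (simp add: field_simps power2_eq_square)
qed

text \<open>The solutions with value \<open>- 1\<close> at \<open>a\<close> that vanish at \<open>b\<close> are bounded in \<open>L\<^sub>2\<close> uniformly in \<open>b\<close>, so a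
  limit point as \<open>b\<close> grows is square integrable.\<close>

lemma Weyl_solution_exists:
  assumes "l < 0"
  obtains m where "(\<lambda>x. phi2 a q (of_real l) x + m * phi1 a q (of_real l) x) \<in> L2 a"
proof -
  let ?f1 = "phi1 a q (of_real l)" and ?f2 = "phi2 a q (of_real l)"
  note f1 = is_solution_props[OF phi_props(1)[of l]] and f2 = is_solution_props[OF phi_props(4)[of l]]
  note c1 = twice_acD(4)[OF f1(1)] and c2 = twice_acD(4)[OF f2(1)]
  \<comment> \<open>Subtracting a fixed \<open>p\<close> with value \<open>- 1\<close> at
    \<open>a\<close> gives homogeneous Dirichlet data at both ends. The source term of the
    difference is \<open>l * p - k\<close>, the \<open>f\<close> below, which vanishes beyond
    \<open>a + 1\<close> and does not depend on \<open>b\<close>.\<close>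
  obtain p k where p: "p \<in> H" "p a = - 1" "D p = 0" "\<forall>x\<ge>a+1. p x = 0" "\<forall>x\<ge>a+1. hl_deriv a p x = 0"
    "AE x\<in>{a..} in lebesgue. L p x = k x" "continuous_on {a..} k" "\<forall>x\<ge>a+1. k x = 0"
    by (rule boundary_data_attained[OF summable])
  note pt = HplusD(2)[OF p(1)]
  note cp = twice_acD(4)[OF pt]
  define f where "f x = of_real l * p x - k x" for x
  have cf: "continuous_on {a..} f" unfolding f_def by (intro continuous_intros cp p(7))
  \<comment> \<open>The coefficient for which \<open>phi2 + m b * phi1\<close> vanishes at
    \<open>b\<close>.\<close>
  define m where "m b = - ?f2 b / ?f1 b" for b
  define \<psi> where "\<psi> c x = ?f2 x + c * ?f1 x" for c x
  have c\<psi>: "continuous_on {a..} (\<psi> c)" for c unfolding \<psi>_def by (intro continuous_intros c1 c2)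
  have tail: "sq_norm_on {a..b} g = sq_norm_on {a..a+1} g"
    if "b \<ge> a + 1" "\<forall>x\<ge>a+1. g x = 0" for g :: cfun and b
    using integral_Ici_eq(1)[of "a+1" "\<lambda>x. (cmod (g x))\<^sup>2" a] integral_Ici_eq(1)[of b "\<lambda>x. (cmod (g x))\<^sup>2" a] that by simp
  define C where "C = 2 * (sq_norm_on {a..a+1} f / l\<^sup>2) + 2 * sq_norm_on {a..a+1} p"
  have bound: "sq_norm_on {a..b} (\<psi> (m b)) \<le> C" if b: "b \<ge> a + 1" for b
  proof -
    let ?z = "\<lambda>x. 1 * \<psi> (m b) x + (- 1) * p x"
    have \<psi>e: "\<psi> (m b) = (\<lambda>x. 1 * ?f2 x + m b * ?f1 x)" by (auto simp: \<psi>_def)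
    have \<psi>t: "twice_ac a (\<psi> (m b))" unfolding \<psi>e by (rule twice_ac_lincomb(1)[OF f2(1) f1(1)])
    have zt: "twice_ac a ?z" by (rule twice_ac_lincomb(1)[OF \<psi>t pt])
    have "?f1 b \<noteq> 0" using phi1_nonzero[OF \<open>l < 0\<close>, of b] b by simp
    then have zb: "?z b = 0" using p(4) b by (simp add: \<psi>_def m_def)
    have za: "?z a = 0" using p(2) phi_props(2,5)[of l] by (simp add: \<psi>_def)
    have "AE x\<in>{a..} in lebesgue. L ?z x = of_real l * ?z x + f x"
      using twice_ac_lincomb(3)[OF \<psi>t pt, where c=1 and d="- 1" and q=q]
        twice_ac_lincomb(3)[OF f2(1) f1(1), where c=1 and d="m b" and q=q, folded \<psi>e] p(6) f1(2) f2(2)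
      by eventually_elim (auto simp: \<psi>_def f_def algebra_simps)
    from Dirichlet_resolvent_bound[OF \<open>l < 0\<close> _ zt cf zb za this] b
    have "l\<^sup>2 * sq_norm_on {a..b} ?z \<le> sq_norm_on {a..a+1} f"
      using tail[OF b, of f] p(4,8) by (simp add: f_def)
    then have zC: "sq_norm_on {a..b} ?z \<le> sq_norm_on {a..a+1} f / l\<^sup>2"
      using \<open>l < 0\<close> by (simp add: field_simps)
    have "sq_norm_on {a..b} (\<psi> (m b)) = sq_norm_on {a..b} (\<lambda>x. ?z x + p x)" by simp
    also have "\<dots> \<le> 2 * sq_norm_on {a..b} ?z + 2 * sq_norm_on {a..b} p"
      by (rule integral_sq_add_le[OF twice_acD(4)[OF zt] cp])
    also have "\<dots> \<le> C" using zC tail[OF b p(4)] by (simp add: C_def)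
    finally show ?thesis .
  qed
  have bound': "sq_norm_on {a..c} (\<psi> (m b)) \<le> C" if "b \<ge> a + 1" "c \<le> b" for b c
  proof -
    have "sq_norm_on {a..c} (\<psi> (m b)) \<le> sq_norm_on {a..b} (\<psi> (m b))"
      using that by (intro integral_subset_le continuous_sq_integrable[OF c\<psi>]) auto
    then show ?thesis using bound[OF that(1)] by simp
  qed
  have sc: "sq_norm_on {a..b} (\<lambda>x. c * ?f1 x) = (cmod c)\<^sup>2 * sq_norm_on {a..b} ?f1" for b c
    by (simp add: norm_mult power_mult_distrib)
  define I1 where "I1 = sq_norm_on {a..a+1} ?f1"
  define I2 where "I2 = sq_norm_on {a..a+1} (\<lambda>x. - ?f2 x)"
  have "I1 > 0" unfolding I1_def by (rule phi1_integral_pos) simp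
  \<comment> \<open>The bound on \<open>{a..a+1}\<close> also controls the coefficients, because
    \<open>phi1\<close> has positive norm there; hence a convergent subsequence.\<close>
  have mb: "(cmod (m b))\<^sup>2 \<le> (2 * C + 2 * I2) / I1" if "b \<ge> a + 1" for b
  proof -
    have "(cmod (m b))\<^sup>2 * I1 = sq_norm_on {a..a+1} (\<lambda>x. \<psi> (m b) x + - ?f2 x)"
      unfolding I1_def sc[symmetric] by (simp add: \<psi>_def)
    also have "\<dots> \<le> 2 * sq_norm_on {a..a+1} (\<psi> (m b)) + 2 * I2"
      unfolding I2_def by (rule integral_sq_add_le[OF c\<psi>]) (intro continuous_intros c2)
    also have "\<dots> \<le> 2 * C + 2 * I2" using bound'[OF that that] by simp
    finally show ?thesis using \<open>I1 > 0\<close> by (simp add: field_simps)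
  qed
  let ?s = "\<lambda>n::nat. m (a + 1 + real n)"
  have "bounded (range ?s)"
  proof (rule boundedI)
    fix x assume "x \<in> range ?s"
    then obtain n where x: "x = ?s n" by blast
    have "(cmod x)\<^sup>2 \<le> (2 * C + 2 * I2) / I1" unfolding x by (rule mb) simp
    then show "norm x \<le> sqrt ((2 * C + 2 * I2) / I1)" by (rule real_le_rsqrt)
  qed
  then obtain m0 r where r: "strict_mono r" "((?s \<circ> r) \<longlonglongrightarrow> m0)"
    using bounded_imp_convergent_subsequence by blast
  \<comment> \<open>For fixed \<open>c\<close> a late member of the subsequence has its zero beyond
    \<open>c\<close> and a coefficient close to \<open>m0\<close>. The doubled squared error is
    below 1, so the bound \<open>2 * C + 1\<close> does not depend on \<open>c\<close>.\<close>
  have lim: "sq_norm_on {a..c} (\<psi> m0) \<le> 2 * C + 1" if "a \<le> c" for c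
  proof -
    define J where "J = sq_norm_on {a..c} ?f1"
    have "(\<lambda>n. 2 * ((cmod (m0 - (?s \<circ> r) n))\<^sup>2 * J)) \<longlonglongrightarrow> 2 * ((cmod (m0 - m0))\<^sup>2 * J)"
      by (intro tendsto_intros r(2))
    then have "\<forall>\<^sub>F n in sequentially. 2 * ((cmod (m0 - (?s \<circ> r) n))\<^sup>2 * J) < 1"
      by (rule order_tendstoD) simp
    moreover have "\<forall>\<^sub>F n in sequentially. c \<le> a + 1 + real n"
    proof -
      obtain N where "c - a - 1 \<le> real N" using real_arch_simple by blast
      then show ?thesis unfolding eventually_sequentially by (intro exI[of _ N]) auto
    qed
    ultimately have "\<forall>\<^sub>F n in sequentially. 2 * ((cmod (m0 - (?s \<circ> r) n))\<^sup>2 * J) < 1 \<and> c \<le> a + 1 + real n"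
      by (rule eventually_conj)
    then obtain n where n: "2 * ((cmod (m0 - ?s (r n)))\<^sup>2 * J) < 1" "c \<le> a + 1 + real n"
      by (auto simp: eventually_sequentially)
    have "real n \<le> real (r n)" using seq_suble[OF r(1), of n] by simp
    then have cn: "c \<le> a + 1 + real (r n)" using n(2) by linarith
    have "sq_norm_on {a..c} (\<psi> m0) = sq_norm_on {a..c} (\<lambda>x. \<psi> (?s (r n)) x + (m0 - ?s (r n)) * ?f1 x)"
      by (simp add: \<psi>_def algebra_simps)
    also have "\<dots> \<le> 2 * sq_norm_on {a..c} (\<psi> (?s (r n))) + 2 * sq_norm_on {a..c} (\<lambda>x. (m0 - ?s (r n)) * ?f1 x)"
      by (rule integral_sq_add_le[OF c\<psi>]) (intro continuous_intros c1)
    also have "\<dots> \<le> 2 * C + 1" using bound'[OF _ cn] n(1) unfolding sc J_def[symmetric] by simp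
    finally show ?thesis .
  qed
  have "(\<lambda>x. (cmod (\<psi> m0 x))\<^sup>2) integrable_on {a..}"
    by (rule integrable_Ici_nonneg[OF _ _ lim]) (auto intro!: continuous_intros c\<psi>)
  then have "(\<lambda>x. (cmod (\<psi> m0 x))\<^sup>2) absolutely_integrable_on {a..}" by (rule nonnegative_absolutely_integrable_1) auto
  then have "\<psi> m0 \<in> L2 a" using continuous_Ici_set_borel_measurable[OF c\<psi>] by (simp add: L2_def)
  then show thesis using that[of m0] by (simp add: \<psi>_def[abs_def])
qed

text \<open>Otherwise \<open>phi1\<close> would be an element of H_+ vanishing at \<open>a\<close>
  whose energy is \<open>l\<close> times its squared norm, which is negative.\<close>

lemma phi1_not_L2:
  assumes "l < 0"
  shows "phi1 a q (of_real l) \<notin> L2 a"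
proof
  let ?y = "phi1 a q (of_real l)"
  assume y2: "?y \<in> L2 a"
  note y = is_solution_props[OF phi_props(1)[of l]]
  have ly: "(\<lambda>x. of_real l * ?y x) \<in> L2 a" using L2_lincomb[OF y2 y2, of "of_real l" 0] by simp
  have ae: "AE x\<in>{a..} in lebesgue. of_real l * ?y x = L ?y x" using y(2) by eventually_elim auto
  have yH: "?y \<in> H" using y2 y(1) L2_AE_cong[OF ly ae] by (simp add: Hplus_def)
  have "0 \<le> Re (ip a (L ?y) ?y)" using Q_nonneg[OF yH phi_props(2)] phi_props(2)[of l] by (simp add: Q_def E_def)
  also have "ip a (L ?y) ?y = of_real l * ip a ?y ?y"
    using ip_AE_cong[OF ly y2 ae] ip_scale_left[OF y2 y2, of "of_real l"] by simp
  finally have "0 \<le> l * Re (ip a ?y ?y)" by simp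
  then have "Re (ip a ?y ?y) \<le> 0" using \<open>l < 0\<close> by (simp add: zero_le_mult_iff)
  then have "sq_norm_on {a..} ?y \<le> 0" unfolding Re_ip_self(3)[OF y2] .
  moreover have "sq_norm_on {a..a+1} ?y \<le> sq_norm_on {a..} ?y"
    using continuous_sq_integrable[OF twice_acD(4)[OF y(1)] order_refl] L2D(2)[OF y2]
    by (intro integral_subset_le) (auto simp: absolutely_integrable_on_def)
  ultimately show False using phi1_integral_pos[of "a+1" l] by simp
qed

text \<open>Two admissible coefficients would put \<open>phi1\<close> into \<open>L2\<close>, so the
  description defining \<open>m_infty\<close> is unique. The initial values of \<open>phi1\<close>
  and \<open>phi2\<close> make the coefficient the derivative of the solution at
  \<open>a\<close>.\<close>

lemma Weyl_solution:
  assumes "l < 0"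
  obtains \<psi> where "\<psi> \<in> H" "\<psi> a = - 1" "D \<psi> = m_infty a q (of_real l)" "\<And>g. g \<in> L2 a \<Longrightarrow> ip a (L \<psi>) g = of_real l * ip a \<psi> g"
proof -
  let ?f1 = "phi1 a q (of_real l)" and ?f2 = "phi2 a q (of_real l)"
  note f1 = is_solution_props[OF phi_props(1)[of l]] and f2 = is_solution_props[OF phi_props(4)[of l]]
  obtain m where m: "(\<lambda>x. ?f2 x + m * ?f1 x) \<in> L2 a" using Weyl_solution_exists[OF assms] .
  have uniq: "m' = m" if m': "(\<lambda>x. ?f2 x + m' * ?f1 x) \<in> L2 a" for m'
  proof (rule ccontr)
    assume "m' \<noteq> m"
    define c where "c = 1 / (m' - m)"
    have c: "c * m' - c * m = 1" using \<open>m' \<noteq> m\<close> by (simp add: c_def flip: diff_divide_distrib)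
    have "(\<lambda>x. c * (?f2 x + m' * ?f1 x) + (- c) * (?f2 x + m * ?f1 x)) \<in> L2 a"
      by (rule L2_lincomb[OF m' m])
    moreover have "c * (?f2 x + m' * ?f1 x) + (- c) * (?f2 x + m * ?f1 x) = ?f1 x" for x
    proof -
      have "c * (?f2 x + m' * ?f1 x) + (- c) * (?f2 x + m * ?f1 x) = (c * m' - c * m) * ?f1 x" by (simp add: algebra_simps)
      then show ?thesis by (simp only: c mult_1)
    qed
    ultimately show False using phi1_not_L2[OF assms] by simp
  qed
  have mi: "m_infty a q (of_real l) = m" unfolding m_infty_def using m uniq by (rule the_equality)
  let ?\<psi> = "\<lambda>x. 1 * ?f2 x + m * ?f1 x"
  have \<psi>2: "?\<psi> \<in> L2 a" using m by simp
  have l\<psi>: "(\<lambda>x. of_real l * ?\<psi> x) \<in> L2 a" using L2_lincomb[OF \<psi>2 \<psi>2, of "of_real l" 0] by simp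
  have ae: "AE x\<in>{a..} in lebesgue. of_real l * ?\<psi> x = L ?\<psi> x"
    using twice_ac_lincomb(3)[OF f2(1) f1(1), where c=1 and d=m and q=q] f1(2) f2(2)
    by eventually_elim (auto simp: algebra_simps)
  show thesis
  proof (rule that[of ?\<psi>])
    show "?\<psi> \<in> H" using \<psi>2 twice_ac_lincomb(1)[OF f2(1) f1(1)] L2_AE_cong[OF l\<psi> ae] by (simp only: Hplus_def mem_Collect_eq)
    show "?\<psi> a = - 1" using phi_props(2,5)[of l] by simp
    show "D ?\<psi> = m_infty a q (of_real l)"
      using twice_ac_lincomb(2)[OF f2(1) f1(1) order_refl, of 1 m] phi_props(3,6)[of l] mi by simp
    show "ip a (L ?\<psi>) g = of_real l * ip a ?\<psi> g" if "g \<in> L2 a" for g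
      using ip_AE_cong[OF l\<psi> that ae] ip_scale_left[OF \<psi>2 that, of "of_real l"] by simp
  qed
qed

text \<open>Write \<open>y = z - u \<psi>\<close> with \<open>u = y(a)\<close>, so that
  \<open>z\<close> vanishes at \<open>a\<close>. The mixed terms of
  \<open>Q y - l * Re (ip a y y)\<close> cancel by the equation for \<psi>; what remains is the
  non-negative part from \<open>z\<close> and \<open>Re m_infty\<close> times
  \<open>\<bar>u\<bar>\<close> squared.\<close>

lemma Q_ge_m_infty:
  assumes "l < 0" and y: "y \<in> H"
  shows "Q y \<ge> Re (m_infty a q (of_real l)) * (cmod (y a))\<^sup>2 + l * Re (ip a y y)"
proof -
  obtain \<psi> where \<psi>: "\<psi> \<in> H" "\<psi> a = - 1" "D \<psi> = m_infty a q (of_real l)" "\<And>g. g \<in> L2 a \<Longrightarrow> ip a (L \<psi>) g = of_real l * ip a \<psi> g"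
    by (rule Weyl_solution[OF \<open>l < 0\<close>]) (rule that)
  define u where "u = y a"
  define z where "z = (\<lambda>x. 1 * y x + u * \<psi> x)"
  have z: "z \<in> H" unfolding z_def by (rule Hplus_lincomb(1)[OF y \<psi>(1)])
  have za: "z a = 0" using \<psi>(2) by (simp add: z_def u_def)
  have yz: "y = (\<lambda>x. 1 * z x + (- u) * \<psi> x)" by (auto simp: z_def)
  have "E \<psi> z = of_real l * ip a \<psi> z" using \<psi>(4)[OF HplusD(1)[OF z]] za by (simp add: E_def)
  then have Ez: "E z \<psi> = of_real l * ip a z \<psi>"
    using E_hermitian[OF \<psi>(1) z] by (simp add: ip_cnj[of a z \<psi>])
  have Q\<psi>: "Q \<psi> = l * Re (ip a \<psi> \<psi>) + Re (m_infty a q (of_real l))"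
    using \<psi>(4)[OF HplusD(1)[OF \<psi>(1)]] \<psi>(2,3) by (simp add: Q_def E_def)
  let ?X = "ip a z \<psi>"
  define R where "R = Re (cnj (- u) * ?X)"
  have "Re (cnj (- u) * (of_real l * ?X)) = l * R" by (simp add: R_def algebra_simps)
  then have "Q y = Q z + (cmod u)\<^sup>2 * Q \<psi> + 2 * (l * R)"
    using Q_lincomb[OF z \<psi>(1), of 1 "- u"] yz Ez by simp
  moreover have "Re (ip a y y) = Re (ip a z z) + (cmod u)\<^sup>2 * Re (ip a \<psi> \<psi>) + 2 * R"
  proof -
    note z2 = HplusD(1)[OF z] and p2 = HplusD(1)[OF \<psi>(1)] and y2 = HplusD(1)[OF y]
    have "ip a y y = 1 * ip a z y + (- u) * ip a \<psi> y" using ip_lincomb_left[OF z2 p2 y2, of 1 "- u"] yz by simp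
    moreover have "ip a z y = cnj 1 * ip a z z + cnj (- u) * ?X" using ip_lincomb_right[OF z2 p2 z2, of 1 "- u"] yz by simp
    moreover have "ip a \<psi> y = cnj 1 * cnj ?X + cnj (- u) * ip a \<psi> \<psi>"
      using ip_lincomb_right[OF z2 p2 p2, of 1 "- u"] yz by (simp add: ip_cnj[of a \<psi> z])
    ultimately have "ip a y y = ip a z z + (u * cnj u) * ip a \<psi> \<psi> + (cnj (- u) * ?X + cnj (cnj (- u) * ?X))"
      by (simp add: algebra_simps)
    moreover have "u * cnj u = of_real ((cmod u)\<^sup>2)" by (simp only: complex_norm_square)
    moreover have "Re (A + of_real r * B + (t + cnj t)) = Re A + r * Re B + 2 * Re t" for r A B t by simp
    ultimately show ?thesis by (simp only: R_def)
  qed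
  moreover have "Q z \<ge> 0" by (rule Q_nonneg[OF z za])
  moreover have "l * Re (ip a z z) \<le> 0" using Re_ip_self(1)[OF HplusD(1)[OF z]] \<open>l < 0\<close> by (simp add: mult_nonpos_nonneg)
  ultimately show ?thesis unfolding Q\<psi> u_def[symmetric] by (simp add: algebra_simps)
qed

end

section \<open>The limit of \<open>m_infty\<close> and the angle of sectoriality\<close>

locale halfline_form_limit = halfline_form +
  fixes m0 :: real
  assumes limit: "((\<lambda>x. m_infty a q (complex_of_real x)) \<longlongrightarrow> complex_of_real m0) (at_left 0)"
begin

lemma Q_ge_m0:
  assumes y: "y \<in> H"
  shows "Q y \<ge> m0 * (cmod (y a))\<^sup>2"
proof -
  have "((\<lambda>l. Re (m_infty a q (of_real l)) * (cmod (y a))\<^sup>2 + l * Re (ip a y y)) \<longlongrightarrow>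
      Re (of_real m0) * (cmod (y a))\<^sup>2 + 0 * Re (ip a y y)) (at_left 0)"
    by (intro tendsto_intros limit)
  moreover have "\<forall>\<^sub>F l in at_left 0. Re (m_infty a q (of_real l)) * (cmod (y a))\<^sup>2 + l * Re (ip a y y) \<le> Q y"
    unfolding eventually_at_filter using Q_ge_m_infty[OF _ y] by (intro always_eventually) auto
  ultimately have "Re (of_real m0) * (cmod (y a))\<^sup>2 + 0 * Re (ip a y y) \<le> Q y"
    by (intro tendsto_upperbound) auto
  then show ?thesis by simp
qed

text \<open>\<open>- u\<close> times the Weyl solution for \<open>l\<close> close to 0 has value
  \<open>u\<close> and nearly minimal energy. A multiple of the unit derivative sequence then
  adjusts the derivative to \<open>v\<close>.\<close>

lemma Q_near_m0:
  assumes "e > 0"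
  obtains y where "y \<in> H" "y a = u" "D y = v" "Q y < m0 * (cmod u)\<^sup>2 + e"
proof -
  \<comment> \<open>Adding 1 to the denominator covers \<open>u = 0\<close>.\<close>
  define e' where "e' = e / ((cmod u)\<^sup>2 + 1)"
  have up: "(cmod u)\<^sup>2 + 1 > 0" by (simp add: add_nonneg_pos)
  have "e' > 0" using up \<open>e > 0\<close> by (simp add: e'_def)
  have "((\<lambda>l. Re (m_infty a q (of_real l))) \<longlongrightarrow> Re (of_real m0)) (at_left 0)" by (intro tendsto_intros limit)
  then have "\<forall>\<^sub>F l in at_left 0. Re (m_infty a q (of_real l)) < m0 + e'" by (rule order_tendstoD) (use \<open>e' > 0\<close> in simp)
  moreover have "\<forall>\<^sub>F l in at_left (0::real). l < 0" unfolding eventually_at_filter by (intro always_eventually) auto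
  ultimately have "\<forall>\<^sub>F l in at_left 0. Re (m_infty a q (of_real l)) < m0 + e' \<and> l < 0" by (rule eventually_conj)
  then obtain l where l: "Re (m_infty a q (of_real l)) < m0 + e'" "l < 0"
    using eventually_happens[of _ "at_left (0::real)"] by force
  obtain \<psi> where \<psi>: "\<psi> \<in> H" "\<psi> a = - 1" "D \<psi> = m_infty a q (of_real l)" "\<And>g. g \<in> L2 a \<Longrightarrow> ip a (L \<psi>) g = of_real l * ip a \<psi> g"
    by (rule Weyl_solution[OF \<open>l < 0\<close>]) (rule that)
  have "Q \<psi> = l * Re (ip a \<psi> \<psi>) + Re (m_infty a q (of_real l))"
    using \<psi>(4)[OF HplusD(1)[OF \<psi>(1)]] \<psi>(2,3) by (simp add: Q_def E_def)
  moreover have "l * Re (ip a \<psi> \<psi>) \<le> 0" using Re_ip_self(1)[OF HplusD(1)[OF \<psi>(1)]] l(2) by (simp add: mult_nonpos_nonneg)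
  ultimately have "Q \<psi> < m0 + e'" using l(1) by simp
  then have "(cmod u)\<^sup>2 * Q \<psi> \<le> (cmod u)\<^sup>2 * (m0 + e')" by (intro mult_left_mono) auto
  also have "\<dots> < m0 * (cmod u)\<^sup>2 + e"
  proof -
    have "(cmod u)\<^sup>2 * e' < ((cmod u)\<^sup>2 + 1) * e'" using \<open>e' > 0\<close> by simp
    also have "\<dots> = e" using up by (simp add: e'_def)
    finally show ?thesis by (simp add: algebra_simps)
  qed
  finally have Qu: "(cmod u)\<^sup>2 * Q \<psi> < m0 * (cmod u)\<^sup>2 + e" .
  \<comment> \<open>The derivative missing in \<open>- u\<close> times \<psi>.\<close>
  define t where "t = v + u * D \<psi>"
  obtain z where z: "\<And>n. z n \<in> H" "\<And>n. z n a = 0" "\<And>n. D (z n) = 1"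
    "(\<lambda>n. Q (z n)) \<longlonglongrightarrow> 0" "\<And>f. f \<in> L2 a \<Longrightarrow> (\<lambda>n. ip a f (z n)) \<longlonglongrightarrow> 0"
    by (rule unit_derivative_sequence) (rule that)
  have Ez: "E \<psi> (z n) = ip a (L \<psi>) (z n)" for n using z(2) by (simp add: E_def)
  let ?w = "\<lambda>n x. (- u) * \<psi> x + t * z n x"
  have "(\<lambda>n. Q (?w n)) \<longlonglongrightarrow> (cmod (- u))\<^sup>2 * Q \<psi> + (cmod t)\<^sup>2 * 0 + 2 * Re ((- u) * cnj t * 0)"
    unfolding Q_lincomb[OF \<psi>(1) z(1)] Ez by (intro tendsto_intros z(4) z(5)[OF HplusD(3)[OF \<psi>(1)]])
  then have "(\<lambda>n. Q (?w n)) \<longlonglongrightarrow> (cmod u)\<^sup>2 * Q \<psi>" by simp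
  from order_tendstoD(2)[OF this Qu] obtain n where n: "Q (?w n) < m0 * (cmod u)\<^sup>2 + e"
    by (auto simp: eventually_sequentially)
  show thesis
  proof (rule that[of "?w n"])
    show "?w n \<in> H" by (rule Hplus_lincomb(1)[OF \<psi>(1) z(1)])
    show "?w n a = u" using \<psi>(2) z(2) by simp
    show "D (?w n) = v" using Hplus_lincomb(2)[OF \<psi>(1) z(1), of "- u" t n] z(3) by (simp add: t_def)
    show "Q (?w n) < m0 * (cmod u)\<^sup>2 + e" by (rule n)
  qed
qed

text \<open>Functions of nearly minimal energy with \<open>y(a) = 1\<close> and
  \<open>y'(a) = h\<close> give one inequality from sectoriality. Conversely the lower bound for the
  energy keeps every quotient below \<open>Im h / (m0 + Re h)\<close>, and by exactness
  \<open>tan \<alpha>\<close> is their supremum.\<close>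

lemma exact_angle:
  assumes h: "Im h > 0" and \<alpha>: "0 < \<alpha>" "\<alpha> < pi / 2"
    and ex: "exact_sectorial_op a (T_dom a q h) L \<alpha>"
  shows "cot \<alpha> * Im h = m0 + Re h" "m0 + Re h > 0"
proof -
  have T: "ip a (L f) f = of_real (Q f) + h * of_real ((cmod (f a))\<^sup>2)" if "f \<in> T_dom a q h" for f
  proof -
    have "f \<in> H" "D f = h * f a" using that by (auto simp: T_dom_def)
    then show ?thesis using E_self[of f] by (simp only: complex_norm_square mult.assoc)
  qed
  have TR: "Re (ip a (L f) f) = Q f + Re h * (cmod (f a))\<^sup>2" "Im (ip a (L f) f) = Im h * (cmod (f a))\<^sup>2"
    if "f \<in> T_dom a q h" for f unfolding T[OF that] by simp_all
  have tan: "tan \<alpha> > 0" using \<alpha> by (intro tan_gt_zero)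
  then have cot: "cot \<alpha> > 0" "cot \<alpha> * tan \<alpha> = 1" using \<alpha> cos_gt_zero[of \<alpha>] sin_gt_zero[of \<alpha>]
    by (auto simp: cot_def tan_def)
  have sec: "cot \<alpha> * \<bar>Im (ip a (L f) f)\<bar> \<le> Re (ip a (L f) f)" if "f \<in> T_dom a q h" for f
    using ex that by (auto simp: exact_sectorial_op_def exact_sectorial_form_def sectorial_form_def)
  have le: "cot \<alpha> * Im h \<le> m0 + Re h"
  proof (rule field_le_epsilon)
    fix e :: real assume "e > 0"
    then obtain y where y: "y \<in> H" "y a = 1" "D y = h" "Q y < m0 * (cmod 1)\<^sup>2 + e" by (rule Q_near_m0)
    then have "y \<in> T_dom a q h" by (simp add: T_dom_def)
    from sec[OF this] TR[OF this] show "cot \<alpha> * Im h \<le> m0 + Re h + e" using y h by simp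
  qed
  then show pos: "m0 + Re h > 0" using cot(1) h by (meson less_le_trans mult_pos_pos)
  have "tan \<alpha> = (SUP f\<in>T_dom a q h. \<bar>Im (ip a (L f) f)\<bar> / Re (ip a (L f) f))"
    using ex by (simp add: exact_sectorial_op_def exact_sectorial_form_def)
  also have "\<dots> \<le> Im h / (m0 + Re h)"
  proof (rule cSUP_least)
    obtain y where "y \<in> H" "y a = 1" "D y = h" "Q y < m0 * (cmod 1)\<^sup>2 + 1" using Q_near_m0[OF zero_less_one] by blast
    then have "y \<in> T_dom a q h" by (simp add: T_dom_def)
    then show "T_dom a q h \<noteq> {}" by blast
    fix f assume f: "f \<in> T_dom a q h"
    show "\<bar>Im (ip a (L f) f)\<bar> / Re (ip a (L f) f) \<le> Im h / (m0 + Re h)"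
    \<comment> \<open>If \<open>f a = 0\<close> the numerator vanishes and the quotient is 0, also
      when the denominator is 0.\<close>
    proof (cases "f a = 0")
      case True
      then show ?thesis unfolding TR[OF f] using h pos by simp
    next
      case False
      define s where "s = (cmod (f a))\<^sup>2"
      have "s > 0" using False by (simp add: s_def)
      have "Q f \<ge> m0 * s" using Q_ge_m0[of f] f by (simp add: T_dom_def s_def)
      then have "Q f + Re h * s \<ge> (m0 + Re h) * s" by (simp add: algebra_simps)
      moreover have "(m0 + Re h) * s > 0" using pos \<open>s > 0\<close> by simp
      ultimately have "Q f + Re h * s > 0" "(m0 + Re h) * s \<le> Q f + Re h * s" by linarith+
      then have "Im h * s / (Q f + Re h * s) \<le> Im h * s / ((m0 + Re h) * s)"
        using h \<open>s > 0\<close> pos by (intro divide_left_mono mult_pos_pos) auto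
      also have "\<dots> = Im h / (m0 + Re h)" using \<open>s > 0\<close> by simp
      finally show ?thesis unfolding TR[OF f] s_def[symmetric] using h \<open>s > 0\<close> by simp
    qed
  qed
  finally have "tan \<alpha> * (m0 + Re h) \<le> Im h" using pos by (simp add: field_simps)
  then have "cot \<alpha> * (tan \<alpha> * (m0 + Re h)) \<le> cot \<alpha> * Im h" using cot(1) by (intro mult_left_mono) auto
  then have "m0 + Re h \<le> cot \<alpha> * Im h" using cot(2) by (simp flip: mult.assoc)
  then show "cot \<alpha> * Im h = m0 + Re h" using le by simp
qed

section \<open>The quadratic form of the associated operator\<close>

lemma associated_op_form:
  assumes y: "y \<in> H" and h: "Im h > 0"
  shows "Re (associated_op a q (A_mu a q h (ereal r)) y y) =
      Q y + r * (cmod (y a))\<^sup>2 - (r - Re h) * ((cmod (of_real r * y a - D y))\<^sup>2 / (cmod (of_real r - h))\<^sup>2)"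
    "Im (associated_op a q (A_mu a q h (ereal r)) y y) =
      - (Im h * ((cmod (of_real r * y a - D y))\<^sup>2 / (cmod (of_real r - h))\<^sup>2))"
proof -
  define u v X w d where "u = y a" and "v = D y" and "X = ip a (L y) y" and "w = of_real r * u - v" and "d = of_real r - h"
  have "d \<noteq> 0" using h by (auto simp: d_def complex_eq_iff)
  have X: "X = of_real (Q y) + v * cnj u" using E_self[OF y] by (simp add: X_def u_def v_def)
  \<comment> \<open>Twice the real part of \<open>X\<close> minus \<open>X\<close> leaves
    \<open>cnj X\<close>. Rewriting the rest through \<open>w\<close> and \<open>d\<close> isolates
    the only non-real term, a multiple of \<open>cnj d\<close>.\<close>
  have "associated_op a q (A_mu a q h (ereal r)) y y =
     cnj X + 1 / d * (v - h * u) * (of_real r * cnj u - cnj v)"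
    by (simp add: associated_op_def Re_op_def adj_op_def Astar_def A_mu_def delta_def delta'_def
        X_def[symmetric] u_def[symmetric] v_def[symmetric] d_def[symmetric], simp add: field_simps)
  also have "v - h * u = d * u - w" by (simp add: d_def w_def algebra_simps)
  also have "of_real r * cnj u - cnj v = cnj w" by (simp add: w_def)
  also have "1 / d * (d * u - w) * cnj w = u * cnj w - (w * cnj w) / d" using \<open>d \<noteq> 0\<close> by (simp add: field_simps)
  also have "(w * cnj w) / d = of_real ((cmod w)\<^sup>2 / (cmod d)\<^sup>2) * cnj d"
  proof -
    have "complex_of_real ((cmod w)\<^sup>2 / (cmod d)\<^sup>2) = (w * cnj w) / (d * cnj d)"
      by (simp only: of_real_divide complex_norm_square)
    then show ?thesis using \<open>d \<noteq> 0\<close> by simp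
  qed
  also have "cnj X + (u * cnj w - of_real ((cmod w)\<^sup>2 / (cmod d)\<^sup>2) * cnj d) =
      of_real (Q y) + of_real r * (u * cnj u) - of_real ((cmod w)\<^sup>2 / (cmod d)\<^sup>2) * cnj d"
    by (simp add: X w_def algebra_simps)
  also have "u * cnj u = of_real ((cmod u)\<^sup>2)" by (simp only: complex_norm_square)
  finally have e: "associated_op a q (A_mu a q h (ereal r)) y y =
     of_real (Q y) + of_real r * of_real ((cmod u)\<^sup>2) - of_real ((cmod w)\<^sup>2 / (cmod d)\<^sup>2) * cnj d" .
  have rr: "Re (of_real A + of_real r * of_real B - of_real C * cnj d) = A + r * B - (r - Re h) * C"
    "Im (of_real A + of_real r * of_real B - of_real C * cnj d) = - (Im h * C)" for A B C
    by (simp_all add: d_def algebra_simps)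
  show "Re (associated_op a q (A_mu a q h (ereal r)) y y) =
      Q y + r * (cmod (y a))\<^sup>2 - (r - Re h) * ((cmod (of_real r * y a - D y))\<^sup>2 / (cmod (of_real r - h))\<^sup>2)"
    unfolding e rr by (simp only: u_def v_def w_def d_def)
  show "Im (associated_op a q (A_mu a q h (ereal r)) y y) =
      - (Im h * ((cmod (of_real r * y a - D y))\<^sup>2 / (cmod (of_real r - h))\<^sup>2))"
    unfolding e rr by (simp only: u_def v_def w_def d_def)
qed

lemma accumulative_iff_associated_nonneg:
  "accumulative a q B \<longleftrightarrow> (\<forall>f\<in>H. 0 \<le> Re (associated_op a q B f f))"
  by (simp add: accumulative_def associated_op_def Re_op_def adj_op_def Astar_def ip_cnj[of a _ "L _"])

text \<open>The form of the associated operator now contains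
  \<open>2 * Re (D y * cnj (y a))\<close>. This is linear in \<open>D y\<close>, which can be
  prescribed while the energy stays bounded, so the form is unbounded below for fixed
  \<open>y a\<close>.\<close>

lemma not_accumulative_infinite:
  assumes "\<mu> = \<infinity> \<or> \<mu> = - \<infinity>"
  shows "\<not> accumulative a q (A_mu a q h \<mu>)"
proof
  assume acc: "accumulative a q (A_mu a q h \<mu>)"
  \<comment> \<open>Chosen so that \<open>2 * t\<close> exceeds \<open>m0 + 1 - Re h\<close>, a
    bound for the remaining terms when \<open>y a = 1\<close>.\<close>
  define t where "t = (\<bar>m0 + 1 - Re h\<bar> + 1) / 2"
  obtain y where y: "y \<in> H" "y a = 1" "D y = of_real (- t)" "Q y < m0 * (cmod 1)\<^sup>2 + 1" using Q_near_m0[OF zero_less_one] by blast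
  have "ip a (L y) y = of_real (Q y) + of_real (- t)" using E_self[OF y(1)] y by simp
  then have "Re (associated_op a q (A_mu a q h \<mu>) y y) = Q y - 2 * t - Re h"
    using assms y by (auto simp: associated_op_def Re_op_def adj_op_def Astar_def A_mu_def delta_def)
  moreover have "0 \<le> Re (associated_op a q (A_mu a q h \<mu>) y y)"
    using acc y(1) accumulative_iff_associated_nonneg by blast
  moreover have "2 * t = \<bar>m0 + 1 - Re h\<bar> + 1" by (simp add: t_def)
  moreover have "Q y < m0 + 1" using y(4) by simp
  ultimately show False by linarith
qed

end

theorem theorem6:
  fixes a :: real and q :: "real \<Rightarrow> real" and h :: complex and \<mu> :: ereal
    and m0 \<alpha> :: real and \<Theta> :: l_system
  assumes "locally_summable a q"
    and "symmetric_on a (Adot_dom a q) (lop a q)"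
    and "deficiency_indices_1_1 a (Adot_dom a q) (lop a q)"
    and "nonneg_on a (Adot_dom a q) (lop a q)"
    and "((\<lambda>x. m_infty a q (complex_of_real x)) \<longlongrightarrow> complex_of_real m0) (at_left 0)"
    and "Im h > 0"
    and "0 < \<alpha>" and "\<alpha> < pi / 2"
    and "exact_sectorial_op a (T_dom a q h) (lop a q) \<alpha>"
    and "\<Theta> = schroedinger_l_system a q h \<mu>"
    and "accumulative a q (state_operator \<Theta>)"
  shows "sectorial_pm a q (associated_op a q (state_operator \<Theta>)) \<alpha> \<longleftrightarrow> \<mu> = ereal (- m0)"
proof -
  interpret halfline_form_limit a q m0
    by unfold_locales (rule assms)+
  have so: "state_operator \<Theta> = A_mu a q h \<mu>" using assms(10) by (simp add: schroedinger_l_system_def)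
  have acc: "accumulative a q (A_mu a q h \<mu>)" using assms(11) so by simp
  then obtain r where r: "\<mu> = ereal r" using not_accumulative_infinite by (cases \<mu>) auto
  note angle = exact_angle[OF assms(6-9)]
  note form = associated_op_form[OF _ assms(6), of _ r]
  have s: "(cmod (of_real r - h))\<^sup>2 > 0" using assms(6) by (auto simp: complex_eq_iff)
  show ?thesis unfolding so r
  proof
    assume "ereal r = ereal (- m0)"
    then have r0: "r = - m0" by simp
    show "sectorial_pm a q (associated_op a q (A_mu a q h (ereal r))) \<alpha>"
      unfolding sectorial_pm_def sectorial_form_def
    proof
      fix y assume y: "y \<in> H"
      define W where "W = (cmod (of_real r * y a - D y))\<^sup>2 / (cmod (of_real r - h))\<^sup>2"
      have "W \<ge> 0" by (simp add: W_def)
      \<comment> \<open>For \<open>r = - m0\<close> the angle identity makes the terms in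
        \<open>W\<close> cancel, which leaves just the lower bound for the energy.\<close>
      have "cot \<alpha> * \<bar>- (Im h * W)\<bar> = (m0 + Re h) * W"
        using \<open>W \<ge> 0\<close> assms(6) angle(1) by (simp add: abs_mult flip: mult.assoc)
      also have "\<dots> \<le> Q y + r * (cmod (y a))\<^sup>2 - (r - Re h) * W" using Q_ge_m0[OF y] r0 by (simp add: algebra_simps)
      finally show "cot \<alpha> * \<bar>Im (associated_op a q (A_mu a q h (ereal r)) y y)\<bar> \<le> Re (associated_op a q (A_mu a q h (ereal r)) y y)"
        unfolding form[OF y] W_def .
    qed
  next
    assume sec: "sectorial_pm a q (associated_op a q (A_mu a q h (ereal r))) \<alpha>"
    have "- m0 \<le> r"
    proof -
      have "0 \<le> m0 + r + e" if e: "e > 0" for e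
      proof -
        \<comment> \<open>The derivative \<open>r\<close> makes \<open>w\<close> vanish, so the form
          reduces to \<open>Q y + r\<close>.\<close>
        obtain y where y: "y \<in> H" "y a = 1" "D y = of_real r" "Q y < m0 * (cmod 1)\<^sup>2 + e" using Q_near_m0[OF e] by blast
        have "0 \<le> Re (associated_op a q (A_mu a q h (ereal r)) y y)"
          using acc y(1) accumulative_iff_associated_nonneg unfolding r by blast
        then show ?thesis unfolding form[OF y(1)] using y by simp
      qed
      then have "0 \<le> m0 + r" using field_le_epsilon[of 0 "m0 + r"] by blast
      then show ?thesis by simp
    qed
    moreover have "r \<le> - m0"
    proof -
      have "(m0 + r) / (cmod (of_real r - h))\<^sup>2 \<le> 0 + e" if e: "e > 0" for e
      proof -
        \<comment> \<open>With \<open>y a = 0\<close> the energy can be made arbitrarily small while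
          \<open>w = - 1\<close> stays fixed, so only the terms in \<open>w\<close> count.\<close>
        obtain y where y: "y \<in> H" "y a = 0" "D y = 1" "Q y < m0 * (cmod 0)\<^sup>2 + e" using Q_near_m0[OF e] by blast
        define S where "S = 1 / (cmod (of_real r - h))\<^sup>2"
        have "S \<ge> 0" by (simp add: S_def)
        have "cot \<alpha> * \<bar>- (Im h * S)\<bar> \<le> Q y - (r - Re h) * S"
          using sec y unfolding sectorial_pm_def sectorial_form_def by (auto simp: form[OF y(1)] S_def)
        moreover have "cot \<alpha> * \<bar>- (Im h * S)\<bar> = (m0 + Re h) * S"
          using \<open>S \<ge> 0\<close> assms(6) angle(1) by (simp add: abs_mult flip: mult.assoc)
        ultimately have "(m0 + r) * S \<le> Q y" by (simp add: algebra_simps)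
        then show ?thesis using y(4) by (simp add: S_def)
      qed
      then have "(m0 + r) / (cmod (of_real r - h))\<^sup>2 \<le> 0" by (rule field_le_epsilon)
      then show ?thesis using s by (simp add: divide_le_0_iff)
    qed
    ultimately show "ereal r = ereal (- m0)" by simp
  qed
qed

end
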